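(* The 2-category $\mathbf{IdxPos}$ of indexed posets has Kleisli objects for comonads; that is, the 2-functor $\mathrm{Inc}:\mathbf{IdxPos}\to\mathrm{Cmd}^*(\mathbf{IdxPos})$ sending every indexed poset to the identity comonad on it has a left 2-adjoint $\mathrm{Cmd}^*(\mathbf{IdxPos})\to\mathbf{IdxPos}$.
   Context: $\mathbf{Pos}$ is the category of posets and monotone functions. The 2-category $\mathbf{IdxPos}$. A 0-cell is a functor $P:\mathbb C^{\mathrm{op}}\to\mathbf{Pos}$ ($\mathbb C$ any category). A 1-cell from $P:\mathbb C^{\mathrm{op}}\to\mathbf{Pos}$ to $R:\mathbb D^{\mathrm{op}}\to\mathbf{Pos}$ is a pair $(F,\mathfrak f)$ with $F:\mathbb C\to\mathbb D$ a functor and $\mathfrak f:P\to R\circ F^{\mathrm{op}}$ a natural transformation; composition is $(G,\mathfrak g)(F,\mathfrak f)=(GF,(\mathfrak g_{FA}\mathfrak f_A)_A)$. A 2-cell $(F,\mathfrak f)\Rightarrow(G,\mathfrak g):P\to R$ is a natural transformation $\theta:F\to G$ such that $\mathfrak f_A(\alpha)\le R(\theta_A)(\mathfrak g_A(\alpha))$ for all objects $A$ of $\mathbb C$ and $\alpha\in P(A)$. Compositions of 2-cells are those of natural transformations. A comonad in $\mathbf{IdxPos}$ is $(P,(K,\mathfrak k),\gamma,\varepsilon)$ with $P:\mathbb C^{\mathrm{op}}\to\mathbf{Pos}$ a 0-cell, $(K,\mathfrak k):P\to P$ a 1-cell, and $\gamma:(K,\mathfrak k)\Rightarrow(K,\mathfrak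 k)^2$, $\varepsilon:(K,\mathfrak k)\Rightarrow\mathrm{id}_P$ 2-cells such that $(K,\gamma,\varepsilon)$ is a comonad on $\mathbb C$. The 2-category $\mathrm{Cmd}^*(\mathbf{IdxPos})$. A 0-cell is a comonad in $\mathbf{IdxPos}$. A 1-cell from $(P,(K,\mathfrak k),\gamma,\varepsilon)$ to $(P',(K',\mathfrak k'),\gamma',\varepsilon')$ is a pair $((F,\mathfrak f),\mathfrak j)$ where $(F,\mathfrak f):P\to P'$ is a 1-cell of $\mathbf{IdxPos}$ and $\mathfrak j:(K',\mathfrak k')(F,\mathfrak f)\Rightarrow(F,\mathfrak f)(K,\mathfrak k)$ is a 2-cell of $\mathbf{IdxPos}$ (so $\mathfrak j:K'F\to FK$ is natural with $\mathfrak k'_{FA}\mathfrak f_A(\alpha)\le P'(\mathfrak j_A)\mathfrak f_{KA}\mathfrak k_A(\alpha)$) satisfying $F(\gamma)\circ\mathfrak j=\mathfrak j_K\circ K'(\mathfrak j)\circ\gamma'_F$ and $F(\varepsilon)\circ\mathfrak j=\varepsilon'_F$. A 2-cell $((F,\mathfrak f),\mathfrak j)\Rightarrow((G,\mathfrak g),\mathfrak h)$ is a 2-cell $\eta:(F,\mathfrak f)\Rightarrow(G,\mathfrak g)$ of $\mathbf{IdxPos}$ such that $\eta_K\circ\mathfrak j=\mathfrak h\circ K'(\eta)$. The 2-functor $\mathrm{Inc}$ sends $P$ to $(P,\mathrm{id}_P,\mathrm{id},\mathrm{id})$, a 1-cell $(F,\mathfrak f)$ to $((F,\mathfrak f),\mathrm{id})$,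 and a 2-cell to itself. *)

theory Defs
  imports "HOL-Library.FuncSet"
begin

section \<open>Categories, functors, natural transformations\<close>

text \<open>
  Categories are given by hom-sets indexed by pairs of objects; different hom-sets need not be
  disjoint, so domain and codomain are arguments of composition: for \<open>f\<close> in \<open>Hom C A B\<close> and
  \<open>g\<close> in \<open>Hom C B D\<close> the composite is \<open>Cmp C A B D g f\<close>.

  Throughout this section all operations are required to take the value \<open>undefined\<close> outside of
  their domain, so that HOL equality of categories, functors and transformations is the intended
  equality.
\<close>

record ('o, 'a) cat =
  Obj :: "'o set"
  Hom :: "'o \<Rightarrow> 'o \<Rightarrow> 'a set"
  Idm :: "'o \<Rightarrow> 'a"
  Cmp :: "'o \<Rightarrow> 'o \<Rightarrow> 'o \<Rightarrow> 'a \<Rightarrow> 'a \<Rightarrow> 'a"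

locale is_category =
  fixes C :: "('o, 'a) cat"
  assumes Hom_Obj: "f \<in> Hom C A B \<Longrightarrow> A \<in> Obj C \<and> B \<in> Obj C"
    and Idm_Hom: "A \<in> Obj C \<Longrightarrow> Idm C A \<in> Hom C A A"
    and Cmp_Hom: "\<lbrakk>f \<in> Hom C A B; g \<in> Hom C B D\<rbrakk> \<Longrightarrow> Cmp C A B D g f \<in> Hom C A D"
    and Cmp_Idm_right: "f \<in> Hom C A B \<Longrightarrow> Cmp C A A B f (Idm C A) = f"
    and Cmp_Idm_left: "f \<in> Hom C A B \<Longrightarrow> Cmp C A B B (Idm C B) f = f"
    and Cmp_assoc: "\<lbrakk>f \<in> Hom C A B; g \<in> Hom C B D; h \<in> Hom C D E\<rbrakk>
          \<Longrightarrow> Cmp C A D E h (Cmp C A B D g f) = Cmp C A B E (Cmp C B D E h g) f"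
    and Idm_ext: "Idm C \<in> extensional (Obj C)"
    and Cmp_ext: "\<not> (f \<in> Hom C A B \<and> g \<in> Hom C B D) \<Longrightarrow> Cmp C A B D g f = undefined"

definition Op :: "('o, 'a) cat \<Rightarrow> ('o, 'a) cat" where
  "Op C = \<lparr>Obj = Obj C, Hom = (\<lambda>A B. Hom C B A), Idm = Idm C,
           Cmp = (\<lambda>A B D g f. Cmp C D B A f g)\<rparr>"

record ('o, 'a, 'o2, 'a2) fctr =
  fobj :: "'o \<Rightarrow> 'o2"
  farr :: "'o \<Rightarrow> 'o \<Rightarrow> 'a \<Rightarrow> 'a2"

locale is_functor =
  fixes C :: "('o, 'a) cat" and D :: "('o2, 'a2) cat" and F :: "('o, 'a, 'o2, 'a2) fctr"
  assumes source: "is_category C"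
    and target: "is_category D"
    and fobj_type: "fobj F \<in> Obj C \<rightarrow>\<^sub>E Obj D"
    and farr_type: "farr F A B \<in> Hom C A B \<rightarrow>\<^sub>E Hom D (fobj F A) (fobj F B)"
    and farr_Idm: "A \<in> Obj C \<Longrightarrow> farr F A A (Idm C A) = Idm D (fobj F A)"
    and farr_Cmp: "\<lbrakk>f \<in> Hom C A B; g \<in> Hom C B E\<rbrakk>
          \<Longrightarrow> farr F A E (Cmp C A B E g f)
              = Cmp D (fobj F A) (fobj F B) (fobj F E) (farr F B E g) (farr F A B f)"

definition id_fctr :: "('o, 'a) cat \<Rightarrow> ('o, 'a, 'o, 'a) fctr" where
  "id_fctr C = \<lparr>fobj = (\<lambda>A\<in>Obj C. A), farr = (\<lambda>A B. \<lambda>f\<in>Hom C A B. f)\<rparr>"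

text \<open>The composite \<open>G \<circ> F\<close>, where \<open>C\<close> is the source category of \<open>F\<close>.\<close>

definition comp_fctr ::
    "('o, 'a) cat \<Rightarrow> ('o2, 'a2, 'o3, 'a3) fctr \<Rightarrow> ('o, 'a, 'o2, 'a2) fctr
      \<Rightarrow> ('o, 'a, 'o3, 'a3) fctr" where
  "comp_fctr C G F =
     \<lparr>fobj = (\<lambda>A\<in>Obj C. fobj G (fobj F A)),
      farr = (\<lambda>A B. \<lambda>f\<in>Hom C A B. farr G (fobj F A) (fobj F B) (farr F A B f))\<rparr>"

definition op_fctr :: "('o, 'a, 'o2, 'a2) fctr \<Rightarrow> ('o, 'a, 'o2, 'a2) fctr" where
  "op_fctr F = \<lparr>fobj = fobj F, farr = (\<lambda>A B. farr F B A)\<rparr>"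

locale is_nat_trans =
  fixes C :: "('o, 'a) cat" and D :: "('o2, 'a2) cat"
    and F G :: "('o, 'a, 'o2, 'a2) fctr" and \<theta> :: "'o \<Rightarrow> 'a2"
  assumes source: "is_functor C D F"
    and target: "is_functor C D G"
    and component: "A \<in> Obj C \<Longrightarrow> \<theta> A \<in> Hom D (fobj F A) (fobj G A)"
    and natural: "f \<in> Hom C A B
          \<Longrightarrow> Cmp D (fobj F A) (fobj F B) (fobj G B) (\<theta> B) (farr F A B f)
              = Cmp D (fobj F A) (fobj G A) (fobj G B) (farr G A B f) (\<theta> A)"
    and ext: "\<theta> \<in> extensional (Obj C)"


section \<open>The category of posets\<close>

record 'p poset =
  pts :: "'p set"
  ple :: "'p rel"

definition Pos :: "('p poset, 'p \<Rightarrow> 'p) cat" where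
  "Pos =
    (let Ob = {X. partial_order_on (pts X) (ple X)};
         Mon = (\<lambda>X Y. {f \<in> pts X \<rightarrow>\<^sub>E pts Y.
                  X \<in> Ob \<and> Y \<in> Ob \<and> (\<forall>x y. (x, y) \<in> ple X \<longrightarrow> (f x, f y) \<in> ple Y)})
     in \<lparr>Obj = Ob, Hom = Mon,
         Idm = (\<lambda>X\<in>Ob. \<lambda>x\<in>pts X. x),
         Cmp = (\<lambda>X Y Z g f. if f \<in> Mon X Y \<and> g \<in> Mon Y Z then compose (pts X) g f else undefined)\<rparr>)"


section \<open>Strict 2-categories, 2-functors and 2-adjunctions\<close>

text \<open>
  Here 1-cells and 2-cells carry their boundary. \<open>g \<odot> f\<close> is composition of 1-cells
  (\<open>f\<close> first), \<open>b \<cdot> a\<close> is vertical and \<open>b \<star> a\<close> horizontal composition of 2-cells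
  (\<open>a\<close> first). Whiskering is horizontal composition with an identity 2-cell.
\<close>

record ('x, 'm, 'c) two_cat =
  Cell0 :: "'x set"
  Cell1 :: "'m set"
  Cell2 :: "'c set"
  Src :: "'m \<Rightarrow> 'x"
  Tgt :: "'m \<Rightarrow> 'x"
  Dom :: "'c \<Rightarrow> 'm"
  Cod :: "'c \<Rightarrow> 'm"
  Id1 :: "'x \<Rightarrow> 'm"
  Id2 :: "'m \<Rightarrow> 'c"
  Comp1 :: "'m \<Rightarrow> 'm \<Rightarrow> 'm" (infixr "\<odot>\<index>" 75)
  VComp :: "'c \<Rightarrow> 'c \<Rightarrow> 'c" (infixr "\<cdot>\<index>" 70)
  HComp :: "'c \<Rightarrow> 'c \<Rightarrow> 'c" (infixr "\<star>\<index>" 75)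

definition hom1 :: "('x, 'm, 'c) two_cat \<Rightarrow> 'x \<Rightarrow> 'x \<Rightarrow> 'm set" where
  "hom1 K X Y = {f \<in> Cell1 K. Src K f = X \<and> Tgt K f = Y}"

definition hom2 :: "('x, 'm, 'c) two_cat \<Rightarrow> 'm \<Rightarrow> 'm \<Rightarrow> 'c set" where
  "hom2 K f g = {a \<in> Cell2 K. Dom K a = f \<and> Cod K a = g}"

locale is_two_category =
  fixes K :: "('x, 'm, 'c) two_cat" (structure)
  assumes Src_Cell0: "f \<in> Cell1 K \<Longrightarrow> Src K f \<in> Cell0 K"
    and Tgt_Cell0: "f \<in> Cell1 K \<Longrightarrow> Tgt K f \<in> Cell0 K"
    and Dom_Cell1: "a \<in> Cell2 K \<Longrightarrow> Dom K a \<in> Cell1 K"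
    and Cod_Cell1: "a \<in> Cell2 K \<Longrightarrow> Cod K a \<in> Cell1 K"
    and parallel: "a \<in> Cell2 K \<Longrightarrow>
          Src K (Dom K a) = Src K (Cod K a) \<and> Tgt K (Dom K a) = Tgt K (Cod K a)"
    \<comment> \<open>1-cells\<close>
    and Id1_hom: "X \<in> Cell0 K \<Longrightarrow> Id1 K X \<in> hom1 K X X"
    and Comp1_hom: "\<lbrakk>f \<in> hom1 K X Y; g \<in> hom1 K Y Z\<rbrakk> \<Longrightarrow> g \<odot> f \<in> hom1 K X Z"
    and Comp1_Id1_right: "f \<in> hom1 K X Y \<Longrightarrow> f \<odot> Id1 K X = f"
    and Comp1_Id1_left: "f \<in> hom1 K X Y \<Longrightarrow> Id1 K Y \<odot> f = f"
    and Comp1_assoc: "\<lbrakk>f \<in> hom1 K X Y; g \<in> hom1 K Y Z; h \<in> hom1 K Z W\<rbrakk>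
          \<Longrightarrow> h \<odot> (g \<odot> f) = (h \<odot> g) \<odot> f"
    \<comment> \<open>vertical composition\<close>
    and Id2_hom: "f \<in> Cell1 K \<Longrightarrow> Id2 K f \<in> hom2 K f f"
    and VComp_hom: "\<lbrakk>a \<in> hom2 K f g; b \<in> hom2 K g h\<rbrakk> \<Longrightarrow> b \<cdot> a \<in> hom2 K f h"
    and VComp_Id2_right: "a \<in> hom2 K f g \<Longrightarrow> a \<cdot> Id2 K f = a"
    and VComp_Id2_left: "a \<in> hom2 K f g \<Longrightarrow> Id2 K g \<cdot> a = a"
    and VComp_assoc: "\<lbrakk>a \<in> hom2 K f g; b \<in> hom2 K g h; c \<in> hom2 K h k\<rbrakk>
          \<Longrightarrow> c \<cdot> (b \<cdot> a) = (c \<cdot> b) \<cdot> a"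
    \<comment> \<open>horizontal composition\<close>
    and HComp_hom: "\<lbrakk>f \<in> hom1 K X Y; a \<in> hom2 K f f'; g \<in> hom1 K Y Z; b \<in> hom2 K g g'\<rbrakk>
          \<Longrightarrow> b \<star> a \<in> hom2 K (g \<odot> f) (g' \<odot> f')"
    and HComp_Id_right: "\<lbrakk>f \<in> hom1 K X Y; a \<in> hom2 K f f'\<rbrakk> \<Longrightarrow> a \<star> Id2 K (Id1 K X) = a"
    and HComp_Id_left: "\<lbrakk>f \<in> hom1 K X Y; a \<in> hom2 K f f'\<rbrakk> \<Longrightarrow> Id2 K (Id1 K Y) \<star> a = a"
    and HComp_assoc: "\<lbrakk>f \<in> hom1 K X Y; a \<in> hom2 K f f'; g \<in> hom1 K Y Z; b \<in> hom2 K g g';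
            h \<in> hom1 K Z W; c \<in> hom2 K h h'\<rbrakk> \<Longrightarrow> c \<star> (b \<star> a) = (c \<star> b) \<star> a"
    and HComp_Id2: "\<lbrakk>f \<in> hom1 K X Y; g \<in> hom1 K Y Z\<rbrakk>
          \<Longrightarrow> Id2 K g \<star> Id2 K f = Id2 K (g \<odot> f)"
    and interchange: "\<lbrakk>f \<in> hom1 K X Y; a \<in> hom2 K f f'; a' \<in> hom2 K f' f'';
            g \<in> hom1 K Y Z; b \<in> hom2 K g g'; b' \<in> hom2 K g' g''\<rbrakk>
          \<Longrightarrow> (b' \<cdot> b) \<star> (a' \<cdot> a) = (b' \<star> a') \<cdot> (b \<star> a)"

record ('x, 'm, 'c, 'x2, 'm2, 'c2) two_fctr =
  on0 :: "'x \<Rightarrow> 'x2"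
  on1 :: "'m \<Rightarrow> 'm2"
  on2 :: "'c \<Rightarrow> 'c2"

locale is_two_functor =
  fixes K :: "('x, 'm, 'c) two_cat" and L :: "('x2, 'm2, 'c2) two_cat"
    and F :: "('x, 'm, 'c, 'x2, 'm2, 'c2) two_fctr"
  assumes source: "is_two_category K"
    and target: "is_two_category L"
    and on0_type: "X \<in> Cell0 K \<Longrightarrow> on0 F X \<in> Cell0 L"
    and on1_type: "f \<in> hom1 K X Y \<Longrightarrow> on1 F f \<in> hom1 L (on0 F X) (on0 F Y)"
    and on2_type: "a \<in> hom2 K f g \<Longrightarrow> on2 F a \<in> hom2 L (on1 F f) (on1 F g)"
    and on1_Id1: "X \<in> Cell0 K \<Longrightarrow> on1 F (Id1 K X) = Id1 L (on0 F X)"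
    and on1_Comp1: "\<lbrakk>f \<in> hom1 K X Y; g \<in> hom1 K Y Z\<rbrakk>
          \<Longrightarrow> on1 F (g \<odot>\<^bsub>K\<^esub> f) = on1 F g \<odot>\<^bsub>L\<^esub> on1 F f"
    and on2_Id2: "f \<in> Cell1 K \<Longrightarrow> on2 F (Id2 K f) = Id2 L (on1 F f)"
    and on2_VComp: "\<lbrakk>a \<in> hom2 K f g; b \<in> hom2 K g h\<rbrakk>
          \<Longrightarrow> on2 F (b \<cdot>\<^bsub>K\<^esub> a) = on2 F b \<cdot>\<^bsub>L\<^esub> on2 F a"
    and on2_HComp: "\<lbrakk>f \<in> hom1 K X Y; a \<in> hom2 K f f'; g \<in> hom1 K Y Z; b \<in> hom2 K g g'\<rbrakk>
          \<Longrightarrow> on2 F (b \<star>\<^bsub>K\<^esub> a) = on2 F b \<star>\<^bsub>L\<^esub> on2 F a"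

definition id_two_fctr :: "('x, 'm, 'c, 'x, 'm, 'c) two_fctr" where
  "id_two_fctr = \<lparr>on0 = (\<lambda>X. X), on1 = (\<lambda>f. f), on2 = (\<lambda>a. a)\<rparr>"

definition comp_two_fctr ::
    "('x2, 'm2, 'c2, 'x3, 'm3, 'c3) two_fctr \<Rightarrow> ('x, 'm, 'c, 'x2, 'm2, 'c2) two_fctr
      \<Rightarrow> ('x, 'm, 'c, 'x3, 'm3, 'c3) two_fctr" where
  "comp_two_fctr G F = \<lparr>on0 = on0 G \<circ> on0 F, on1 = on1 G \<circ> on1 F, on2 = on2 G \<circ> on2 F\<rparr>"

locale is_two_nat_trans =
  fixes K :: "('x, 'm, 'c) two_cat" and L :: "('x2, 'm2, 'c2) two_cat"
    and F G :: "('x, 'm, 'c, 'x2, 'm2, 'c2) two_fctr" and t :: "'x \<Rightarrow> 'm2"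
  assumes source: "is_two_functor K L F"
    and target: "is_two_functor K L G"
    and component: "X \<in> Cell0 K \<Longrightarrow> t X \<in> hom1 L (on0 F X) (on0 G X)"
    and natural1: "f \<in> hom1 K X Y \<Longrightarrow> t Y \<odot>\<^bsub>L\<^esub> on1 F f = on1 G f \<odot>\<^bsub>L\<^esub> t X"
    and natural2: "\<lbrakk>f \<in> hom1 K X Y; a \<in> hom2 K f g\<rbrakk>
          \<Longrightarrow> Id2 L (t Y) \<star>\<^bsub>L\<^esub> on2 F a = on2 G a \<star>\<^bsub>L\<^esub> Id2 L (t X)"

text \<open>\<open>F : K \<rightarrow> L\<close> is left 2-adjoint to \<open>G : L \<rightarrow> K\<close>, with unit \<open>u\<close> and counit \<open>e\<close>.\<close>

locale is_two_adjunction =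
  fixes K :: "('x, 'm, 'c) two_cat" and L :: "('x2, 'm2, 'c2) two_cat"
    and F :: "('x, 'm, 'c, 'x2, 'm2, 'c2) two_fctr"
    and G :: "('x2, 'm2, 'c2, 'x, 'm, 'c) two_fctr"
    and u :: "'x \<Rightarrow> 'm" and e :: "'x2 \<Rightarrow> 'm2"
  assumes left: "is_two_functor K L F"
    and right: "is_two_functor L K G"
    and unit: "is_two_nat_trans K K id_two_fctr (comp_two_fctr G F) u"
    and counit: "is_two_nat_trans L L (comp_two_fctr F G) id_two_fctr e"
    and triangle_left: "X \<in> Cell0 K \<Longrightarrow> e (on0 F X) \<odot>\<^bsub>L\<^esub> on1 F (u X) = Id1 L (on0 F X)"
    and triangle_right: "Y \<in> Cell0 L \<Longrightarrow> on1 G (e Y) \<odot>\<^bsub>K\<^esub> u (on0 G Y) = Id1 K (on0 G Y)"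

definition is_left_two_adjoint ::
    "('x, 'm, 'c) two_cat \<Rightarrow> ('x2, 'm2, 'c2) two_cat
      \<Rightarrow> ('x, 'm, 'c, 'x2, 'm2, 'c2) two_fctr \<Rightarrow> ('x2, 'm2, 'c2, 'x, 'm, 'c) two_fctr \<Rightarrow> bool" where
  "is_left_two_adjoint K L F G \<longleftrightarrow> (\<exists>u e. is_two_adjunction K L F G u e)"


section \<open>The 2-category of indexed posets\<close>

text \<open>
  The type parameters \<open>'o\<close>, \<open>'a\<close>, \<open>'p\<close> (of objects, arrows and elements of fibres) play the role
  of the universe in which the categories and posets live.
\<close>

record ('o, 'a, 'p) idxpos =
  base :: "('o, 'a) cat"
  fib :: "('o, 'a, 'p poset, 'p \<Rightarrow> 'p) fctr"

definition is_idxpos :: "('o, 'a, 'p) idxpos \<Rightarrow> bool" where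
  "is_idxpos P \<longleftrightarrow> is_category (base P) \<and> is_functor (Op (base P)) Pos (fib P)"

record ('o, 'a, 'p) ip_cell1 =
  src1 :: "('o, 'a, 'p) idxpos"
  tgt1 :: "('o, 'a, 'p) idxpos"
  fun1 :: "('o, 'a, 'o, 'a) fctr"
  nat1 :: "'o \<Rightarrow> 'p \<Rightarrow> 'p"

definition is_ip_cell1 :: "('o, 'a, 'p) ip_cell1 \<Rightarrow> bool" where
  "is_ip_cell1 f \<longleftrightarrow>
     is_idxpos (src1 f) \<and> is_idxpos (tgt1 f) \<and>
     is_functor (base (src1 f)) (base (tgt1 f)) (fun1 f) \<and>
     is_nat_trans (Op (base (src1 f))) Pos
       (fib (src1 f)) (comp_fctr (Op (base (src1 f))) (fib (tgt1 f)) (op_fctr (fun1 f))) (nat1 f)"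

definition ip_id1 :: "('o, 'a, 'p) idxpos \<Rightarrow> ('o, 'a, 'p) ip_cell1" where
  "ip_id1 P = \<lparr>src1 = P, tgt1 = P, fun1 = id_fctr (base P),
     nat1 = (\<lambda>A\<in>Obj (base P). \<lambda>\<alpha>\<in>pts (fobj (fib P) A). \<alpha>)\<rparr>"

definition ip_comp1 ::
    "('o, 'a, 'p) ip_cell1 \<Rightarrow> ('o, 'a, 'p) ip_cell1 \<Rightarrow> ('o, 'a, 'p) ip_cell1" where
  "ip_comp1 g f = \<lparr>src1 = src1 f, tgt1 = tgt1 g,
     fun1 = comp_fctr (base (src1 f)) (fun1 g) (fun1 f),
     nat1 = (\<lambda>A\<in>Obj (base (src1 f)). \<lambda>\<alpha>\<in>pts (fobj (fib (src1 f)) A).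
               nat1 g (fobj (fun1 f) A) (nat1 f A \<alpha>))\<rparr>"

record ('o, 'a, 'p) ip_cell2 =
  dom2 :: "('o, 'a, 'p) ip_cell1"
  cod2 :: "('o, 'a, 'p) ip_cell1"
  nat2 :: "'o \<Rightarrow> 'a"

text \<open>
  In the inequality below, the component \<open>\<theta>\<^sub>A : F A \<rightarrow> G A\<close> is an arrow from \<open>G A\<close> to \<open>F A\<close>
  in the opposite category, which is the source of the target indexed poset.
\<close>

definition is_ip_cell2 :: "('o, 'a, 'p) ip_cell2 \<Rightarrow> bool" where
  "is_ip_cell2 \<theta> \<longleftrightarrow>
     (let f = dom2 \<theta>; g = cod2 \<theta>; P = src1 f; R = tgt1 f;
          F = fun1 f; G = fun1 g
      in is_ip_cell1 f \<and> is_ip_cell1 g \<and> src1 g = P \<and> tgt1 g = R \<and>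
         is_nat_trans (base P) (base R) F G (nat2 \<theta>) \<and>
         (\<forall>A\<in>Obj (base P). \<forall>\<alpha>\<in>pts (fobj (fib P) A).
            (nat1 f A \<alpha>, farr (fib R) (fobj G A) (fobj F A) (nat2 \<theta> A) (nat1 g A \<alpha>))
              \<in> ple (fobj (fib R) (fobj F A))))"

definition ip_id2 :: "('o, 'a, 'p) ip_cell1 \<Rightarrow> ('o, 'a, 'p) ip_cell2" where
  "ip_id2 f = \<lparr>dom2 = f, cod2 = f,
     nat2 = (\<lambda>A\<in>Obj (base (src1 f)). Idm (base (tgt1 f)) (fobj (fun1 f) A))\<rparr>"

definition ip_vcomp ::
    "('o, 'a, 'p) ip_cell2 \<Rightarrow> ('o, 'a, 'p) ip_cell2 \<Rightarrow> ('o, 'a, 'p) ip_cell2" where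
  "ip_vcomp \<phi> \<theta> = \<lparr>dom2 = dom2 \<theta>, cod2 = cod2 \<phi>,
     nat2 = (\<lambda>A\<in>Obj (base (src1 (dom2 \<theta>))).
       Cmp (base (tgt1 (dom2 \<theta>)))
         (fobj (fun1 (dom2 \<theta>)) A) (fobj (fun1 (cod2 \<theta>)) A) (fobj (fun1 (cod2 \<phi>)) A)
         (nat2 \<phi> A) (nat2 \<theta> A))\<rparr>"

text \<open>
  For \<open>\<theta> : F \<Rightarrow> F'\<close> and \<open>\<phi> : G \<Rightarrow> G'\<close>, the horizontal composite has components
  \<open>G' (\<theta>\<^sub>A) \<circ> \<phi>\<^bsub>F A\<^esub> : G F A \<rightarrow> G' F' A\<close>.
\<close>

definition ip_hcomp ::
    "('o, 'a, 'p) ip_cell2 \<Rightarrow> ('o, 'a, 'p) ip_cell2 \<Rightarrow> ('o, 'a, 'p) ip_cell2" where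
  "ip_hcomp \<phi> \<theta> =
     (let F = fun1 (dom2 \<theta>); F' = fun1 (cod2 \<theta>); G = fun1 (dom2 \<phi>); G' = fun1 (cod2 \<phi>)
      in \<lparr>dom2 = ip_comp1 (dom2 \<phi>) (dom2 \<theta>), cod2 = ip_comp1 (cod2 \<phi>) (cod2 \<theta>),
          nat2 = (\<lambda>A\<in>Obj (base (src1 (dom2 \<theta>))).
            Cmp (base (tgt1 (dom2 \<phi>)))
              (fobj G (fobj F A)) (fobj G' (fobj F A)) (fobj G' (fobj F' A))
              (farr G' (fobj F A) (fobj F' A) (nat2 \<theta> A)) (nat2 \<phi> (fobj F A)))\<rparr>)"

definition IdxPos ::
    "(('o, 'a, 'p) idxpos, ('o, 'a, 'p) ip_cell1, ('o, 'a, 'p) ip_cell2) two_cat" where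
  "IdxPos = \<lparr>Cell0 = Collect is_idxpos, Cell1 = Collect is_ip_cell1, Cell2 = Collect is_ip_cell2,
     Src = src1, Tgt = tgt1, Dom = dom2, Cod = cod2, Id1 = ip_id1, Id2 = ip_id2,
     Comp1 = ip_comp1, VComp = ip_vcomp, HComp = ip_hcomp\<rparr>"


section \<open>The 2-category of comonads in a 2-category\<close>

record ('x, 'm, 'c) comonad =
  carr :: 'x
  endo :: 'm
  comult :: 'c
  coun :: 'c

text \<open>
  For \<open>K = IdxPos\<close> the equations below are equations of natural transformations, and say that the
  underlying functor with \<open>comult\<close> and \<open>coun\<close> is a comonad on the base category.
\<close>

definition is_comonad :: "('x, 'm, 'c) two_cat \<Rightarrow> ('x, 'm, 'c) comonad \<Rightarrow> bool" where
  "is_comonad K T \<longleftrightarrow>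
     (let X = carr T; k = endo T; \<gamma> = comult T; \<epsilon> = coun T
      in X \<in> Cell0 K \<and> k \<in> hom1 K X X \<and>
         \<gamma> \<in> hom2 K k (k \<odot>\<^bsub>K\<^esub> k) \<and> \<epsilon> \<in> hom2 K k (Id1 K X) \<and>
         (Id2 K k \<star>\<^bsub>K\<^esub> \<gamma>) \<cdot>\<^bsub>K\<^esub> \<gamma> = (\<gamma> \<star>\<^bsub>K\<^esub> Id2 K k) \<cdot>\<^bsub>K\<^esub> \<gamma> \<and>
         (Id2 K k \<star>\<^bsub>K\<^esub> \<epsilon>) \<cdot>\<^bsub>K\<^esub> \<gamma> = Id2 K k \<and>
         (\<epsilon> \<star>\<^bsub>K\<^esub> Id2 K k) \<cdot>\<^bsub>K\<^esub> \<gamma> = Id2 K k)"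

record ('x, 'm, 'c) cmd_cell1 =
  csrc :: "('x, 'm, 'c) comonad"
  ctgt :: "('x, 'm, 'c) comonad"
  und1 :: 'm
  swap :: 'c

definition is_cmd_cell1 :: "('x, 'm, 'c) two_cat \<Rightarrow> ('x, 'm, 'c) cmd_cell1 \<Rightarrow> bool" where
  "is_cmd_cell1 K F \<longleftrightarrow>
     (let T = csrc F; T' = ctgt F; k = endo T; k' = endo T'; f = und1 F; j = swap F
      in is_comonad K T \<and> is_comonad K T' \<and> f \<in> hom1 K (carr T) (carr T') \<and>
         j \<in> hom2 K (k' \<odot>\<^bsub>K\<^esub> f) (f \<odot>\<^bsub>K\<^esub> k) \<and>
         (Id2 K f \<star>\<^bsub>K\<^esub> comult T) \<cdot>\<^bsub>K\<^esub> j
           = (j \<star>\<^bsub>K\<^esub> Id2 K k) \<cdot>\<^bsub>K\<^esub> (Id2 K k' \<star>\<^bsub>K\<^esub> j) \<cdot>\<^bsub>K\<^esub> (comult T' \<star>\<^bsub>K\<^esub> Id2 K f) \<and>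
         (Id2 K f \<star>\<^bsub>K\<^esub> coun T) \<cdot>\<^bsub>K\<^esub> j = coun T' \<star>\<^bsub>K\<^esub> Id2 K f)"

record ('x, 'm, 'c) cmd_cell2 =
  cdom :: "('x, 'm, 'c) cmd_cell1"
  ccod :: "('x, 'm, 'c) cmd_cell1"
  und2 :: 'c

definition is_cmd_cell2 :: "('x, 'm, 'c) two_cat \<Rightarrow> ('x, 'm, 'c) cmd_cell2 \<Rightarrow> bool" where
  "is_cmd_cell2 K a \<longleftrightarrow>
     (let F = cdom a; G = ccod a; k = endo (csrc F); k' = endo (ctgt F); \<eta> = und2 a
      in is_cmd_cell1 K F \<and> is_cmd_cell1 K G \<and> csrc G = csrc F \<and> ctgt G = ctgt F \<and>
         \<eta> \<in> hom2 K (und1 F) (und1 G) \<and>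
         (\<eta> \<star>\<^bsub>K\<^esub> Id2 K k) \<cdot>\<^bsub>K\<^esub> swap F = swap G \<cdot>\<^bsub>K\<^esub> (Id2 K k' \<star>\<^bsub>K\<^esub> \<eta>))"

definition cmd_id1 :: "('x, 'm, 'c) two_cat \<Rightarrow> ('x, 'm, 'c) comonad \<Rightarrow> ('x, 'm, 'c) cmd_cell1" where
  "cmd_id1 K T = \<lparr>csrc = T, ctgt = T, und1 = Id1 K (carr T), swap = Id2 K (endo T)\<rparr>"

text \<open>The 2-cell of the composite of \<open>(f, j)\<close> and \<open>(g, h)\<close> is \<open>k'' g f \<Rightarrow> g k' f \<Rightarrow> g f k\<close>.\<close>

definition cmd_comp1 ::
    "('x, 'm, 'c) two_cat \<Rightarrow> ('x, 'm, 'c) cmd_cell1 \<Rightarrow> ('x, 'm, 'c) cmd_cell1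
      \<Rightarrow> ('x, 'm, 'c) cmd_cell1" where
  "cmd_comp1 K G F = \<lparr>csrc = csrc F, ctgt = ctgt G, und1 = und1 G \<odot>\<^bsub>K\<^esub> und1 F,
     swap = (Id2 K (und1 G) \<star>\<^bsub>K\<^esub> swap F) \<cdot>\<^bsub>K\<^esub> (swap G \<star>\<^bsub>K\<^esub> Id2 K (und1 F))\<rparr>"

definition CmdStar ::
    "('x, 'm, 'c) two_cat
      \<Rightarrow> (('x, 'm, 'c) comonad, ('x, 'm, 'c) cmd_cell1, ('x, 'm, 'c) cmd_cell2) two_cat" where
  "CmdStar K = \<lparr>Cell0 = Collect (is_comonad K), Cell1 = Collect (is_cmd_cell1 K),
     Cell2 = Collect (is_cmd_cell2 K),
     Src = csrc, Tgt = ctgt, Dom = cdom, Cod = ccod,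
     Id1 = cmd_id1 K,
     Id2 = (\<lambda>F. \<lparr>cdom = F, ccod = F, und2 = Id2 K (und1 F)\<rparr>),
     Comp1 = cmd_comp1 K,
     VComp = (\<lambda>b a. \<lparr>cdom = cdom a, ccod = ccod b, und2 = und2 b \<cdot>\<^bsub>K\<^esub> und2 a\<rparr>),
     HComp = (\<lambda>b a. \<lparr>cdom = cmd_comp1 K (cdom b) (cdom a), ccod = cmd_comp1 K (ccod b) (ccod a),
                     und2 = und2 b \<star>\<^bsub>K\<^esub> und2 a\<rparr>)\<rparr>"

definition inc0 :: "('x, 'm, 'c) two_cat \<Rightarrow> 'x \<Rightarrow> ('x, 'm, 'c) comonad" where
  "inc0 K X = \<lparr>carr = X, endo = Id1 K X, comult = Id2 K (Id1 K X), coun = Id2 K (Id1 K X)\<rparr>"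

definition inc1 :: "('x, 'm, 'c) two_cat \<Rightarrow> 'm \<Rightarrow> ('x, 'm, 'c) cmd_cell1" where
  "inc1 K f = \<lparr>csrc = inc0 K (Src K f), ctgt = inc0 K (Tgt K f), und1 = f, swap = Id2 K f\<rparr>"

definition Inc ::
    "('x, 'm, 'c) two_cat
      \<Rightarrow> ('x, 'm, 'c, ('x, 'm, 'c) comonad, ('x, 'm, 'c) cmd_cell1, ('x, 'm, 'c) cmd_cell2) two_fctr"
  where
  "Inc K = \<lparr>on0 = inc0 K, on1 = inc1 K,
     on2 = (\<lambda>a. \<lparr>cdom = inc1 K (Dom K a), ccod = inc1 K (Cod K a), und2 = a\<rparr>)\<rparr>"

end

theory Submission
  imports Defs
begin

text \<open>
  A 1-cell \<open>T \<rightarrow> Inc R\<close> in \<open>CmdStar K\<close> is a 1-cell \<open>g\<close> with a coalgebra structure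
  \<open>j : g \<Rightarrow> g k\<close>, so it suffices that every comonad in \<open>IdxPos\<close> has a 2-universal coalgebra.
  For \<open>T = (P, (K, \<kappa>), \<gamma>, \<epsilon>)\<close> its base is the coKleisli category. The coalgebra inequality forces
  every \<open>\<beta> \<in> P (K A)\<close> to be identified with \<open>c \<beta> = P (\<gamma>\<^sub>A) (\<kappa> \<beta>)\<close>, and the 2-cell
  inequalities for \<open>\<gamma>\<close> and \<open>\<epsilon>\<close> make \<open>c\<close> an interior operator on \<open>P (K A)\<close>; it commutes with
  reindexing along coKleisli extensions \<open>K f \<circ> \<gamma>\<^sub>A\<close>, so the fixed points of \<open>c\<close> form the
  fibre of the Kleisli object over \<open>A\<close>. The universal 1-cell has \<open>\<kappa>\<close> as its action on fibres. A
  coalgebra \<open>(g, j)\<close> extends along it by \<open>f \<mapsto> g f \<circ> j\<^sub>A\<close> on arrows and by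
  \<open>\<beta> \<mapsto> R (j\<^sub>A) (g \<beta>)\<close> on fibres.
\<close>

section \<open>Whiskering in 2-categories\<close>

text \<open>Why \<beta> and c \<beta> must be identified: 1-cells are strictly natural while 2-cells
  are only inequalities, and antisymmetry turns some of these into equations. For a coalgebra
  \<open>(g, j)\<close> the inequality of \<open>j\<close> reads g x \<le> R (j_A) (g (\<kappa> x));
  the converse follows from \<kappa> x \<le> P (\<epsilon>_A) x and the counit law of
  \<open>j\<close>. Applying this equation over K A and then the comultiplication law gives R (j_A)
  (g \<beta>) = R (j_A) (g (c \<beta>)). The fixed points of c are the canonical representatives.

  Why this is universal: the candidate is generated by its unit data. Every Kleisli arrow from A to
  B is the universal 2-cell at A followed by the image of an arrow K A \<rightarrow> B, and every
  fixed point x is \<kappa> x reindexed along that 2-cell. Hence 1-cells out of the Kleisli object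
  are determined on generators, and naturality and the inequality of a 2-cell need to be checked
  only there.\<close>

lemma hom1_iff: "f \<in> hom1 K X Y \<longleftrightarrow> f \<in> Cell1 K \<and> Src K f = X \<and> Tgt K f = Y"
  by (simp add: hom1_def)

lemma hom2_iff: "a \<in> hom2 K f g \<longleftrightarrow> a \<in> Cell2 K \<and> Dom K a = f \<and> Cod K a = g"
  by (simp add: hom2_def)

context is_two_category
begin

text \<open>Here and below the axioms are restated with boundaries as equations: in the
  \<open>hom1\<close> and \<open>hom2\<close> form, intermediate cells occur only in the premises,
  where the simplifier cannot guess them.\<close>

lemma cell0_simps [simp]:
  "f \<in> Cell1 K \<Longrightarrow> Src K f \<in> Cell0 K" "f \<in> Cell1 K \<Longrightarrow> Tgt K f \<in> Cell0 K"
  by (simp_all add: Src_Cell0 Tgt_Cell0)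

lemma cell1_simps [simp]:
  "a \<in> Cell2 K \<Longrightarrow> Dom K a \<in> Cell1 K" "a \<in> Cell2 K \<Longrightarrow> Cod K a \<in> Cell1 K"
  "a \<in> Cell2 K \<Longrightarrow> Src K (Cod K a) = Src K (Dom K a)"
  "a \<in> Cell2 K \<Longrightarrow> Tgt K (Cod K a) = Tgt K (Dom K a)"
  by (simp_all add: Dom_Cell1 Cod_Cell1 parallel)

lemma id1_simps [simp]:
  assumes "X \<in> Cell0 K"
  shows "Id1 K X \<in> Cell1 K" "Src K (Id1 K X) = X" "Tgt K (Id1 K X) = X"
  using Id1_hom[OF assms] by (auto simp: hom1_iff)

lemma comp1_simps [simp]:
  assumes "f \<in> Cell1 K" "g \<in> Cell1 K" "Src K g = Tgt K f"
  shows "g \<odot> f \<in> Cell1 K" "Src K (g \<odot> f) = Src K f" "Tgt K (g \<odot> f) = Tgt K g"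
  using Comp1_hom[of f "Src K f" "Tgt K f" g "Tgt K g"] assms by (auto simp: hom1_iff)

lemma comp1_unit [simp]:
  "\<lbrakk>f \<in> Cell1 K; Src K f = X\<rbrakk> \<Longrightarrow> f \<odot> Id1 K X = f"
  "\<lbrakk>f \<in> Cell1 K; Tgt K f = X\<rbrakk> \<Longrightarrow> Id1 K X \<odot> f = f"
  using Comp1_Id1_right Comp1_Id1_left by (auto simp: hom1_iff)

lemma comp1_assoc [simp]:
  "\<lbrakk>f \<in> Cell1 K; g \<in> Cell1 K; h \<in> Cell1 K; Src K g = Tgt K f; Src K h = Tgt K g\<rbrakk>
    \<Longrightarrow> (h \<odot> g) \<odot> f = h \<odot> (g \<odot> f)"
  using Comp1_assoc[of f "Src K f" "Tgt K f" g "Tgt K g" h "Tgt K h"] by (auto simp: hom1_iff)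

lemma id2_simps [simp]:
  assumes "f \<in> Cell1 K"
  shows "Id2 K f \<in> Cell2 K" "Dom K (Id2 K f) = f" "Cod K (Id2 K f) = f"
  using Id2_hom[OF assms] by (auto simp: hom2_iff)

lemma vcomp_simps [simp]:
  assumes "a \<in> Cell2 K" "b \<in> Cell2 K" "Dom K b = Cod K a"
  shows "b \<cdot> a \<in> Cell2 K" "Dom K (b \<cdot> a) = Dom K a" "Cod K (b \<cdot> a) = Cod K b"
  using VComp_hom[of a "Dom K a" "Cod K a" b "Cod K b"] assms by (auto simp: hom2_iff)

lemma vcomp_unit [simp]:
  "\<lbrakk>a \<in> Cell2 K; Dom K a = f\<rbrakk> \<Longrightarrow> a \<cdot> Id2 K f = a"
  "\<lbrakk>a \<in> Cell2 K; Cod K a = f\<rbrakk> \<Longrightarrow> Id2 K f \<cdot> a = a"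
  using VComp_Id2_right VComp_Id2_left by (auto simp: hom2_iff)

lemma vcomp_assoc [simp]:
  "\<lbrakk>a \<in> Cell2 K; b \<in> Cell2 K; c \<in> Cell2 K; Dom K b = Cod K a; Dom K c = Cod K b\<rbrakk>
    \<Longrightarrow> (c \<cdot> b) \<cdot> a = c \<cdot> (b \<cdot> a)"
  using VComp_assoc[of a "Dom K a" "Cod K a" b "Cod K b" c "Cod K c"] by (auto simp: hom2_iff)

lemma hcomp_simps [simp]:
  assumes "a \<in> Cell2 K" "b \<in> Cell2 K" "Src K (Dom K b) = Tgt K (Dom K a)"
  shows "b \<star> a \<in> Cell2 K" "Dom K (b \<star> a) = Dom K b \<odot> Dom K a" "Cod K (b \<star> a) = Cod K b \<odot> Cod K a"
  using HComp_hom[of "Dom K a" "Src K (Dom K a)" "Tgt K (Dom K a)" a "Cod K a"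
      "Dom K b" "Tgt K (Dom K b)" b "Cod K b"] assms
  by (auto simp: hom1_iff hom2_iff)

lemma hcomp_unit:
  "\<lbrakk>a \<in> Cell2 K; Src K (Dom K a) = X\<rbrakk> \<Longrightarrow> a \<star> Id2 K (Id1 K X) = a"
  "\<lbrakk>a \<in> Cell2 K; Tgt K (Dom K a) = X\<rbrakk> \<Longrightarrow> Id2 K (Id1 K X) \<star> a = a"
  using HComp_Id_right[of "Dom K a"] HComp_Id_left[of "Dom K a"] by (auto simp: hom1_iff hom2_iff)

lemma hcomp_assoc:
  "\<lbrakk>a \<in> Cell2 K; b \<in> Cell2 K; c \<in> Cell2 K; Src K (Dom K b) = Tgt K (Dom K a);
    Src K (Dom K c) = Tgt K (Dom K b)\<rbrakk> \<Longrightarrow> (c \<star> b) \<star> a = c \<star> (b \<star> a)"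
  using HComp_assoc[of "Dom K a" "Src K (Dom K a)" "Tgt K (Dom K a)" a "Cod K a"
      "Dom K b" "Tgt K (Dom K b)" b "Cod K b" "Dom K c" "Tgt K (Dom K c)" c "Cod K c"]
  by (auto simp: hom1_iff hom2_iff)

lemma hcomp_id2 [simp]:
  "\<lbrakk>f \<in> Cell1 K; g \<in> Cell1 K; Src K g = Tgt K f\<rbrakk> \<Longrightarrow> Id2 K g \<star> Id2 K f = Id2 K (g \<odot> f)"
  using HComp_Id2[of f "Src K f" "Tgt K f" g "Tgt K g"] by (auto simp: hom1_iff)

lemma hcomp_interchange:
  "\<lbrakk>a \<in> Cell2 K; a' \<in> Cell2 K; b \<in> Cell2 K; b' \<in> Cell2 K; Dom K a' = Cod K a; Dom K b' = Cod K b;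
    Src K (Dom K b) = Tgt K (Dom K a)\<rbrakk> \<Longrightarrow> (b' \<cdot> b) \<star> (a' \<cdot> a) = (b' \<star> a') \<cdot> (b \<star> a)"
  using interchange[of "Dom K a" "Src K (Dom K a)" "Tgt K (Dom K a)" a "Cod K a" a' "Cod K a'"
      "Dom K b" "Tgt K (Dom K b)" b "Cod K b" b' "Cod K b'"]
  by (auto simp: hom1_iff hom2_iff)

text \<open>With whiskerings as constants of their own, the rules below give a normal form:
  right-nested vertical composites of 2-cells under iterated whiskering by single 1-cells. The
  exchange law stays outside the simp set and is applied by hand.\<close>

definition wl :: "'m \<Rightarrow> 'c \<Rightarrow> 'c" where "wl g a = Id2 K g \<star> a"
definition wr :: "'c \<Rightarrow> 'm \<Rightarrow> 'c" where "wr a f = a \<star> Id2 K f"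

lemma wl_simps [simp]:
  assumes "a \<in> Cell2 K" "g \<in> Cell1 K" "Src K g = Tgt K (Dom K a)"
  shows "wl g a \<in> Cell2 K" "Dom K (wl g a) = g \<odot> Dom K a" "Cod K (wl g a) = g \<odot> Cod K a"
  using assms by (auto simp: wl_def)

lemma wr_simps [simp]:
  assumes "a \<in> Cell2 K" "f \<in> Cell1 K" "Src K (Dom K a) = Tgt K f"
  shows "wr a f \<in> Cell2 K" "Dom K (wr a f) = Dom K a \<odot> f" "Cod K (wr a f) = Cod K a \<odot> f"
  using assms by (auto simp: wr_def)

lemma wl_id1 [simp]: "\<lbrakk>a \<in> Cell2 K; Tgt K (Dom K a) = X\<rbrakk> \<Longrightarrow> wl (Id1 K X) a = a"
  using HComp_Id_left[of "Dom K a"] by (auto simp: wl_def hom1_iff hom2_iff)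

lemma wr_id1 [simp]: "\<lbrakk>a \<in> Cell2 K; Src K (Dom K a) = X\<rbrakk> \<Longrightarrow> wr a (Id1 K X) = a"
  using HComp_Id_right[of "Dom K a"] by (auto simp: wr_def hom1_iff hom2_iff)

lemma wl_id2 [simp]:
  "\<lbrakk>f \<in> Cell1 K; g \<in> Cell1 K; Src K g = Tgt K f\<rbrakk> \<Longrightarrow> wl g (Id2 K f) = Id2 K (g \<odot> f)"
  by (simp add: wl_def)

lemma wr_id2 [simp]:
  "\<lbrakk>f \<in> Cell1 K; g \<in> Cell1 K; Src K g = Tgt K f\<rbrakk> \<Longrightarrow> wr (Id2 K g) f = Id2 K (g \<odot> f)"
  by (simp add: wr_def)

lemma wl_comp1 [simp]:
  "\<lbrakk>a \<in> Cell2 K; f \<in> Cell1 K; g \<in> Cell1 K; Src K f = Tgt K (Dom K a); Src K g = Tgt K f\<rbrakk>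
    \<Longrightarrow> wl (g \<odot> f) a = wl g (wl f a)"
  by (simp add: wl_def hcomp_assoc flip: hcomp_id2)

lemma wr_comp1 [simp]:
  "\<lbrakk>a \<in> Cell2 K; f \<in> Cell1 K; g \<in> Cell1 K; Src K g = Tgt K f; Src K (Dom K a) = Tgt K g\<rbrakk>
    \<Longrightarrow> wr a (g \<odot> f) = wr (wr a g) f"
  by (simp add: wr_def hcomp_assoc)

lemma wr_wl [simp]:
  "\<lbrakk>a \<in> Cell2 K; f \<in> Cell1 K; g \<in> Cell1 K; Src K (Dom K a) = Tgt K f; Src K g = Tgt K (Dom K a)\<rbrakk>
    \<Longrightarrow> wr (wl g a) f = wl g (wr a f)"
  by (simp add: wr_def wl_def hcomp_assoc)

lemma wl_vcomp [simp]:
  "\<lbrakk>a \<in> Cell2 K; b \<in> Cell2 K; g \<in> Cell1 K; Dom K b = Cod K a; Src K g = Tgt K (Dom K a)\<rbrakk>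
    \<Longrightarrow> wl g (b \<cdot> a) = wl g b \<cdot> wl g a"
  using hcomp_interchange[of a b "Id2 K g" "Id2 K g"] by (simp add: wl_def)

lemma wr_vcomp [simp]:
  "\<lbrakk>a \<in> Cell2 K; b \<in> Cell2 K; f \<in> Cell1 K; Dom K b = Cod K a; Src K (Dom K a) = Tgt K f\<rbrakk>
    \<Longrightarrow> wr (b \<cdot> a) f = wr b f \<cdot> wr a f"
  using hcomp_interchange[of "Id2 K f" "Id2 K f" a b] by (simp add: wr_def)

text \<open>Of the two ways to split a horizontal composite into whiskerings, this one is the normal
  form; \<open>exchange\<close> leads to the other.\<close>

lemma hcomp_eq:
  "\<lbrakk>a \<in> Cell2 K; b \<in> Cell2 K; Src K (Dom K b) = Tgt K (Dom K a)\<rbrakk>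
    \<Longrightarrow> b \<star> a = wl (Cod K b) a \<cdot> wr b (Dom K a)"
  using hcomp_interchange[of "Id2 K (Dom K a)" a b "Id2 K (Cod K b)"] by (simp add: wr_def wl_def)

text \<open>Both sides are \<open>b \<star> a\<close>, by interchange with identities. The
  boundaries are separate variables so that the rule matches after they have been
  simplified.\<close>

lemma exchange:
  assumes "a \<in> Cell2 K" "b \<in> Cell2 K" "Src K (Dom K b) = Tgt K (Dom K a)"
    "Dom K a = f" "Cod K a = f'" "Dom K b = g" "Cod K b = g'"
  shows "wl g' a \<cdot> wr b f = wr b f' \<cdot> wl g a"
proof -
  have "b \<star> a = wr b f' \<cdot> wl g a"
    using hcomp_interchange[of a "Id2 K f'" "Id2 K g" b] assms by (auto simp: wr_def wl_def)
  then show ?thesis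
    using hcomp_eq assms by simp
qed

text \<open>In a right-nested composite a two-factor redex appears with a tail; this and
  \<open>exchange_reassoc\<close> carry the tail along.\<close>

lemma vcomp_reassoc:
  assumes "b \<cdot> a = d" "a \<in> Cell2 K" "b \<in> Cell2 K" "Dom K b = Cod K a"
    "c \<in> Cell2 K" "Dom K a = Cod K c"
  shows "b \<cdot> (a \<cdot> c) = d \<cdot> c"
  using assms vcomp_assoc[of c a b] by auto

lemma exchange_reassoc:
  assumes "a \<in> Cell2 K" "b \<in> Cell2 K" "Src K (Dom K b) = Tgt K (Dom K a)"
    "Dom K a = f" "Cod K a = f'" "Dom K b = g" "Cod K b = g'" "c \<in> Cell2 K" "Cod K c = g \<odot> f"
  shows "wl g' a \<cdot> (wr b f \<cdot> c) = wr b f' \<cdot> (wl g a \<cdot> c)"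
  using exchange[of a b f f' g g'] assms
    vcomp_assoc[of c "wr b f" "wl g' a"] vcomp_assoc[of c "wl g a" "wr b f'"]
  by auto

section \<open>The 2-category of comonads\<close>

lemma is_comonad_iff:
  "is_comonad K T \<longleftrightarrow>
    carr T \<in> Cell0 K \<and>
    endo T \<in> Cell1 K \<and> Src K (endo T) = carr T \<and> Tgt K (endo T) = carr T \<and>
    comult T \<in> Cell2 K \<and> Dom K (comult T) = endo T \<and> Cod K (comult T) = endo T \<odot> endo T \<and>
    coun T \<in> Cell2 K \<and> Dom K (coun T) = endo T \<and> Cod K (coun T) = Id1 K (carr T) \<and>
    wl (endo T) (comult T) \<cdot> comult T = wr (comult T) (endo T) \<cdot> comult T \<and>
    wl (endo T) (coun T) \<cdot> comult T = Id2 K (endo T) \<and>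
    wr (coun T) (endo T) \<cdot> comult T = Id2 K (endo T)"
  by (auto simp: is_comonad_def Let_def hom1_iff hom2_iff wl_def wr_def)

lemma is_cmd_cell1_iff:
  "is_cmd_cell1 K F \<longleftrightarrow>
    is_comonad K (csrc F) \<and> is_comonad K (ctgt F) \<and>
    und1 F \<in> Cell1 K \<and> Src K (und1 F) = carr (csrc F) \<and> Tgt K (und1 F) = carr (ctgt F) \<and>
    swap F \<in> Cell2 K \<and> Dom K (swap F) = endo (ctgt F) \<odot> und1 F \<and>
    Cod K (swap F) = und1 F \<odot> endo (csrc F) \<and>
    wl (und1 F) (comult (csrc F)) \<cdot> swap F
      = wr (swap F) (endo (csrc F)) \<cdot> (wl (endo (ctgt F)) (swap F) \<cdot> wr (comult (ctgt F)) (und1 F)) \<and>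
    wl (und1 F) (coun (csrc F)) \<cdot> swap F = wr (coun (ctgt F)) (und1 F)"
  by (auto simp: is_cmd_cell1_def Let_def hom1_iff hom2_iff wl_def wr_def)

lemma is_cmd_cell2_iff:
  "is_cmd_cell2 K a \<longleftrightarrow>
    is_cmd_cell1 K (cdom a) \<and> is_cmd_cell1 K (ccod a) \<and>
    csrc (ccod a) = csrc (cdom a) \<and> ctgt (ccod a) = ctgt (cdom a) \<and>
    und2 a \<in> Cell2 K \<and> Dom K (und2 a) = und1 (cdom a) \<and> Cod K (und2 a) = und1 (ccod a) \<and>
    wr (und2 a) (endo (csrc (cdom a))) \<cdot> swap (cdom a)
      = swap (ccod a) \<cdot> wl (endo (ctgt (cdom a))) (und2 a)"
  by (auto simp: is_cmd_cell2_def Let_def hom2_iff wl_def wr_def)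

lemma cmd_comp1_eq:
  "cmd_comp1 K G F = \<lparr>csrc = csrc F, ctgt = ctgt G, und1 = und1 G \<odot> und1 F,
     swap = wl (und1 G) (swap F) \<cdot> wr (swap G) (und1 F)\<rparr>"
  by (simp add: cmd_comp1_def wl_def wr_def)

section \<open>Identities and composites in the 2-category of comonads\<close>

lemma is_cmd_cell1_id: "is_comonad K T \<Longrightarrow> is_cmd_cell1 K (cmd_id1 K T)"
  by (auto simp: is_cmd_cell1_iff is_comonad_iff cmd_id1_def)

text \<open>A pasting argument: the comultiplication laws of \<open>F\<close> and of
  \<open>G\<close> are used once each, and one exchange puts the pieces in order.\<close>

lemma is_cmd_cell1_comp:
  assumes "is_cmd_cell1 K F" "is_cmd_cell1 K G" "csrc G = ctgt F"
  shows "is_cmd_cell1 K (cmd_comp1 K G F)"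
proof -
  obtain T T' f j where F: "F = \<lparr>csrc = T, ctgt = T', und1 = f, swap = j\<rparr>"
    by (cases F) auto
  obtain T'' g h where G: "G = \<lparr>csrc = T', ctgt = T'', und1 = g, swap = h\<rparr>"
    using assms(3) F by (cases G) auto
  obtain X k \<gamma> \<epsilon> where T: "T = \<lparr>carr = X, endo = k, comult = \<gamma>, coun = \<epsilon>\<rparr>"
    by (cases T) auto
  obtain X' k' \<gamma>' \<epsilon>' where T': "T' = \<lparr>carr = X', endo = k', comult = \<gamma>', coun = \<epsilon>'\<rparr>"
    by (cases T') auto
  obtain X'' k'' \<gamma>'' \<epsilon>'' where T'': "T'' = \<lparr>carr = X'', endo = k'', comult = \<gamma>'', coun = \<epsilon>''\<rparr>"
    by (cases T'') auto
  note s = assms(1,2)[unfolded is_cmd_cell1_iff is_comonad_iff F G T T' T'', simplified]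
  have j1: "wl f \<gamma> \<cdot> j = wr j k \<cdot> (wl k' j \<cdot> wr \<gamma>' f)"
    and h1: "wl g \<gamma>' \<cdot> h = wr h k' \<cdot> (wl k'' h \<cdot> wr \<gamma>'' g)"
    and j2: "wl f \<epsilon> \<cdot> j = wr \<epsilon>' f" and h2: "wl g \<epsilon>' \<cdot> h = wr \<epsilon>'' g"
    using s by auto
  have [simp]: "X \<in> Cell0 K" "X' \<in> Cell0 K" "X'' \<in> Cell0 K"
    "k \<in> Cell1 K" "Src K k = X" "Tgt K k = X"
    "k' \<in> Cell1 K" "Src K k' = X'" "Tgt K k' = X'"
    "k'' \<in> Cell1 K" "Src K k'' = X''" "Tgt K k'' = X''"
    "f \<in> Cell1 K" "Src K f = X" "Tgt K f = X'"
    "g \<in> Cell1 K" "Src K g = X'" "Tgt K g = X''"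
    "\<gamma> \<in> Cell2 K" "Dom K \<gamma> = k" "Cod K \<gamma> = k \<odot> k"
    "\<gamma>' \<in> Cell2 K" "Dom K \<gamma>' = k'" "Cod K \<gamma>' = k' \<odot> k'"
    "\<gamma>'' \<in> Cell2 K" "Dom K \<gamma>'' = k''" "Cod K \<gamma>'' = k'' \<odot> k''"
    "\<epsilon> \<in> Cell2 K" "Dom K \<epsilon> = k" "Cod K \<epsilon> = Id1 K X"
    "\<epsilon>' \<in> Cell2 K" "Dom K \<epsilon>' = k'" "Cod K \<epsilon>' = Id1 K X'"
    "\<epsilon>'' \<in> Cell2 K" "Dom K \<epsilon>'' = k''" "Cod K \<epsilon>'' = Id1 K X''"
    "j \<in> Cell2 K" "Dom K j = k' \<odot> f" "Cod K j = f \<odot> k"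
    "h \<in> Cell2 K" "Dom K h = k'' \<odot> g" "Cod K h = g \<odot> k'"
    using s by auto
  let ?s = "wl g j \<cdot> wr h f"
  have "wl (g \<odot> f) \<gamma> \<cdot> ?s = wl g (wl f \<gamma> \<cdot> j) \<cdot> wr h f"
    by simp
  also have "\<dots> = wl g (wr j k) \<cdot> (wl g (wl k' j) \<cdot> wr (wl g \<gamma>' \<cdot> h) f)"
    by (subst j1) simp
  also have "\<dots> = wl g (wr j k) \<cdot> (wl (g \<odot> k') j \<cdot> (wr h (k' \<odot> f) \<cdot> (wr (wl k'' h) f \<cdot> wr (wr \<gamma>'' g) f)))"
    by (subst h1) simp
  \<comment> \<open>\<open>h\<close> acts on the side of \<open>g\<close> and \<open>j\<close> on
    the side of \<open>f\<close>, so the two may be performed in either order.\<close>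
  also have "wl (g \<odot> k') j \<cdot> (wr h (k' \<odot> f) \<cdot> (wr (wl k'' h) f \<cdot> wr (wr \<gamma>'' g) f))
    = wr h (f \<odot> k) \<cdot> (wl (k'' \<odot> g) j \<cdot> (wr (wl k'' h) f \<cdot> wr (wr \<gamma>'' g) f))"
    by (rule exchange_reassoc) simp_all
  finally have 1: "wl (g \<odot> f) \<gamma> \<cdot> ?s = wr ?s k \<cdot> (wl k'' ?s \<cdot> wr \<gamma>'' (g \<odot> f))"
    by simp
  have "wl (g \<odot> f) \<epsilon> \<cdot> ?s = wl g (wl f \<epsilon> \<cdot> j) \<cdot> wr h f"
    by simp
  also have "\<dots> = wr (wl g \<epsilon>' \<cdot> h) f"
    by (subst j2) simp
  finally have 2: "wl (g \<odot> f) \<epsilon> \<cdot> ?s = wr \<epsilon>'' (g \<odot> f)"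
    by (subst (asm) h2) simp
  show ?thesis
    using assms(1,2) 1 2 by (simp add: F G T T' T'' is_cmd_cell1_iff cmd_comp1_eq)
qed

lemma cmd_comp1_assoc:
  assumes "is_cmd_cell1 K F" "is_cmd_cell1 K G" "is_cmd_cell1 K H"
    "csrc G = ctgt F" "csrc H = ctgt G"
  shows "cmd_comp1 K H (cmd_comp1 K G F) = cmd_comp1 K (cmd_comp1 K H G) F"
  using assms by (auto simp: is_cmd_cell1_iff cmd_comp1_eq is_comonad_iff)

lemma is_cmd_cell2_vcomp:
  assumes "is_cmd_cell2 K a" "is_cmd_cell2 K b" "cdom b = ccod a"
  shows "is_cmd_cell2 K \<lparr>cdom = cdom a, ccod = ccod b, und2 = und2 b \<cdot> und2 a\<rparr>"
proof -
  let ?F = "cdom a" and ?G = "ccod a" and ?H = "ccod b"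
  let ?k = "endo (csrc ?F)" and ?k' = "endo (ctgt ?F)"
  note [simp] = assms(3)
  have eq: "wr (und2 a) ?k \<cdot> swap ?F = swap ?G \<cdot> wl ?k' (und2 a)"
    "wr (und2 b) ?k \<cdot> swap ?G = swap ?H \<cdot> wl ?k' (und2 b)"
    using assms by (auto simp: is_cmd_cell2_iff)
  note [simp] = assms(1,2)[unfolded is_cmd_cell2_iff is_cmd_cell1_iff is_comonad_iff]
  have "wr (und2 b \<cdot> und2 a) ?k \<cdot> swap ?F = wr (und2 b) ?k \<cdot> (swap ?G \<cdot> wl ?k' (und2 a))"
    by simp
  also have "\<dots> = (swap ?H \<cdot> wl ?k' (und2 b)) \<cdot> wl ?k' (und2 a)"
    by (rule vcomp_reassoc[OF eq(2)]) simp_all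
  also have "\<dots> = swap ?H \<cdot> wl ?k' (und2 b \<cdot> und2 a)"
    by simp
  finally show ?thesis
    using assms by (auto simp: is_cmd_cell2_iff)
qed

text \<open>Exchanging the second 2-cell with the swap of \<open>cdom a\<close> brings the two
  compatibility squares together; after both are applied, a second exchange moves the first 2-cell
  past the swap of \<open>ccod b\<close>.\<close>

lemma is_cmd_cell2_hcomp:
  assumes "is_cmd_cell2 K a" "is_cmd_cell2 K b" "csrc (cdom b) = ctgt (cdom a)"
  shows "is_cmd_cell2 K \<lparr>cdom = cmd_comp1 K (cdom b) (cdom a),
    ccod = cmd_comp1 K (ccod b) (ccod a), und2 = und2 b \<star> und2 a\<rparr>"
proof -
  let ?F = "cdom a" and ?F' = "ccod a" and ?G = "cdom b" and ?G' = "ccod b"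
  let ?f = "und1 ?F" and ?f' = "und1 ?F'" and ?g = "und1 ?G" and ?g' = "und1 ?G'"
  let ?k = "endo (csrc ?F)" and ?k' = "endo (ctgt ?F)" and ?k'' = "endo (ctgt ?G)"
  let ?\<eta> = "und2 a" and ?\<theta> = "und2 b"
  let ?j = "swap ?F" and ?j' = "swap ?F'" and ?h = "swap ?G" and ?h' = "swap ?G'"
  note [simp] = assms(3)
  have eq: "wr ?\<eta> ?k \<cdot> ?j = ?j' \<cdot> wl ?k' ?\<eta>" "wr ?\<theta> ?k' \<cdot> ?h = ?h' \<cdot> wl ?k'' ?\<theta>"
    using assms by (auto simp: is_cmd_cell2_iff)
  have cells: "is_cmd_cell1 K ?F" "is_cmd_cell1 K ?F'" "is_cmd_cell1 K ?G" "is_cmd_cell1 K ?G'"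
    using assms by (auto simp: is_cmd_cell2_iff)
  note [simp] = assms(1,2)[unfolded is_cmd_cell2_iff is_cmd_cell1_iff is_comonad_iff]
  have "wr (?\<theta> \<star> ?\<eta>) ?k \<cdot> (wl ?g ?j \<cdot> wr ?h ?f)
    = wl ?g' (wr ?\<eta> ?k) \<cdot> (wr ?\<theta> (?f \<odot> ?k) \<cdot> (wl ?g ?j \<cdot> wr ?h ?f))"
    by (simp add: hcomp_eq)
  also have "wr ?\<theta> (?f \<odot> ?k) \<cdot> (wl ?g ?j \<cdot> wr ?h ?f)
    = wl ?g' ?j \<cdot> (wr ?\<theta> (?k' \<odot> ?f) \<cdot> wr ?h ?f)"
    by (rule exchange_reassoc[symmetric]) simp_all
  also have "wl ?g' (wr ?\<eta> ?k) \<cdot> (wl ?g' ?j \<cdot> (wr ?\<theta> (?k' \<odot> ?f) \<cdot> wr ?h ?f))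
    = wl ?g' (wr ?\<eta> ?k \<cdot> ?j) \<cdot> wr (wr ?\<theta> ?k' \<cdot> ?h) ?f"
    by (simp del: eq(1))
  also have "\<dots> = wl ?g' ?j' \<cdot> (wl (?g' \<odot> ?k') ?\<eta> \<cdot> (wr ?h' ?f \<cdot> wr (wl ?k'' ?\<theta>) ?f))"
    unfolding eq by simp
  also have "wl (?g' \<odot> ?k') ?\<eta> \<cdot> (wr ?h' ?f \<cdot> wr (wl ?k'' ?\<theta>) ?f)
    = wr ?h' ?f' \<cdot> (wl (?k'' \<odot> ?g') ?\<eta> \<cdot> wr (wl ?k'' ?\<theta>) ?f)"
    by (rule exchange_reassoc) simp_all
  finally have "wr (?\<theta> \<star> ?\<eta>) ?k \<cdot> (wl ?g ?j \<cdot> wr ?h ?f)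
    = (wl ?g' ?j' \<cdot> wr ?h' ?f') \<cdot> wl ?k'' (?\<theta> \<star> ?\<eta>)"
    by (simp add: hcomp_eq)
  moreover have "is_cmd_cell1 K (cmd_comp1 K ?G ?F)" "is_cmd_cell1 K (cmd_comp1 K ?G' ?F')"
    using cells by (auto intro: is_cmd_cell1_comp)
  ultimately show ?thesis
    by (simp add: is_cmd_cell2_iff cmd_comp1_eq)
qed

lemma cmd_id1_simps [simp]:
  "csrc (cmd_id1 K T) = T" "ctgt (cmd_id1 K T) = T" "und1 (cmd_id1 K T) = Id1 K (carr T)"
  by (simp_all add: cmd_id1_def)

lemma cmd_comp1_simps [simp]:
  "csrc (cmd_comp1 K G F) = csrc F" "ctgt (cmd_comp1 K G F) = ctgt G"
  "und1 (cmd_comp1 K G F) = und1 G \<odot> und1 F"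
  "swap (cmd_comp1 K G F) = wl (und1 G) (swap F) \<cdot> wr (swap G) (und1 F)"
  by (simp_all add: cmd_comp1_eq)

lemma cmd_comp1_id:
  assumes "is_cmd_cell1 K F"
  shows "csrc F = T \<Longrightarrow> cmd_comp1 K F (cmd_id1 K T) = F"
    "ctgt F = T \<Longrightarrow> cmd_comp1 K (cmd_id1 K T) F = F"
  using assms by (auto simp: is_cmd_cell1_iff is_comonad_iff cmd_comp1_eq cmd_id1_def)

lemma CmdStar_simps [simp]:
  "Cell0 (CmdStar K) = Collect (is_comonad K)"
  "Cell1 (CmdStar K) = Collect (is_cmd_cell1 K)"
  "Cell2 (CmdStar K) = Collect (is_cmd_cell2 K)"
  "Src (CmdStar K) = csrc" "Tgt (CmdStar K) = ctgt" "Dom (CmdStar K) = cdom" "Cod (CmdStar K) = ccod"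
  "Id1 (CmdStar K) = cmd_id1 K"
  "Id2 (CmdStar K) F = \<lparr>cdom = F, ccod = F, und2 = Id2 K (und1 F)\<rparr>"
  "Comp1 (CmdStar K) = cmd_comp1 K"
  "VComp (CmdStar K) b a = \<lparr>cdom = cdom a, ccod = ccod b, und2 = und2 b \<cdot> und2 a\<rparr>"
  "HComp (CmdStar K) b a = \<lparr>cdom = cmd_comp1 K (cdom b) (cdom a),
    ccod = cmd_comp1 K (ccod b) (ccod a), und2 = und2 b \<star> und2 a\<rparr>"
  by (simp_all add: CmdStar_def)

lemma is_cmd_cell1D:
  assumes "is_cmd_cell1 K F"
  shows "is_comonad K (csrc F)" "is_comonad K (ctgt F)" "und1 F \<in> Cell1 K"
    "Src K (und1 F) = carr (csrc F)" "Tgt K (und1 F) = carr (ctgt F)"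
  using assms by (auto simp: is_cmd_cell1_iff)

lemma is_cmd_cell2D:
  assumes "is_cmd_cell2 K a"
  shows "is_cmd_cell1 K (cdom a)" "is_cmd_cell1 K (ccod a)"
    "csrc (ccod a) = csrc (cdom a)" "ctgt (ccod a) = ctgt (cdom a)"
    "und2 a \<in> Cell2 K" "Dom K (und2 a) = und1 (cdom a)" "Cod K (und2 a) = und1 (ccod a)"
  using assms by (auto simp: is_cmd_cell2_iff)

lemma is_cmd_cell2_id2:
  assumes "is_cmd_cell1 K F"
  shows "is_cmd_cell2 K \<lparr>cdom = F, ccod = F, und2 = Id2 K (und1 F)\<rparr>"
  using assms by (auto simp: is_cmd_cell2_iff is_cmd_cell1_iff is_comonad_iff)

text \<open>A 2-cell is a 2-cell of \<open>K\<close> with its boundary, so its equations are those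
  of \<open>K\<close>; the rest is the closure of the defining conditions and the unit and
  associativity laws of 1-cells, shown above.\<close>

lemma is_two_category_CmdStar: "is_two_category (CmdStar K)"
proof (unfold_locales, goal_cases)
  case (14 a f g)
  then show ?case by (cases a) (auto simp: hom2_iff is_cmd_cell2_iff)
qed (auto simp: hom1_iff hom2_iff is_cmd_cell1_id is_cmd_cell1_comp is_cmd_cell2_id2
  is_cmd_cell2_vcomp is_cmd_cell2_hcomp is_cmd_cell1D is_cmd_cell2D cmd_comp1_id cmd_comp1_assoc
  hcomp_unit hcomp_assoc hcomp_interchange)

section \<open>The inclusion of identity comonads\<close>

lemma is_comonad_inc0: "X \<in> Cell0 K \<Longrightarrow> is_comonad K (inc0 K X)"
  by (simp add: is_comonad_iff inc0_def)

lemma inc0_simps [simp]: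
  "carr (inc0 K X) = X" "endo (inc0 K X) = Id1 K X"
  "comult (inc0 K X) = Id2 K (Id1 K X)" "coun (inc0 K X) = Id2 K (Id1 K X)"
  by (simp_all add: inc0_def)

lemma is_cmd_cell1_inc1: "f \<in> Cell1 K \<Longrightarrow> is_cmd_cell1 K (inc1 K f)"
  by (simp add: is_cmd_cell1_iff inc1_def is_comonad_inc0)

lemma inc1_simps [simp]:
  "csrc (inc1 K f) = inc0 K (Src K f)" "ctgt (inc1 K f) = inc0 K (Tgt K f)"
  "und1 (inc1 K f) = f" "swap (inc1 K f) = Id2 K f"
  by (simp_all add: inc1_def)

lemma is_cmd_cell2_inc:
  "a \<in> Cell2 K \<Longrightarrow> is_cmd_cell2 K \<lparr>cdom = inc1 K (Dom K a), ccod = inc1 K (Cod K a), und2 = a\<rparr>"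
  by (simp add: is_cmd_cell2_iff is_cmd_cell1_inc1)

lemma Inc_simps [simp]:
  "on0 (Inc K) = inc0 K" "on1 (Inc K) = inc1 K"
  "on2 (Inc K) a = \<lparr>cdom = inc1 K (Dom K a), ccod = inc1 K (Cod K a), und2 = a\<rparr>"
  by (simp_all add: Inc_def)

lemma inc1_comp1:
  "\<lbrakk>f \<in> Cell1 K; g \<in> Cell1 K; Src K g = Tgt K f\<rbrakk> \<Longrightarrow> inc1 K (g \<odot> f) = cmd_comp1 K (inc1 K g) (inc1 K f)"
  by (simp add: inc1_def cmd_comp1_eq)

lemma inc1_id1: "X \<in> Cell0 K \<Longrightarrow> inc1 K (Id1 K X) = cmd_id1 K (inc0 K X)"
  by (simp add: inc1_def cmd_id1_def)

lemma is_two_functor_Inc: "is_two_functor K (CmdStar K) (Inc K)"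
  by (intro is_two_functor.intro is_two_category_CmdStar is_two_category_axioms)
    (auto simp: hom1_iff hom2_iff is_comonad_inc0 is_cmd_cell1_inc1 is_cmd_cell2_inc inc1_comp1
      inc1_id1)

end

section \<open>Left 2-adjoints from universal arrows\<close>

context is_two_functor
begin

lemma on0_cell [simp]: "X \<in> Cell0 K \<Longrightarrow> on0 F X \<in> Cell0 L"
  by (rule on0_type)

lemma on1_simps [simp]:
  assumes "f \<in> Cell1 K"
  shows "on1 F f \<in> Cell1 L" "Src L (on1 F f) = on0 F (Src K f)" "Tgt L (on1 F f) = on0 F (Tgt K f)"
  using on1_type[of f "Src K f" "Tgt K f"] assms by (auto simp: hom1_iff)

lemma on2_simps [simp]:
  assumes "a \<in> Cell2 K"
  shows "on2 F a \<in> Cell2 L" "Dom L (on2 F a) = on1 F (Dom K a)" "Cod L (on2 F a) = on1 F (Cod K a)"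
  using on2_type[of a "Dom K a" "Cod K a"] assms by (auto simp: hom2_iff)

lemma on1_id1 [simp]: "X \<in> Cell0 K \<Longrightarrow> on1 F (Id1 K X) = Id1 L (on0 F X)"
  by (rule on1_Id1)

lemma on1_comp1 [simp]:
  "\<lbrakk>f \<in> Cell1 K; g \<in> Cell1 K; Src K g = Tgt K f\<rbrakk> \<Longrightarrow> on1 F (g \<odot>\<^bsub>K\<^esub> f) = on1 F g \<odot>\<^bsub>L\<^esub> on1 F f"
  using on1_Comp1[of f "Src K f" "Tgt K f" g] by (auto simp: hom1_iff)

lemma on2_id2 [simp]: "f \<in> Cell1 K \<Longrightarrow> on2 F (Id2 K f) = Id2 L (on1 F f)"
  by (rule on2_Id2)

lemma on2_vcomp [simp]:
  "\<lbrakk>a \<in> Cell2 K; b \<in> Cell2 K; Dom K b = Cod K a\<rbrakk> \<Longrightarrow> on2 F (b \<cdot>\<^bsub>K\<^esub> a) = on2 F b \<cdot>\<^bsub>L\<^esub> on2 F a"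
  using on2_VComp[of a "Dom K a" "Cod K a" b "Cod K b"] by (auto simp: hom2_iff)

lemma on2_hcomp [simp]:
  assumes "a \<in> Cell2 K" "b \<in> Cell2 K" "Src K (Dom K b) = Tgt K (Dom K a)"
  shows "on2 F (b \<star>\<^bsub>K\<^esub> a) = on2 F b \<star>\<^bsub>L\<^esub> on2 F a"
  using on2_HComp[of "Dom K a" "Src K (Dom K a)" "Tgt K (Dom K a)" a "Cod K a" "Dom K b" "Tgt K (Dom K b)" b "Cod K b"]
    assms is_two_category.cell1_simps(1)[OF source]
  by (auto simp: hom1_iff hom2_iff)

end

text \<open>Together \<open>univ1\<close> and \<open>univ2\<close> say that applying
  \<open>G\<close> and precomposing with \<open>u X\<close> is an isomorphism of categories from the
  cells \<open>F0 X\<close> to \<open>Y\<close> in \<open>L\<close> onto the cells \<open>X\<close>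
  to \<open>G Y\<close> in \<open>K\<close>: bijective on 1-cells, and on 2-cells between fixed
  1-cells.\<close>

locale two_universal =
  fixes K :: "('x, 'm, 'c) two_cat" and L :: "('x2, 'm2, 'c2) two_cat"
    and G :: "('x2, 'm2, 'c2, 'x, 'm, 'c) two_fctr" and F0 :: "'x \<Rightarrow> 'x2" and u :: "'x \<Rightarrow> 'm"
  assumes G: "is_two_functor L K G"
    and F0: "X \<in> Cell0 K \<Longrightarrow> F0 X \<in> Cell0 L"
    and u: "X \<in> Cell0 K \<Longrightarrow> u X \<in> hom1 K X (on0 G (F0 X))"
    and univ1: "\<lbrakk>X \<in> Cell0 K; Y \<in> Cell0 L; f \<in> hom1 K X (on0 G Y)\<rbrakk>
      \<Longrightarrow> \<exists>!h. h \<in> hom1 L (F0 X) Y \<and> on1 G h \<odot>\<^bsub>K\<^esub> u X = f"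
    and univ2: "\<lbrakk>X \<in> Cell0 K; h \<in> hom1 L (F0 X) Y; h' \<in> hom1 L (F0 X) Y;
        a \<in> hom2 K (on1 G h \<odot>\<^bsub>K\<^esub> u X) (on1 G h' \<odot>\<^bsub>K\<^esub> u X)\<rbrakk>
      \<Longrightarrow> \<exists>!b. b \<in> hom2 L h h' \<and> on2 G b \<star>\<^bsub>K\<^esub> Id2 K (u X) = a"
begin

sublocale G: is_two_functor L K G by (rule G)
sublocale K: is_two_category K by (rule G.target)
sublocale L: is_two_category L by (rule G.source)

notation K.wl (infixr "\<rhd>" 75)
notation K.wr (infixl "\<lhd>" 76)

declare F0 [simp]

lemma u_simps [simp]:
  assumes "X \<in> Cell0 K"
  shows "u X \<in> Cell1 K" "Src K (u X) = X" "Tgt K (u X) = on0 G (F0 X)"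
  using u[OF assms] by (auto simp: hom1_iff)

text \<open>The uniqueness clauses used as extensionality: cells out of \<open>F0 X\<close> are
  compared after applying \<open>G\<close> and precomposing with \<open>u X\<close>. The equations
  of the adjunction that are not defining equations are proved by this rule and
  \<open>eq2I\<close>.\<close>

lemma eq1I:
  assumes "on1 G h \<odot>\<^bsub>K\<^esub> u X = on1 G h' \<odot>\<^bsub>K\<^esub> u X" "X \<in> Cell0 K" "h \<in> Cell1 L" "h' \<in> Cell1 L"
    "Src L h = F0 X" "Src L h' = F0 X" "Tgt L h = Tgt L h'"
  shows "h = h'"
  using univ1[of X "Tgt L h" "on1 G h \<odot>\<^bsub>K\<^esub> u X"] assms by (auto simp: hom1_iff)

lemma eq2I:
  assumes "on2 G b \<lhd> u X = on2 G b' \<lhd> u X" "X \<in> Cell0 K" "b \<in> Cell2 L" "b' \<in> Cell2 L"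
    "Src L (Dom L b) = F0 X" "Dom L b = Dom L b'" "Cod L b = Cod L b'"
  shows "b = b'"
  using univ2[of X "Dom L b" "Tgt L (Dom L b)" "Cod L b" "on2 G b \<lhd> u X"] assms
    L.cell1_simps[of b]
  by (auto simp: hom1_iff hom2_iff K.wr_def)

section \<open>The left 2-adjoint, determined by naturality of the unit\<close>

definition F1 :: "'m \<Rightarrow> 'm2" where
  "F1 f = (THE h. h \<in> hom1 L (F0 (Src K f)) (F0 (Tgt K f)) \<and>
    on1 G h \<odot>\<^bsub>K\<^esub> u (Src K f) = u (Tgt K f) \<odot>\<^bsub>K\<^esub> f)"

lemma F1:
  assumes "f \<in> Cell1 K"
  shows "F1 f \<in> Cell1 L" "Src L (F1 f) = F0 (Src K f)" "Tgt L (F1 f) = F0 (Tgt K f)"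
    "on1 G (F1 f) \<odot>\<^bsub>K\<^esub> u (Src K f) = u (Tgt K f) \<odot>\<^bsub>K\<^esub> f"
  using theI'[OF univ1[of "Src K f" "F0 (Tgt K f)" "u (Tgt K f) \<odot>\<^bsub>K\<^esub> f"]] assms
  unfolding F1_def[symmetric] by (auto simp: hom1_iff)

lemmas F1_simps [simp] = F1(1-3)

lemma F1_u [simp]:
  "\<lbrakk>f \<in> Cell1 K; Src K f = X\<rbrakk> \<Longrightarrow> on1 G (F1 f) \<odot>\<^bsub>K\<^esub> u X = u (Tgt K f) \<odot>\<^bsub>K\<^esub> f"
  using F1(4) by auto

text \<open>Composites are nested to the right, so the naturality square is also needed with a
  tail.\<close>

lemma F1_u_assoc [simp]:
  "\<lbrakk>f \<in> Cell1 K; Src K f = X; g \<in> Cell1 K; Tgt K g = X\<rbrakk>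
    \<Longrightarrow> on1 G (F1 f) \<odot>\<^bsub>K\<^esub> (u X \<odot>\<^bsub>K\<^esub> g) = u (Tgt K f) \<odot>\<^bsub>K\<^esub> (f \<odot>\<^bsub>K\<^esub> g)"
  using K.comp1_assoc[of g "u X" "on1 G (F1 f)"] by auto

definition F2 :: "'c \<Rightarrow> 'c2" where
  "F2 a = (THE b. b \<in> hom2 L (F1 (Dom K a)) (F1 (Cod K a)) \<and>
    on2 G b \<star>\<^bsub>K\<^esub> Id2 K (u (Src K (Dom K a))) = u (Tgt K (Dom K a)) \<rhd> a)"

lemma F2:
  assumes "a \<in> Cell2 K"
  shows "F2 a \<in> Cell2 L" "Dom L (F2 a) = F1 (Dom K a)" "Cod L (F2 a) = F1 (Cod K a)"
    "on2 G (F2 a) \<lhd> u (Src K (Dom K a)) = u (Tgt K (Dom K a)) \<rhd> a"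
  using theI'[OF univ2[of "Src K (Dom K a)" "F1 (Dom K a)" "F0 (Tgt K (Dom K a))" "F1 (Cod K a)"
      "u (Tgt K (Dom K a)) \<rhd> a"]] assms
  unfolding F2_def[symmetric] by (auto simp: hom1_iff hom2_iff K.wr_def)

lemmas F2_simps [simp] = F2(1-3)

lemma F2_u [simp]:
  "\<lbrakk>a \<in> Cell2 K; Src K (Dom K a) = X\<rbrakk> \<Longrightarrow> on2 G (F2 a) \<lhd> u X = u (Tgt K (Dom K a)) \<rhd> a"
  using F2(4) by auto

definition F :: "('x, 'm, 'c, 'x2, 'm2, 'c2) two_fctr" where
  "F = \<lparr>on0 = F0, on1 = F1, on2 = F2\<rparr>"

lemma F_simps [simp]: "on0 F = F0" "on1 F = F1" "on2 F = F2"
  by (simp_all add: F_def)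

lemma F1_comp1 [simp]:
  "\<lbrakk>f \<in> Cell1 K; g \<in> Cell1 K; Src K g = Tgt K f\<rbrakk> \<Longrightarrow> F1 (g \<odot>\<^bsub>K\<^esub> f) = F1 g \<odot>\<^bsub>L\<^esub> F1 f"
  by (rule eq1I[of _ "Src K f"]) simp_all

lemma F2_hcomp:
  assumes [simp]: "a \<in> Cell2 K" "b \<in> Cell2 K" "Src K (Dom K b) = Tgt K (Dom K a)"
  shows "F2 (b \<star>\<^bsub>K\<^esub> a) = F2 b \<star>\<^bsub>L\<^esub> F2 a"
proof (rule eq2I[of _ "Src K (Dom K a)"])
  let ?u = "u (Src K (Dom K a))" and ?u' = "u (Tgt K (Dom K a))" and ?u'' = "u (Tgt K (Dom K b))"
  \<comment> \<open>Whiskering by a composite unfolds into iterated whiskering, so nested whiskers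
    must be folded back before naturality of \<open>u\<close> on 1-cells can be applied to the
    composite.\<close>
  have 1: "on1 G (F1 (Cod K b)) \<rhd> ?u' \<rhd> a = ?u'' \<rhd> Cod K b \<rhd> a"
    by (simp flip: K.wl_comp1)
  have 2: "on2 G (F2 b) \<lhd> on1 G (F1 (Dom K a)) \<lhd> ?u = (?u'' \<rhd> b) \<lhd> Dom K a"
    by (simp flip: K.wr_comp1 del: K.wr_wl) (simp del: K.wr_wl)
  show "on2 G (F2 (b \<star>\<^bsub>K\<^esub> a)) \<lhd> ?u = on2 G (F2 b \<star>\<^bsub>L\<^esub> F2 a) \<lhd> ?u"
    using 1 2 by (simp add: K.hcomp_eq)
qed simp_all

lemma is_two_functor_F: "is_two_functor K L F"
proof (intro is_two_functor.intro K.is_two_category_axioms L.is_two_category_axioms, goal_cases)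
  case (4 X)
  then show ?case by (auto intro: eq1I[of _ X])
next
  case (6 f)
  then show ?case by (auto simp: intro!: eq2I[of _ "Src K f"])
next
  case (7 a f g b h)
  then show ?case by (auto simp: hom2_iff intro!: eq2I[of _ "Src K f"])
qed (auto simp: hom1_iff hom2_iff F2_hcomp)

text \<open>The transpose of the identity, so that one triangle identity holds by definition; the
  other follows from uniqueness.\<close>

definition e :: "'x2 \<Rightarrow> 'm2" where
  "e Y = (THE h. h \<in> hom1 L (F0 (on0 G Y)) Y \<and> on1 G h \<odot>\<^bsub>K\<^esub> u (on0 G Y) = Id1 K (on0 G Y))"

lemma e_simps [simp]:
  assumes "Y \<in> Cell0 L"
  shows "e Y \<in> Cell1 L" "Src L (e Y) = F0 (on0 G Y)" "Tgt L (e Y) = Y"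
    "on1 G (e Y) \<odot>\<^bsub>K\<^esub> u (on0 G Y) = Id1 K (on0 G Y)"
  using theI'[OF univ1[of "on0 G Y" Y "Id1 K (on0 G Y)"]] assms
  unfolding e_def[symmetric] by (auto simp: hom1_iff)

lemma e_u_assoc [simp]:
  "\<lbrakk>Y \<in> Cell0 L; f \<in> Cell1 K; Tgt K f = on0 G Y\<rbrakk> \<Longrightarrow> on1 G (e Y) \<odot>\<^bsub>K\<^esub> (u (on0 G Y) \<odot>\<^bsub>K\<^esub> f) = f"
  using K.comp1_assoc[of f "u (on0 G Y)" "on1 G (e Y)"] by auto

lemma is_two_functor_id: "is_two_functor K K id_two_fctr" "is_two_functor L L id_two_fctr"
  by (auto intro!: is_two_functor.intro K.is_two_category_axioms L.is_two_category_axioms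
      simp: id_two_fctr_def)

end

lemma is_two_functor_comp:
  assumes "is_two_functor K L F" "is_two_functor L M G"
  shows "is_two_functor K M (comp_two_fctr G F)"
proof -
  interpret F: is_two_functor K L F by fact
  interpret G: is_two_functor L M G by fact
  show ?thesis
    by (intro is_two_functor.intro F.source G.target)
      (auto simp: comp_two_fctr_def hom1_iff hom2_iff)
qed

context two_universal
begin

text \<open>After \<open>G\<close> and whiskering with the unit, both sides reduce to
  \<open>on2 G a\<close>. Agreement of the boundaries is naturality of \<open>e\<close> on
  1-cells.\<close>

lemma e_natural2:
  assumes [simp]: "a \<in> Cell2 L"
  shows "Id2 L (e (Tgt L (Dom L a))) \<star>\<^bsub>L\<^esub> F2 (on2 G a) = a \<star>\<^bsub>L\<^esub> Id2 L (e (Src L (Dom L a)))"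
proof (rule eq2I[of _ "on0 G (Src L (Dom L a))"])
  let ?X = "Src L (Dom L a)" and ?Y = "Tgt L (Dom L a)"
  have 1: "on1 G (e ?Y) \<rhd> u (on0 G ?Y) \<rhd> on2 G a = on2 G a"
    by (simp flip: K.wl_comp1)
  have 2: "on2 G a \<lhd> on1 G (e ?X) \<lhd> u (on0 G ?X) = on2 G a"
    by (simp flip: K.wr_comp1)
  show "on2 G (Id2 L (e ?Y) \<star>\<^bsub>L\<^esub> F2 (on2 G a)) \<lhd> u (on0 G ?X)
    = on2 G (a \<star>\<^bsub>L\<^esub> Id2 L (e ?X)) \<lhd> u (on0 G ?X)"
    using 1 2 by (simp flip: K.wl_def K.wr_def)
  show "Dom L (Id2 L (e ?Y) \<star>\<^bsub>L\<^esub> F2 (on2 G a)) = Dom L (a \<star>\<^bsub>L\<^esub> Id2 L (e ?X))"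
    by (auto intro!: eq1I[of _ "on0 G ?X"])
  show "Cod L (Id2 L (e ?Y) \<star>\<^bsub>L\<^esub> F2 (on2 G a)) = Cod L (a \<star>\<^bsub>L\<^esub> Id2 L (e ?X))"
    by (auto intro!: eq1I[of _ "on0 G ?X"])
qed simp_all

text \<open>Naturality of \<open>u\<close> and one triangle identity are the defining equations of
  \<open>F1\<close>, \<open>F2\<close> and \<open>e\<close>. The equations settled by uniqueness
  compare cells out of some \<open>F0 X\<close>.\<close>

theorem is_two_adjunction: "is_two_adjunction K L F G u e"
proof (intro is_two_adjunction.intro is_two_nat_trans.intro is_two_functor_F G
    is_two_functor_comp[of K L F K G] is_two_functor_comp[of L K G L F] is_two_functor_id, goal_cases)
  case (5 f X Y)
  then show ?case
    by (auto simp: comp_two_fctr_def id_two_fctr_def hom1_iff intro!: eq1I[of _ "on0 G X"])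
next
  case (7 X)
  then show ?case by (auto intro!: eq1I[of _ X])
qed (auto simp: comp_two_fctr_def id_two_fctr_def hom1_iff hom2_iff e_natural2
    simp flip: K.wl_def K.wr_def)

end

section \<open>Kleisli objects\<close>

context is_two_category
begin

text \<open>A right coaction of the comonad on the 1-cell \<open>g\<close>, which is what a 1-cell
  of \<open>CmdStar K\<close> into an identity comonad amounts to.\<close>

definition is_coalgebra :: "('x, 'm, 'c) comonad \<Rightarrow> 'm \<Rightarrow> 'c \<Rightarrow> bool" where
  "is_coalgebra T g j \<longleftrightarrow>
    g \<in> Cell1 K \<and> Src K g = carr T \<and> j \<in> Cell2 K \<and> Dom K j = g \<and> Cod K j = g \<odot> endo T \<and>
    wl g (comult T) \<cdot> j = wr j (endo T) \<cdot> j \<and> wl g (coun T) \<cdot> j = Id2 K g"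

text \<open>\<open>(U, s)\<close> represents coalgebras: the second conjunct is the universal
  property for 1-cells, the third for 2-cells. The equation assumed of \<open>a\<close> there says
  that \<open>a\<close> is a morphism between the coalgebras induced by \<open>h\<close> and
  \<open>h'\<close>.\<close>

definition is_kleisli :: "('x, 'm, 'c) comonad \<Rightarrow> 'm \<Rightarrow> 'c \<Rightarrow> bool" where
  "is_kleisli T U s \<longleftrightarrow> is_coalgebra T U s \<and>
    (\<forall>g j. is_coalgebra T g j \<longrightarrow>
      (\<exists>!h. h \<in> hom1 K (Tgt K U) (Tgt K g) \<and> h \<odot> U = g \<and> wl h s = j)) \<and>
    (\<forall>h\<in>Cell1 K. \<forall>h'\<in>Cell1 K. \<forall>a\<in>hom2 K (h \<odot> U) (h' \<odot> U).
      Src K h = Tgt K U \<longrightarrow> Src K h' = Tgt K U \<longrightarrow> Tgt K h = Tgt K h' \<longrightarrow>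
      wr a (endo T) \<cdot> wl h s = wl h' s \<cdot> a \<longrightarrow> (\<exists>!b. b \<in> hom2 K h h' \<and> wr b U = a))"

text \<open>The endomorphism, comultiplication and counit of the target are identities, so the unit
  laws strip them from the two laws of a comonad 1-cell.\<close>

lemma cmd_cell1_inc0_iff:
  assumes "is_comonad K T"
  shows "F \<in> hom1 (CmdStar K) T (inc0 K Y) \<longleftrightarrow>
    Y \<in> Cell0 K \<and> csrc F = T \<and> ctgt F = inc0 K Y \<and> is_coalgebra T (und1 F) (swap F) \<and> Tgt K (und1 F) = Y"
proof -
  note [simp] = assms[unfolded is_comonad_iff]
  show ?thesis
    using assms
    by (auto simp: hom1_iff is_cmd_cell1_iff is_coalgebra_def is_comonad_inc0)
qed

lemma two_universal_Inc:
  assumes kl: "\<And>T. is_comonad K T \<Longrightarrow> is_kleisli T (U T) (s T)"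
  shows "two_universal (CmdStar K) K (Inc K) (\<lambda>T. Tgt K (U T))
    (\<lambda>T. \<lparr>csrc = T, ctgt = inc0 K (Tgt K (U T)), und1 = U T, swap = s T\<rparr>)"
proof (intro two_universal.intro is_two_functor_Inc, goal_cases)
  case (1 T)
  then show ?case using kl[of T] by (auto simp: is_kleisli_def is_coalgebra_def)
next
  case (2 T)
  then show ?case using kl[of T]
    by (subst Inc_simps, subst cmd_cell1_inc0_iff) (auto simp: is_kleisli_def is_coalgebra_def)
next
  case (3 T Y F)
  then have T: "is_comonad K T" by simp
  note [simp] = T[unfolded is_comonad_iff]
  have F: "csrc F = T" "ctgt F = inc0 K Y" "is_coalgebra T (und1 F) (swap F)" "Tgt K (und1 F) = Y"
    using 3(3) cmd_cell1_inc0_iff[OF T] by auto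
  have U: "is_coalgebra T (U T) (s T)"
    using kl[OF T] by (simp add: is_kleisli_def)
  have "\<exists>!h. h \<in> hom1 K (Tgt K (U T)) Y \<and> h \<odot> U T = und1 F \<and> wl h (s T) = swap F"
    using kl[OF T] F unfolding is_kleisli_def by blast
  \<comment> \<open>\<open>inc1 K h\<close> has an identity swap, so composing with it postcomposes
    \<open>U T\<close> and whiskers \<open>s T\<close> by \<open>h\<close>. Only these two
    components remain to be compared with \<open>F\<close>.\<close>
  moreover have "cmd_comp1 K (inc1 K h)
      \<lparr>csrc = T, ctgt = inc0 K (Tgt K (U T)), und1 = U T, swap = s T\<rparr> = F
    \<longleftrightarrow> h \<odot> U T = und1 F \<and> wl h (s T) = swap F" if "h \<in> hom1 K (Tgt K (U T)) Y" for h
    using that U F(1,2) by (cases F) (auto simp: cmd_comp1_eq hom1_iff is_coalgebra_def)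
  ultimately show ?case by (simp cong: conj_cong)
next
  case (4 T h Y h' a)
  then have T: "is_comonad K T" by simp
  note [simp] = T[unfolded is_comonad_iff]
  let ?u = "\<lparr>csrc = T, ctgt = inc0 K (Tgt K (U T)), und1 = U T, swap = s T\<rparr>"
  have [simp]: "h \<in> Cell1 K" "h' \<in> Cell1 K" "Src K h = Tgt K (U T)" "Src K h' = Tgt K (U T)"
    "Tgt K h = Y" "Tgt K h' = Y"
    using 4(2,3) by (auto simp: hom1_iff)
  have U: "is_coalgebra T (U T) (s T)"
    using kl[OF T] by (simp add: is_kleisli_def)
  note [simp] = U[unfolded is_coalgebra_def]
  have a: "is_cmd_cell2 K a" "cdom a = cmd_comp1 K (inc1 K h) ?u" "ccod a = cmd_comp1 K (inc1 K h') ?u"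
    using 4(4) by (auto simp: hom2_iff)
  have [simp]: "und2 a \<in> Cell2 K" "Dom K (und2 a) = h \<odot> U T" "Cod K (und2 a) = h' \<odot> U T"
    using a by (auto simp: is_cmd_cell2_iff)
  have eq: "wr (und2 a) (endo T) \<cdot> wl h (s T) = wl h' (s T) \<cdot> und2 a"
    using a by (auto simp: is_cmd_cell2_iff)
  have "\<exists>!b. b \<in> hom2 K h h' \<and> wr b (U T) = und2 a"
    using kl[OF T, unfolded is_kleisli_def] eq by (simp add: hom2_iff)
  \<comment> \<open>The boundaries agree by assumption, so equality with \<open>a\<close> is
    equality of the underlying 2-cells.\<close>
  moreover have "b \<in> hom2 K h h' \<and> on2 (Inc K) b \<star>\<^bsub>CmdStar K\<^esub> Id2 (CmdStar K) ?u = a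
    \<longleftrightarrow> b \<in> hom2 K h h' \<and> wr b (U T) = und2 a" for b
    using a(2,3) by (cases a) (auto simp: hom2_iff wr_def)
  ultimately show ?case by simp
qed

text \<open>Kleisli objects are chosen for all comonads at once; the uniqueness clauses turn any
  such choice into a 2-functor.\<close>

theorem Inc_left_two_adjoint:
  assumes "\<And>T. is_comonad K T \<Longrightarrow> \<exists>U s. is_kleisli T U s"
  shows "\<exists>L. is_left_two_adjoint (CmdStar K) K L (Inc K)"
proof -
  obtain U s where "\<And>T. is_comonad K T \<Longrightarrow> is_kleisli T (U T) (s T)"
    using assms by metis
  from two_universal.is_two_adjunction[OF two_universal_Inc[OF this]]
  show ?thesis unfolding is_left_two_adjoint_def by blast
qed

end

section \<open>Categories and functors\<close>

lemma Pos_simps [simp]: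
  "Obj Pos = {X. partial_order_on (pts X) (ple X)}"
  "partial_order_on (pts X) (ple X) \<Longrightarrow> Idm Pos X = (\<lambda>x\<in>pts X. x)"
  by (simp_all add: Pos_def Let_def)

lemma Cmp_Pos:
  "f \<in> Hom Pos X Y \<Longrightarrow> g \<in> Hom Pos Y Z \<Longrightarrow> Cmp Pos X Y Z g f = compose (pts X) g f"
  "\<not> (f \<in> Hom Pos X Y \<and> g \<in> Hom Pos Y Z) \<Longrightarrow> Cmp Pos X Y Z g f = undefined"
  unfolding Pos_def Let_def cat.simps by (rule if_P, blast) (rule if_not_P)

lemma Hom_Pos_iff [simp]:
  "f \<in> Hom Pos X Y \<longleftrightarrow> partial_order_on (pts X) (ple X) \<and> partial_order_on (pts Y) (ple Y) \<and>
    f \<in> pts X \<rightarrow>\<^sub>E pts Y \<and> (\<forall>x y. (x, y) \<in> ple X \<longrightarrow> (f x, f y) \<in> ple Y)"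
  by (simp add: Pos_def Let_def) blast

lemma is_category_Pos: "is_category Pos"
proof
  have *: "compose (pts X) k l \<in> Hom Pos X Z" if "l \<in> Hom Pos X Y" "k \<in> Hom Pos Y Z"
    for k l :: "'a \<Rightarrow> 'a" and X Y Z
    using that partial_order_onD(1)[of "pts X" "ple X"]
    by (auto simp: compose_def partial_order_on_def preorder_on_def refl_on_def)
  show "Cmp Pos A B D g f \<in> Hom Pos A D" if "f \<in> Hom Pos A B" "g \<in> Hom Pos B D"
    for f g :: "'a \<Rightarrow> 'a" and A B D
    using *[OF that] by (simp only: Cmp_Pos(1)[OF that])
  show "Idm Pos \<in> extensional (Obj Pos)"
    by (simp add: Pos_def Let_def)
  fix f g h :: "'a \<Rightarrow> 'a" and A B D E
  assume fgh: "f \<in> Hom Pos A B" "g \<in> Hom Pos B D" "h \<in> Hom Pos D E"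
  have "Cmp Pos A D E h (Cmp Pos A B D g f) = compose (pts A) h (compose (pts A) g f)"
    using Cmp_Pos(1)[OF *[OF fgh(1,2)] fgh(3)] Cmp_Pos(1)[OF fgh(1,2)] by simp
  moreover have "Cmp Pos A B E (Cmp Pos B D E h g) f = compose (pts A) (compose (pts B) h g) f"
    using Cmp_Pos(1)[OF fgh(1) *[OF fgh(2,3)]] Cmp_Pos(1)[OF fgh(2,3)] by simp
  ultimately show "Cmp Pos A D E h (Cmp Pos A B D g f) = Cmp Pos A B E (Cmp Pos B D E h g) f"
    using fgh by (auto simp: compose_def fun_eq_iff)
next
  fix f :: "'a \<Rightarrow> 'a" and A B
  assume f: "f \<in> Hom Pos A B"
  have id: "(\<lambda>x\<in>pts X. x) \<in> Hom Pos X X" if "partial_order_on (pts X) (ple X)" for X :: "'a poset"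
    using that by (auto simp: partial_order_on_def preorder_on_def refl_on_def)
  show "Cmp Pos A A B f (Idm Pos A) = f" "Cmp Pos A B B (Idm Pos B) f = f"
    using f id Cmp_Pos(1)[OF id f] Cmp_Pos(1)[OF f id]
    by (auto simp: compose_def PiE_iff intro!: extensionalityI[of _ "pts A"])
next
  fix A :: "'a poset" assume "A \<in> Obj Pos"
  then show "Idm Pos A \<in> Hom Pos A A"
    by (auto simp: partial_order_on_def preorder_on_def refl_on_def)
qed (simp, erule Cmp_Pos(2))

section \<open>Opposite categories and composition of functors\<close>

lemma Op_simps [simp]:
  "Obj (Op C) = Obj C" "Hom (Op C) A B = Hom C B A" "Idm (Op C) = Idm C"
  "Cmp (Op C) A B D g f = Cmp C D B A f g"
  by (simp_all add: Op_def)

lemma is_category_Op: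
  assumes "is_category C"
  shows "is_category (Op C)"
proof -
  interpret is_category C by fact
  show ?thesis
    by unfold_locales (auto simp: Cmp_assoc Idm_ext Cmp_Idm_left Cmp_Idm_right Cmp_Hom Idm_Hom
        dest: Hom_Obj intro: Cmp_ext)
qed

lemma id_fctr_simps [simp]:
  "fobj (id_fctr C) = (\<lambda>A\<in>Obj C. A)" "farr (id_fctr C) A B = (\<lambda>f\<in>Hom C A B. f)"
  by (simp_all add: id_fctr_def)

lemma comp_fctr_simps [simp]:
  "fobj (comp_fctr C G F) = (\<lambda>A\<in>Obj C. fobj G (fobj F A))"
  "farr (comp_fctr C G F) A B = (\<lambda>f\<in>Hom C A B. farr G (fobj F A) (fobj F B) (farr F A B f))"
  by (simp_all add: comp_fctr_def)

lemma op_fctr_simps [simp]: "fobj (op_fctr F) = fobj F" "farr (op_fctr F) A B = farr F B A"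
  by (simp_all add: op_fctr_def)

context is_category
begin

lemmas cat_simps [simp] = Idm_Hom Cmp_Hom Cmp_Idm_right Cmp_Idm_left

lemma Hom_ObjD: "f \<in> Hom C A B \<Longrightarrow> A \<in> Obj C" "f \<in> Hom C A B \<Longrightarrow> B \<in> Obj C"
  using Hom_Obj by auto

lemma Cmp_assoc' [simp]:
  "\<lbrakk>f \<in> Hom C A B; g \<in> Hom C B D; h \<in> Hom C D E\<rbrakk>
    \<Longrightarrow> Cmp C A B E (Cmp C B D E h g) f = Cmp C A D E h (Cmp C A B D g f)"
  by (rule Cmp_assoc[symmetric])

lemma is_functor_id: "is_functor C C (id_fctr C)"
  by unfold_locales (auto dest: Hom_ObjD)

end

context is_functor
begin

sublocale S: is_category C by (rule source)
sublocale T: is_category D by (rule target)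

lemma fobj_Obj [simp]: "A \<in> Obj C \<Longrightarrow> fobj F A \<in> Obj D"
  using fobj_type by auto

lemma farr_Hom [simp]: "f \<in> Hom C A B \<Longrightarrow> farr F A B f \<in> Hom D (fobj F A) (fobj F B)"
  using farr_type by auto

lemmas functor_simps [simp] = farr_Idm farr_Cmp

lemma is_functor_op: "is_functor (Op C) (Op D) (op_fctr F)"
  using fobj_type farr_type by (intro is_functor.intro is_category_Op source target) auto

end

lemma is_functorI:
  assumes "is_category C" "is_category D"
    "fobj F \<in> extensional (Obj C)" "\<And>A B. farr F A B \<in> extensional (Hom C A B)"
    "\<And>A. A \<in> Obj C \<Longrightarrow> fobj F A \<in> Obj D"
    "\<And>A B f. f \<in> Hom C A B \<Longrightarrow> farr F A B f \<in> Hom D (fobj F A) (fobj F B)"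
    "\<And>A. A \<in> Obj C \<Longrightarrow> farr F A A (Idm C A) = Idm D (fobj F A)"
    "\<And>A B E f g. \<lbrakk>f \<in> Hom C A B; g \<in> Hom C B E\<rbrakk> \<Longrightarrow> farr F A E (Cmp C A B E g f)
      = Cmp D (fobj F A) (fobj F B) (fobj F E) (farr F B E g) (farr F A B f)"
  shows "is_functor C D F"
  using assms by (intro is_functor.intro) (auto simp: PiE_iff)

text \<open>Both functors are \<open>undefined\<close> off their domains, so agreement on the
  objects and arrows of \<open>C\<close> is equality of records.\<close>

lemma fctr_eqI:
  fixes F :: "('o, 'a, 'o2, 'a2) fctr"
  assumes "is_functor C D F" "is_functor C E G" "\<And>A. A \<in> Obj C \<Longrightarrow> fobj F A = fobj G A"
    "\<And>A B f. f \<in> Hom C A B \<Longrightarrow> farr F A B f = farr G A B f"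
  shows "F = G"
proof (rule fctr.equality)
  interpret F: is_functor C D F by fact
  interpret G: is_functor C E G by fact
  show "fobj F = fobj G"
    using F.fobj_type G.fobj_type assms(3) by (intro extensionalityI[of _ "Obj C"]) (auto simp: PiE_iff)
  show "farr F = farr G"
  proof (rule ext, rule ext, rule extensionalityI)
    fix A B
    show "farr F A B \<in> extensional (Hom C A B)" "farr G A B \<in> extensional (Hom C A B)"
      using F.farr_type G.farr_type by (auto simp: PiE_iff)
  qed (rule assms(4))
qed simp

lemma is_functor_comp:
  assumes "is_functor C D F" "is_functor D E G"
  shows "is_functor C E (comp_fctr C G F)"
proof -
  interpret F: is_functor C D F by fact
  interpret G: is_functor D E G by fact
  show ?thesis
    by (rule is_functorI) (auto intro: F.source G.target dest: F.S.Hom_ObjD)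
qed

section \<open>Indexed posets\<close>

abbreviation "fpts P A \<equiv> pts (fobj (fib P) A)"
abbreviation "fle P A x y \<equiv> (x, y) \<in> ple (fobj (fib P) A)"
text \<open>The indices follow \<open>f\<close> as an arrow from \<open>A\<close> to
  \<open>B\<close> of the base, hence are swapped for \<open>farr\<close>, which sees
  \<open>f\<close> in the opposite category.\<close>

abbreviation "reidx P A B f \<equiv> farr (fib P) B A f"

locale idxpos =
  fixes P :: "('o, 'a, 'p) idxpos"
  assumes is_idxpos: "is_idxpos P"
begin

sublocale C: is_category "base P"
  using is_idxpos by (simp add: is_idxpos_def)

sublocale fib: is_functor "Op (base P)" Pos "fib P"
  using is_idxpos by (simp add: is_idxpos_def)

lemma fib_order: "A \<in> Obj (base P) \<Longrightarrow> partial_order_on (fpts P A) (ple (fobj (fib P) A))"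
  using fib.fobj_Obj[of A] by simp

lemma fle_refl [simp]: "A \<in> Obj (base P) \<Longrightarrow> x \<in> fpts P A \<Longrightarrow> fle P A x x"
  using fib_order[of A] by (auto simp: partial_order_on_def preorder_on_def refl_on_def)

lemma fle_trans: "A \<in> Obj (base P) \<Longrightarrow> fle P A x y \<Longrightarrow> fle P A y z \<Longrightarrow> fle P A x z"
  using fib_order[of A] by (auto simp: partial_order_on_def preorder_on_def trans_def)

lemma fle_antisym: "A \<in> Obj (base P) \<Longrightarrow> fle P A x y \<Longrightarrow> fle P A y x \<Longrightarrow> x = y"
  using fib_order[of A] by (auto simp: partial_order_on_def antisym_def)

lemma reidx_fpts [simp]: "f \<in> Hom (base P) A B \<Longrightarrow> x \<in> fpts P B \<Longrightarrow> reidx P A B f x \<in> fpts P A"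
  using fib.farr_Hom[of f B A] by auto

lemma reidx_mono: "f \<in> Hom (base P) A B \<Longrightarrow> fle P B x y \<Longrightarrow> fle P A (reidx P A B f x) (reidx P A B f y)"
  using fib.farr_Hom[of f B A] by auto

lemma reidx_Idm [simp]: "A \<in> Obj (base P) \<Longrightarrow> x \<in> fpts P A \<Longrightarrow> reidx P A A (Idm (base P) A) x = x"
  using fib.farr_Idm[of A] fib_order by auto

lemma reidx_Cmp [simp]:
  assumes "f \<in> Hom (base P) A B" "g \<in> Hom (base P) B D" "x \<in> fpts P D"
  shows "reidx P A D (Cmp (base P) A B D g f) x = reidx P A B f (reidx P B D g x)"
proof -
  have g: "reidx P B D g \<in> Hom Pos (fobj (fib P) D) (fobj (fib P) B)"
    and f: "reidx P A B f \<in> Hom Pos (fobj (fib P) B) (fobj (fib P) A)"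
    using fib.farr_Hom assms by auto
  show ?thesis
    using fib.farr_Cmp[of g D B f A, unfolded Cmp_Pos(1)[OF g f]] assms by (simp add: compose_def)
qed

end

lemma is_idxposI:
  assumes "is_category (base P)" "fobj (fib P) \<in> extensional (Obj (base P))"
    and "\<And>A B. farr (fib P) B A \<in> extensional (Hom (base P) A B)"
    and ord: "\<And>A. A \<in> Obj (base P) \<Longrightarrow> partial_order_on (fpts P A) (ple (fobj (fib P) A))"
    and ext: "\<And>A B f. f \<in> Hom (base P) A B \<Longrightarrow> reidx P A B f \<in> fpts P B \<rightarrow>\<^sub>E fpts P A"
    and mono: "\<And>A B f x y. f \<in> Hom (base P) A B \<Longrightarrow> fle P B x y
      \<Longrightarrow> fle P A (reidx P A B f x) (reidx P A B f y)"
    and id: "\<And>A x. A \<in> Obj (base P) \<Longrightarrow> x \<in> fpts P A \<Longrightarrow> reidx P A A (Idm (base P) A) x = x"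
    and comp: "\<And>A B D f g x. \<lbrakk>f \<in> Hom (base P) A B; g \<in> Hom (base P) B D; x \<in> fpts P D\<rbrakk>
      \<Longrightarrow> reidx P A D (Cmp (base P) A B D g f) x = reidx P A B f (reidx P B D g x)"
  shows "is_idxpos P"
  unfolding is_idxpos_def
proof
  interpret C: is_category "base P" by fact
  show "is_functor (Op (base P)) Pos (fib P)"
  proof (rule is_functorI)
    fix A assume A: "A \<in> Obj (Op (base P))"
    then show "reidx P A A (Idm (Op (base P)) A) = Idm Pos (fobj (fib P) A)"
      using ext[of "Idm (base P) A" A A] id[of A] ord[of A]
      by (auto intro!: extensionalityI[of _ "fpts P A"] simp: PiE_iff)
  next
    fix A B D f g assume fg: "f \<in> Hom (Op (base P)) A B" "g \<in> Hom (Op (base P)) B D"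
    then have hom: "farr (fib P) A B f \<in> Hom Pos (fobj (fib P) A) (fobj (fib P) B)"
      "farr (fib P) B D g \<in> Hom Pos (fobj (fib P) B) (fobj (fib P) D)"
      using ext mono ord C.Hom_ObjD by auto
    show "farr (fib P) A D (Cmp (Op (base P)) A B D g f) = Cmp Pos (fobj (fib P) A) (fobj (fib P) B)
      (fobj (fib P) D) (farr (fib P) B D g) (farr (fib P) A B f)"
    proof (rule extensionalityI[of _ "fpts P A"])
      show "farr (fib P) A D (Cmp (Op (base P)) A B D g f) \<in> extensional (fpts P A)"
        using fg ext[of "Cmp (Op (base P)) A B D g f" D A] by (auto simp: PiE_iff)
    qed (use fg comp[of g D B f A] in \<open>simp_all add: Cmp_Pos(1)[OF hom] compose_def del: Hom_Pos_iff\<close>)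
  qed (use assms C.Hom_ObjD in \<open>auto intro: is_category_Op is_category_Pos\<close>)
qed fact

section \<open>1-cells of indexed posets, elementwise\<close>

locale ip_cell1 =
  fixes f :: "('o, 'a, 'p) ip_cell1"
  assumes is_ip_cell1: "is_ip_cell1 f"
begin

sublocale P: idxpos "src1 f" using is_ip_cell1 by unfold_locales (simp add: is_ip_cell1_def)
sublocale R: idxpos "tgt1 f" using is_ip_cell1 by unfold_locales (simp add: is_ip_cell1_def)
sublocale F: is_functor "base (src1 f)" "base (tgt1 f)" "fun1 f"
  using is_ip_cell1 by (simp add: is_ip_cell1_def)

lemma nat1_ext: "nat1 f \<in> extensional (Obj (base (src1 f)))"
  using is_ip_cell1 by (simp add: is_ip_cell1_def is_nat_trans_def)

lemma nat1_Hom: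
  "A \<in> Obj (base (src1 f)) \<Longrightarrow>
    nat1 f A \<in> Hom Pos (fobj (fib (src1 f)) A) (fobj (fib (tgt1 f)) (fobj (fun1 f) A))"
  using is_ip_cell1 by (simp add: is_ip_cell1_def is_nat_trans_def)

lemma nat1_extensional: "A \<in> Obj (base (src1 f)) \<Longrightarrow> nat1 f A \<in> extensional (fpts (src1 f) A)"
  using nat1_Hom[of A] by (auto simp: PiE_iff)

lemma nat1_fpts [simp]:
  "A \<in> Obj (base (src1 f)) \<Longrightarrow> x \<in> fpts (src1 f) A \<Longrightarrow> nat1 f A x \<in> fpts (tgt1 f) (fobj (fun1 f) A)"
  using nat1_Hom[of A] by auto

lemma nat1_mono:
  "A \<in> Obj (base (src1 f)) \<Longrightarrow> fle (src1 f) A x y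
    \<Longrightarrow> fle (tgt1 f) (fobj (fun1 f) A) (nat1 f A x) (nat1 f A y)"
  using nat1_Hom[of A] by auto

lemma nat1_natural [simp]:
  assumes "h \<in> Hom (base (src1 f)) A B" "x \<in> fpts (src1 f) B"
  shows "nat1 f A (reidx (src1 f) A B h x)
    = reidx (tgt1 f) (fobj (fun1 f) A) (fobj (fun1 f) B) (farr (fun1 f) A B h) (nat1 f B x)"
proof -
  let ?R = "comp_fctr (Op (base (src1 f))) (fib (tgt1 f)) (op_fctr (fun1 f))"
  have AB: "A \<in> Obj (base (src1 f))" "B \<in> Obj (base (src1 f))"
    using assms P.C.Hom_ObjD by auto
  have nt: "is_nat_trans (Op (base (src1 f))) Pos (fib (src1 f)) ?R (nat1 f)"
    using is_ip_cell1 by (simp add: is_ip_cell1_def)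
  have h: "reidx (src1 f) A B h \<in> Hom Pos (fobj (fib (src1 f)) B) (fobj (fib (src1 f)) A)"
    "farr ?R B A h \<in> Hom Pos (fobj ?R B) (fobj ?R A)"
    using P.fib.farr_Hom[of h B A] is_functor.farr_Hom[OF is_nat_trans.target[OF nt], of h B A] assms
    by auto
  have c: "nat1 f A \<in> Hom Pos (fobj (fib (src1 f)) A) (fobj ?R A)"
    "nat1 f B \<in> Hom Pos (fobj (fib (src1 f)) B) (fobj ?R B)"
    using nat1_Hom AB by auto
  have "compose (fpts (src1 f) B) (nat1 f A) (reidx (src1 f) A B h)
    = compose (fpts (src1 f) B) (farr ?R B A h) (nat1 f B)"
    using is_nat_trans.natural[OF nt, of h B A] assms(1)
    by (simp only: Cmp_Pos(1)[OF h(1) c(1)] Cmp_Pos(1)[OF c(2) h(2)] Op_simps)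
  from fun_cong[OF this, of "nat1 f B x"] fun_cong[OF this, of x] show ?thesis
    using assms by (simp add: compose_def)
qed

end

lemma is_ip_cell1I:
  assumes "is_idxpos (src1 f)" "is_idxpos (tgt1 f)"
    and fun1: "is_functor (base (src1 f)) (base (tgt1 f)) (fun1 f)"
    and "nat1 f \<in> extensional (Obj (base (src1 f)))"
    and type: "\<And>A. A \<in> Obj (base (src1 f)) \<Longrightarrow>
      nat1 f A \<in> fpts (src1 f) A \<rightarrow>\<^sub>E fpts (tgt1 f) (fobj (fun1 f) A)"
    and mono: "\<And>A x y. \<lbrakk>A \<in> Obj (base (src1 f)); fle (src1 f) A x y\<rbrakk>
      \<Longrightarrow> fle (tgt1 f) (fobj (fun1 f) A) (nat1 f A x) (nat1 f A y)"
    and nat: "\<And>A B h x. \<lbrakk>h \<in> Hom (base (src1 f)) A B; x \<in> fpts (src1 f) B\<rbrakk>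
      \<Longrightarrow> nat1 f A (reidx (src1 f) A B h x)
        = reidx (tgt1 f) (fobj (fun1 f) A) (fobj (fun1 f) B) (farr (fun1 f) A B h) (nat1 f B x)"
  shows "is_ip_cell1 f"
proof -
  interpret P: idxpos "src1 f" by unfold_locales fact
  interpret R: idxpos "tgt1 f" by unfold_locales fact
  interpret F: is_functor "base (src1 f)" "base (tgt1 f)" "fun1 f" by fact
  have hom: "nat1 f A \<in> Hom Pos (fobj (fib (src1 f)) A) (fobj (fib (tgt1 f)) (fobj (fun1 f) A))"
    if "A \<in> Obj (base (src1 f))" for A
    using that type[OF that] mono P.fib_order[of A] R.fib_order[of "fobj (fun1 f) A"] by auto
  let ?R = "comp_fctr (Op (base (src1 f))) (fib (tgt1 f)) (op_fctr (fun1 f))"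
  have "is_nat_trans (Op (base (src1 f))) Pos (fib (src1 f)) ?R (nat1 f)"
  proof (rule is_nat_trans.intro)
    show "is_functor (Op (base (src1 f))) Pos (fib (src1 f))"
      by (rule P.fib.is_functor_axioms)
    show "is_functor (Op (base (src1 f))) Pos ?R"
      by (rule is_functor_comp[OF F.is_functor_op R.fib.is_functor_axioms])
    then interpret R': is_functor "Op (base (src1 f))" Pos ?R .
    fix h A B
    assume h: "h \<in> Hom (Op (base (src1 f))) A B"
    then have AB: "A \<in> Obj (base (src1 f))" "B \<in> Obj (base (src1 f))"
      using P.C.Hom_ObjD by auto
    have c: "nat1 f A \<in> Hom Pos (fobj (fib (src1 f)) A) (fobj ?R A)"
      "nat1 f B \<in> Hom Pos (fobj (fib (src1 f)) B) (fobj ?R B)"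
      using hom AB by auto
    show "Cmp Pos (fobj (fib (src1 f)) A) (fobj (fib (src1 f)) B) (fobj ?R B)
        (nat1 f B) (farr (fib (src1 f)) A B h) =
      Cmp Pos (fobj (fib (src1 f)) A) (fobj ?R A) (fobj ?R B) (farr ?R A B h) (nat1 f A)"
      unfolding Cmp_Pos(1)[OF P.fib.farr_Hom[OF h] c(2)] Cmp_Pos(1)[OF c(1) R'.farr_Hom[OF h]]
      using h by (auto simp: compose_def fun_eq_iff nat)
  qed (use assms hom in auto)
  then show ?thesis
    using assms by (simp add: is_ip_cell1_def)
qed

lemma ip_cell1_eqI:
  assumes "is_ip_cell1 f" "is_ip_cell1 g" "src1 f = src1 g" "tgt1 f = tgt1 g"
    "\<And>A. A \<in> Obj (base (src1 f)) \<Longrightarrow> fobj (fun1 f) A = fobj (fun1 g) A"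
    "\<And>A B h. h \<in> Hom (base (src1 f)) A B \<Longrightarrow> farr (fun1 f) A B h = farr (fun1 g) A B h"
    "\<And>A x. A \<in> Obj (base (src1 f)) \<Longrightarrow> x \<in> fpts (src1 f) A \<Longrightarrow> nat1 f A x = nat1 g A x"
  shows "f = g"
proof (rule ip_cell1.equality)
  interpret f: ip_cell1 f by unfold_locales fact
  interpret g: ip_cell1 g by unfold_locales fact
  show "fun1 f = fun1 g"
    using assms g.F.is_functor_axioms by (intro fctr_eqI[OF f.F.is_functor_axioms]) auto
  show "nat1 f = nat1 g"
  proof (rule extensionalityI[OF f.nat1_ext])
    show "nat1 g \<in> extensional (Obj (base (src1 f)))"
      using g.nat1_ext assms(3) by simp
    fix A assume A: "A \<in> Obj (base (src1 f))"
    then show "nat1 f A = nat1 g A"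
      using assms(3,7) g.nat1_extensional
      by (intro extensionalityI[OF f.nat1_extensional]) auto
  qed
qed (use assms in simp_all)

lemma ip_id1_simps [simp]:
  "src1 (ip_id1 P) = P" "tgt1 (ip_id1 P) = P" "fun1 (ip_id1 P) = id_fctr (base P)"
  "nat1 (ip_id1 P) = (\<lambda>A\<in>Obj (base P). \<lambda>\<alpha>\<in>fpts P A. \<alpha>)"
  by (simp_all add: ip_id1_def)

lemma ip_comp1_simps [simp]:
  "src1 (ip_comp1 g f) = src1 f" "tgt1 (ip_comp1 g f) = tgt1 g"
  "fun1 (ip_comp1 g f) = comp_fctr (base (src1 f)) (fun1 g) (fun1 f)"
  "nat1 (ip_comp1 g f) = (\<lambda>A\<in>Obj (base (src1 f)). \<lambda>\<alpha>\<in>fpts (src1 f) A.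
     nat1 g (fobj (fun1 f) A) (nat1 f A \<alpha>))"
  by (simp_all add: ip_comp1_def)

lemma (in idxpos) fle_fpts: "A \<in> Obj (base P) \<Longrightarrow> fle P A x y \<Longrightarrow> x \<in> fpts P A \<and> y \<in> fpts P A"
  using fib_order[of A] by (auto simp: partial_order_on_def preorder_on_def refl_on_def)

lemma is_ip_cell1_id1:
  assumes "is_idxpos P"
  shows "is_ip_cell1 (ip_id1 P)"
proof -
  interpret idxpos P by unfold_locales fact
  show ?thesis
    by (rule is_ip_cell1I) (auto simp: is_idxpos C.is_functor_id dest: fle_fpts C.Hom_ObjD)
qed

lemma is_ip_cell1_comp1:
  assumes "is_ip_cell1 f" "is_ip_cell1 g" "src1 g = tgt1 f"
  shows "is_ip_cell1 (ip_comp1 g f)"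
proof -
  interpret f: ip_cell1 f by unfold_locales fact
  \<comment> \<open>Rewriting the boundary at the interpretation states all facts about
    \<open>g\<close> over the target of \<open>f\<close>, so that they compose with those of
    \<open>f\<close>.\<close>
  interpret g: ip_cell1 g rewrites "src1 g = tgt1 f"
    by unfold_locales fact+
  note g.nat1_mono[simp] f.nat1_mono[simp] g.F.is_functor_axioms[simp]
  show ?thesis
    by (rule is_ip_cell1I) (auto intro!: is_functor_comp f.F.is_functor_axioms f.P.is_idxpos g.R.is_idxpos
       dest: f.P.fle_fpts f.P.C.Hom_ObjD)
qed

section \<open>2-cells of indexed posets and their compositions\<close>

locale ip_cell2 =
  fixes t :: "('o, 'a, 'p) ip_cell2"
  assumes is_ip_cell2: "is_ip_cell2 t"
begin

lemma boundary: "is_ip_cell1 (dom2 t)" "is_ip_cell1 (cod2 t)"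
  "src1 (cod2 t) = src1 (dom2 t)" "tgt1 (cod2 t) = tgt1 (dom2 t)"
  using is_ip_cell2 by (simp_all add: is_ip_cell2_def Let_def)

sublocale F: ip_cell1 "dom2 t"
  by unfold_locales (rule boundary)

sublocale G: ip_cell1 "cod2 t"
  rewrites "src1 (cod2 t) = src1 (dom2 t)" and "tgt1 (cod2 t) = tgt1 (dom2 t)"
  by (unfold_locales) (rule boundary)+

lemma nat2_ext: "nat2 t \<in> extensional (Obj (base (src1 (dom2 t))))"
  using is_ip_cell2 by (simp add: is_ip_cell2_def Let_def is_nat_trans_def)

lemma nat2_Hom [simp]:
  "A \<in> Obj (base (src1 (dom2 t))) \<Longrightarrow>
    nat2 t A \<in> Hom (base (tgt1 (dom2 t))) (fobj (fun1 (dom2 t)) A) (fobj (fun1 (cod2 t)) A)"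
  using is_ip_cell2 by (simp add: is_ip_cell2_def Let_def is_nat_trans_def)

lemma nat2_natural:
  "h \<in> Hom (base (src1 (dom2 t))) A B \<Longrightarrow>
    Cmp (base (tgt1 (dom2 t))) (fobj (fun1 (dom2 t)) A) (fobj (fun1 (dom2 t)) B) (fobj (fun1 (cod2 t)) B)
      (nat2 t B) (farr (fun1 (dom2 t)) A B h)
    = Cmp (base (tgt1 (dom2 t))) (fobj (fun1 (dom2 t)) A) (fobj (fun1 (cod2 t)) A) (fobj (fun1 (cod2 t)) B)
      (farr (fun1 (cod2 t)) A B h) (nat2 t A)"
  using is_ip_cell2 by (simp add: is_ip_cell2_def Let_def is_nat_trans_def)

lemma nat2_le:
  "A \<in> Obj (base (src1 (dom2 t))) \<Longrightarrow> x \<in> fpts (src1 (dom2 t)) A \<Longrightarrow>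
    fle (tgt1 (dom2 t)) (fobj (fun1 (dom2 t)) A) (nat1 (dom2 t) A x)
      (reidx (tgt1 (dom2 t)) (fobj (fun1 (dom2 t)) A) (fobj (fun1 (cod2 t)) A) (nat2 t A)
        (nat1 (cod2 t) A x))"
  using is_ip_cell2 by (simp add: is_ip_cell2_def Let_def)

end

lemma is_ip_cell2I:
  assumes "is_ip_cell1 (dom2 t)" "is_ip_cell1 (cod2 t)"
    "src1 (cod2 t) = src1 (dom2 t)" "tgt1 (cod2 t) = tgt1 (dom2 t)"
    "nat2 t \<in> extensional (Obj (base (src1 (dom2 t))))"
    "\<And>A. A \<in> Obj (base (src1 (dom2 t))) \<Longrightarrow>
      nat2 t A \<in> Hom (base (tgt1 (dom2 t))) (fobj (fun1 (dom2 t)) A) (fobj (fun1 (cod2 t)) A)"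
    "\<And>A B h. h \<in> Hom (base (src1 (dom2 t))) A B \<Longrightarrow>
      Cmp (base (tgt1 (dom2 t))) (fobj (fun1 (dom2 t)) A) (fobj (fun1 (dom2 t)) B)
        (fobj (fun1 (cod2 t)) B) (nat2 t B) (farr (fun1 (dom2 t)) A B h)
      = Cmp (base (tgt1 (dom2 t))) (fobj (fun1 (dom2 t)) A) (fobj (fun1 (cod2 t)) A)
        (fobj (fun1 (cod2 t)) B) (farr (fun1 (cod2 t)) A B h) (nat2 t A)"
    "\<And>A x. \<lbrakk>A \<in> Obj (base (src1 (dom2 t))); x \<in> fpts (src1 (dom2 t)) A\<rbrakk> \<Longrightarrow>
      fle (tgt1 (dom2 t)) (fobj (fun1 (dom2 t)) A) (nat1 (dom2 t) A x)
        (reidx (tgt1 (dom2 t)) (fobj (fun1 (dom2 t)) A) (fobj (fun1 (cod2 t)) A) (nat2 t A)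
          (nat1 (cod2 t) A x))"
  shows "is_ip_cell2 t"
proof -
  interpret F: ip_cell1 "dom2 t" by unfold_locales fact
  interpret G: ip_cell1 "cod2 t" rewrites "src1 (cod2 t) = src1 (dom2 t)" and "tgt1 (cod2 t) = tgt1 (dom2 t)"
    by (unfold_locales) fact+
  have "is_nat_trans (base (src1 (dom2 t))) (base (tgt1 (dom2 t))) (fun1 (dom2 t)) (fun1 (cod2 t)) (nat2 t)"
    by (rule is_nat_trans.intro) (use assms F.F.is_functor_axioms G.F.is_functor_axioms in simp_all)
  then show ?thesis
    using assms by (simp add: is_ip_cell2_def Let_def)
qed

lemma ip_cell2_eqI:
  assumes "is_ip_cell2 s" "is_ip_cell2 t" "dom2 s = dom2 t" "cod2 s = cod2 t"
    "\<And>A. A \<in> Obj (base (src1 (dom2 s))) \<Longrightarrow> nat2 s A = nat2 t A"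
  shows "s = t"
proof (rule ip_cell2.equality)
  interpret s: ip_cell2 s by unfold_locales fact
  interpret t: ip_cell2 t by unfold_locales fact
  show "nat2 s = nat2 t"
    using s.nat2_ext t.nat2_ext assms(3,5) by (intro extensionalityI) auto
qed (use assms in simp_all)

lemma ip_id2_simps [simp]:
  "dom2 (ip_id2 f) = f" "cod2 (ip_id2 f) = f"
  "nat2 (ip_id2 f) = (\<lambda>A\<in>Obj (base (src1 f)). Idm (base (tgt1 f)) (fobj (fun1 f) A))"
  by (simp_all add: ip_id2_def)

lemma ip_vcomp_simps [simp]:
  "dom2 (ip_vcomp b a) = dom2 a" "cod2 (ip_vcomp b a) = cod2 b"
  "nat2 (ip_vcomp b a) = (\<lambda>A\<in>Obj (base (src1 (dom2 a))).
    Cmp (base (tgt1 (dom2 a)))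
      (fobj (fun1 (dom2 a)) A) (fobj (fun1 (cod2 a)) A) (fobj (fun1 (cod2 b)) A)
      (nat2 b A) (nat2 a A))"
  by (simp_all add: ip_vcomp_def)

lemma ip_hcomp_simps [simp]:
  "dom2 (ip_hcomp b a) = ip_comp1 (dom2 b) (dom2 a)"
  "cod2 (ip_hcomp b a) = ip_comp1 (cod2 b) (cod2 a)"
  "nat2 (ip_hcomp b a) = (\<lambda>A\<in>Obj (base (src1 (dom2 a))).
    Cmp (base (tgt1 (dom2 b)))
      (fobj (fun1 (dom2 b)) (fobj (fun1 (dom2 a)) A)) (fobj (fun1 (cod2 b)) (fobj (fun1 (dom2 a)) A))
      (fobj (fun1 (cod2 b)) (fobj (fun1 (cod2 a)) A))
      (farr (fun1 (cod2 b)) (fobj (fun1 (dom2 a)) A) (fobj (fun1 (cod2 a)) A) (nat2 a A))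
      (nat2 b (fobj (fun1 (dom2 a)) A)))"
  by (simp_all add: ip_hcomp_def Let_def)

lemma is_ip_cell2_id2:
  assumes "is_ip_cell1 f"
  shows "is_ip_cell2 (ip_id2 f)"
proof -
  interpret ip_cell1 f by unfold_locales fact
  show ?thesis
    by (rule is_ip_cell2I) (auto simp: is_ip_cell1 dest: P.C.Hom_ObjD)
qed

text \<open>The inequality is that of \<open>a\<close> followed by that of \<open>b\<close>
  reindexed along \<open>nat2 a A\<close>, which is monotone.\<close>

lemma is_ip_cell2_vcomp:
  assumes "is_ip_cell2 a" "is_ip_cell2 b" "dom2 b = cod2 a"
  shows "is_ip_cell2 (ip_vcomp b a)"
proof -
  interpret a: ip_cell2 a by unfold_locales fact
  interpret b: ip_cell2 b rewrites "dom2 b = cod2 a"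
    and "src1 (cod2 a) = src1 (dom2 a)" and "tgt1 (cod2 a) = tgt1 (dom2 a)"
    by (unfold_locales) (use assms a.boundary in simp_all)
  let ?P = "src1 (dom2 a)" and ?R = "tgt1 (dom2 a)"
  let ?F = "fun1 (dom2 a)" and ?G = "fun1 (cod2 a)" and ?H = "fun1 (cod2 b)"
  show ?thesis
  proof (rule is_ip_cell2I, goal_cases)
    case (7 A B h)
    then have h [simp]: "h \<in> Hom (base ?P) A B" and [simp]: "A \<in> Obj (base ?P)" "B \<in> Obj (base ?P)"
      using a.F.P.C.Hom_ObjD by auto
    \<comment> \<open>The square of \<open>a\<close> fits the right-nested composite; association is
      then reversed to expose the square of \<open>b\<close>.\<close>
    show ?case
      by (simp add: a.nat2_natural) (simp flip: a.F.R.C.Cmp_assoc' add: b.nat2_natural)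
  next
    case (8 A x)
    then have [simp]: "A \<in> Obj (base ?P)" "x \<in> fpts ?P A" by auto
    have "fle ?R (fobj ?F A) (nat1 (dom2 a) A x)
        (reidx ?R (fobj ?F A) (fobj ?G A) (nat2 a A) (nat1 (cod2 a) A x))"
      by (rule a.nat2_le) simp_all
    moreover have "fle ?R (fobj ?F A)
        (reidx ?R (fobj ?F A) (fobj ?G A) (nat2 a A) (nat1 (cod2 a) A x))
        (reidx ?R (fobj ?F A) (fobj ?G A) (nat2 a A)
           (reidx ?R (fobj ?G A) (fobj ?H A) (nat2 b A) (nat1 (cod2 b) A x)))"
      by (rule a.F.R.reidx_mono) (simp_all add: b.nat2_le)
    ultimately show ?case
      by (auto intro: a.F.R.fle_trans)
  qed (use a.boundary b.boundary in auto)
qed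

text \<open>The inequality chains that of \<open>b\<close> at the element
  \<open>nat1 (dom2 a) A x\<close> with the image of that of \<open>a\<close> under the monotone map
  of \<open>cod2 b\<close>; naturality of that map rewrites the bound into the required
  form.\<close>

lemma is_ip_cell2_hcomp:
  assumes "is_ip_cell2 a" "is_ip_cell2 b" "src1 (dom2 b) = tgt1 (dom2 a)"
  shows "is_ip_cell2 (ip_hcomp b a)"
proof -
  interpret a: ip_cell2 a by unfold_locales fact
  interpret b: ip_cell2 b rewrites "src1 (dom2 b) = tgt1 (dom2 a)"
    by (unfold_locales) (use assms in simp_all)
  let ?P = "src1 (dom2 a)" and ?R = "tgt1 (dom2 a)" and ?S = "tgt1 (dom2 b)"
  let ?F = "fun1 (dom2 a)" and ?F' = "fun1 (cod2 a)" and ?G = "fun1 (dom2 b)" and ?G' = "fun1 (cod2 b)"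
  show ?thesis
  proof (rule is_ip_cell2I, goal_cases)
    case (7 A B h)
    then have h [simp]: "h \<in> Hom (base ?P) A B" and [simp]: "A \<in> Obj (base ?P)" "B \<in> Obj (base ?P)"
      using a.F.P.C.Hom_ObjD by auto
    \<comment> \<open>Naturality of \<open>b\<close> at the arrow \<open>?F h\<close>, then
      naturality of \<open>a\<close> inside the functor \<open>?G'\<close>.\<close>
    show ?case
      by (simp add: a.boundary b.boundary b.nat2_natural)
        (simp add: a.nat2_natural flip: b.F.R.C.Cmp_assoc' b.G.F.farr_Cmp)
  next
    case (8 A x)
    then have [simp]: "A \<in> Obj (base ?P)" "x \<in> fpts ?P A" by auto
    have "fle ?S (fobj ?G (fobj ?F A)) (nat1 (dom2 b) (fobj ?F A) (nat1 (dom2 a) A x))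
        (reidx ?S (fobj ?G (fobj ?F A)) (fobj ?G' (fobj ?F A)) (nat2 b (fobj ?F A))
           (nat1 (cod2 b) (fobj ?F A) (nat1 (dom2 a) A x)))"
      by (rule b.nat2_le) simp_all
    moreover have "fle ?S (fobj ?G (fobj ?F A))
        (reidx ?S (fobj ?G (fobj ?F A)) (fobj ?G' (fobj ?F A)) (nat2 b (fobj ?F A))
           (nat1 (cod2 b) (fobj ?F A) (nat1 (dom2 a) A x)))
        (reidx ?S (fobj ?G (fobj ?F A)) (fobj ?G' (fobj ?F A)) (nat2 b (fobj ?F A))
           (nat1 (cod2 b) (fobj ?F A)
             (reidx ?R (fobj ?F A) (fobj ?F' A) (nat2 a A) (nat1 (cod2 a) A x))))"
      by (intro b.F.R.reidx_mono b.G.nat1_mono a.nat2_le b.nat2_Hom) simp_all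
    ultimately show ?case
      by (auto simp: a.boundary b.boundary intro: b.F.R.fle_trans)
  qed (use a.boundary b.boundary assms(3) in \<open>auto intro: is_ip_cell1_comp1\<close>)
qed

section \<open>The 2-category axioms for indexed posets\<close>

lemma ip_comp1_unit:
  assumes "is_ip_cell1 f"
  shows "ip_comp1 f (ip_id1 (src1 f)) = f" "ip_comp1 (ip_id1 (tgt1 f)) f = f"
proof -
  interpret ip_cell1 f by unfold_locales fact
  have id: "is_ip_cell1 (ip_id1 (src1 f))" "is_ip_cell1 (ip_id1 (tgt1 f))"
    by (simp_all add: is_ip_cell1_id1 P.is_idxpos R.is_idxpos)
  show "ip_comp1 f (ip_id1 (src1 f)) = f" "ip_comp1 (ip_id1 (tgt1 f)) f = f"
    by (auto intro!: ip_cell1_eqI is_ip_cell1_comp1 is_ip_cell1 id dest: P.C.Hom_ObjD)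
qed

lemma ip_comp1_assoc:
  assumes "is_ip_cell1 f" "is_ip_cell1 g" "is_ip_cell1 h" "src1 g = tgt1 f" "src1 h = tgt1 g"
  shows "ip_comp1 h (ip_comp1 g f) = ip_comp1 (ip_comp1 h g) f"
proof -
  interpret f: ip_cell1 f by unfold_locales fact
  show ?thesis
    by (rule ip_cell1_eqI)
      (use assms in \<open>auto intro!: is_ip_cell1_comp1 dest: f.P.C.Hom_ObjD\<close>)
qed

lemma ip_vcomp_unit:
  assumes "is_ip_cell2 a"
  shows "ip_vcomp a (ip_id2 (dom2 a)) = a" "ip_vcomp (ip_id2 (cod2 a)) a = a"
proof -
  interpret ip_cell2 a by unfold_locales fact
  have id: "is_ip_cell2 (ip_id2 (dom2 a))" "is_ip_cell2 (ip_id2 (cod2 a))"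
    by (simp_all add: is_ip_cell2_id2 boundary)
  show "ip_vcomp a (ip_id2 (dom2 a)) = a" "ip_vcomp (ip_id2 (cod2 a)) a = a"
    by (auto intro!: ip_cell2_eqI is_ip_cell2_vcomp is_ip_cell2 id simp: boundary)
qed

lemma ip_vcomp_assoc:
  assumes "is_ip_cell2 a" "is_ip_cell2 b" "is_ip_cell2 c" "dom2 b = cod2 a" "dom2 c = cod2 b"
  shows "ip_vcomp c (ip_vcomp b a) = ip_vcomp (ip_vcomp c b) a"
proof -
  interpret a: ip_cell2 a by unfold_locales fact
  interpret b: ip_cell2 b rewrites "dom2 b = cod2 a"
    and "src1 (cod2 a) = src1 (dom2 a)" and "tgt1 (cod2 a) = tgt1 (dom2 a)"
    by (unfold_locales) (use assms a.boundary in simp_all)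
  interpret c: ip_cell2 c rewrites "dom2 c = cod2 b"
    and "src1 (cod2 b) = src1 (dom2 a)" and "tgt1 (cod2 b) = tgt1 (dom2 a)"
    by (unfold_locales) (use assms a.boundary b.boundary in simp_all)
  show ?thesis
    by (rule ip_cell2_eqI)
      (use assms a.boundary b.boundary in \<open>auto intro!: is_ip_cell2_vcomp\<close>)
qed

lemma ip_hcomp_unit:
  assumes "is_ip_cell2 a"
  shows "ip_hcomp a (ip_id2 (ip_id1 (src1 (dom2 a)))) = a"
    "ip_hcomp (ip_id2 (ip_id1 (tgt1 (dom2 a)))) a = a"
proof -
  interpret ip_cell2 a by unfold_locales fact
  have id: "is_ip_cell2 (ip_id2 (ip_id1 (src1 (dom2 a))))" "is_ip_cell2 (ip_id2 (ip_id1 (tgt1 (dom2 a))))"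
    by (simp_all add: is_ip_cell2_id2 is_ip_cell1_id1 F.P.is_idxpos F.R.is_idxpos)
  show "ip_hcomp a (ip_id2 (ip_id1 (src1 (dom2 a)))) = a"
    "ip_hcomp (ip_id2 (ip_id1 (tgt1 (dom2 a)))) a = a"
    using ip_comp1_unit[OF boundary(1)] ip_comp1_unit[OF boundary(2)]
    by (auto intro!: ip_cell2_eqI is_ip_cell2_hcomp is_ip_cell2 id simp: boundary)
qed

lemma ip_hcomp_assoc:
  assumes "is_ip_cell2 a" "is_ip_cell2 b" "is_ip_cell2 c"
    "src1 (dom2 b) = tgt1 (dom2 a)" "src1 (dom2 c) = tgt1 (dom2 b)"
  shows "ip_hcomp c (ip_hcomp b a) = ip_hcomp (ip_hcomp c b) a"
proof -
  interpret a: ip_cell2 a by unfold_locales fact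
  interpret b: ip_cell2 b rewrites "src1 (dom2 b) = tgt1 (dom2 a)"
    by (unfold_locales) (use assms in simp_all)
  interpret c: ip_cell2 c rewrites "src1 (dom2 c) = tgt1 (dom2 b)"
    by (unfold_locales) (use assms in simp_all)
  show ?thesis
  proof (rule ip_cell2_eqI)
    show "dom2 (ip_hcomp c (ip_hcomp b a)) = dom2 (ip_hcomp (ip_hcomp c b) a)"
      "cod2 (ip_hcomp c (ip_hcomp b a)) = cod2 (ip_hcomp (ip_hcomp c b) a)"
      using assms a.boundary b.boundary c.boundary by (auto intro: ip_comp1_assoc)
  qed (use assms a.boundary b.boundary c.boundary in \<open>auto intro!: is_ip_cell2_hcomp\<close>)
qed

lemma ip_hcomp_id2:
  assumes "is_ip_cell1 f" "is_ip_cell1 g" "src1 g = tgt1 f"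
  shows "ip_hcomp (ip_id2 g) (ip_id2 f) = ip_id2 (ip_comp1 g f)"
proof -
  interpret f: ip_cell1 f by unfold_locales fact
  interpret g: ip_cell1 g rewrites "src1 g = tgt1 f" by (unfold_locales) fact+
  show ?thesis
    by (rule ip_cell2_eqI)
      (use assms in \<open>auto intro!: is_ip_cell2_hcomp is_ip_cell2_id2 is_ip_cell1_comp1\<close>)
qed

lemma ip_interchange:
  assumes "is_ip_cell2 a" "is_ip_cell2 a'" "is_ip_cell2 b" "is_ip_cell2 b'"
    "dom2 a' = cod2 a" "dom2 b' = cod2 b" "src1 (dom2 b) = tgt1 (dom2 a)"
  shows "ip_hcomp (ip_vcomp b' b) (ip_vcomp a' a) = ip_vcomp (ip_hcomp b' a') (ip_hcomp b a)"
proof -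
  interpret a: ip_cell2 a by unfold_locales fact
  interpret a': ip_cell2 a' rewrites "dom2 a' = cod2 a"
    and "src1 (cod2 a) = src1 (dom2 a)" and "tgt1 (cod2 a) = tgt1 (dom2 a)"
    by (unfold_locales) (use assms a.boundary in simp_all)
  interpret b: ip_cell2 b rewrites "src1 (dom2 b) = tgt1 (dom2 a)"
    by (unfold_locales) (use assms in simp_all)
  interpret b': ip_cell2 b' rewrites "dom2 b' = cod2 b"
    and "src1 (cod2 b) = tgt1 (dom2 a)" and "tgt1 (cod2 b) = tgt1 (dom2 b)"
    by (unfold_locales) (use assms b.boundary in simp_all)
  have cells: "is_ip_cell2 (ip_vcomp a' a)" "is_ip_cell2 (ip_vcomp b' b)"
    "is_ip_cell2 (ip_hcomp b' a')" "is_ip_cell2 (ip_hcomp b a)"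
    using assms a.boundary b.boundary by (auto intro!: is_ip_cell2_vcomp is_ip_cell2_hcomp)
  show ?thesis
  proof (rule ip_cell2_eqI)
    fix A assume "A \<in> Obj (base (src1 (dom2 (ip_hcomp (ip_vcomp b' b) (ip_vcomp a' a)))))"
    then have [simp]: "A \<in> Obj (base (src1 (dom2 a)))" by simp
    \<comment> \<open>Interchange amounts to naturality of \<open>nat2 b'\<close> at the arrow
      \<open>nat2 a A\<close>.\<close>
    have "Cmp (base (tgt1 (dom2 b)))
       (fobj (fun1 (cod2 b)) (fobj (fun1 (dom2 a)) A))
       (fobj (fun1 (cod2 b)) (fobj (fun1 (cod2 a)) A))
       (fobj (fun1 (cod2 b')) (fobj (fun1 (cod2 a)) A))
       (nat2 b' (fobj (fun1 (cod2 a)) A))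
       (farr (fun1 (cod2 b)) (fobj (fun1 (dom2 a)) A) (fobj (fun1 (cod2 a)) A) (nat2 a A))
      = Cmp (base (tgt1 (dom2 b)))
       (fobj (fun1 (cod2 b)) (fobj (fun1 (dom2 a)) A))
       (fobj (fun1 (cod2 b')) (fobj (fun1 (dom2 a)) A))
       (fobj (fun1 (cod2 b')) (fobj (fun1 (cod2 a)) A))
       (farr (fun1 (cod2 b')) (fobj (fun1 (dom2 a)) A) (fobj (fun1 (cod2 a)) A) (nat2 a A))
       (nat2 b' (fobj (fun1 (dom2 a)) A))"
      by (rule b'.nat2_natural) simp
    \<comment> \<open>Composites are nested to the right, so the square enters precomposed with a
      component of \<open>b\<close>.\<close>
    from arg_cong[OF this, of "\<lambda>m. Cmp (base (tgt1 (dom2 b)))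
       (fobj (fun1 (dom2 b)) (fobj (fun1 (dom2 a)) A))
       (fobj (fun1 (cod2 b)) (fobj (fun1 (dom2 a)) A))
       (fobj (fun1 (cod2 b')) (fobj (fun1 (cod2 a)) A)) m (nat2 b (fobj (fun1 (dom2 a)) A))"]
    show "nat2 (ip_hcomp (ip_vcomp b' b) (ip_vcomp a' a)) A =
         nat2 (ip_vcomp (ip_hcomp b' a') (ip_hcomp b a)) A"
      using assms a.boundary a'.boundary b.boundary b'.boundary by simp
  qed (use assms cells a.boundary b.boundary in \<open>auto intro!: is_ip_cell2_hcomp is_ip_cell2_vcomp\<close>)
qed

lemma IdxPos_simps [simp]:
  "Cell0 IdxPos = Collect is_idxpos" "Cell1 IdxPos = Collect is_ip_cell1"
  "Cell2 IdxPos = Collect is_ip_cell2"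
  "Src IdxPos = src1" "Tgt IdxPos = tgt1" "Dom IdxPos = dom2" "Cod IdxPos = cod2"
  "Id1 IdxPos = ip_id1" "Id2 IdxPos = ip_id2"
  "Comp1 IdxPos = ip_comp1" "VComp IdxPos = ip_vcomp" "HComp IdxPos = ip_hcomp"
  by (simp_all add: IdxPos_def)

lemma is_two_category_IdxPos: "is_two_category IdxPos"
proof -
  have *: "is_idxpos (src1 f)" "is_idxpos (tgt1 f)" if "is_ip_cell1 f" for f :: "('a, 'b, 'c) ip_cell1"
    using that by (simp_all add: is_ip_cell1_def)
  have **: "is_ip_cell1 (dom2 t)" "is_ip_cell1 (cod2 t)"
    "src1 (cod2 t) = src1 (dom2 t)" "tgt1 (cod2 t) = tgt1 (dom2 t)" if "is_ip_cell2 t"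
    for t :: "('a, 'b, 'c) ip_cell2"
    using ip_cell2.boundary[OF ip_cell2.intro[OF that]] by auto
  show ?thesis
    by unfold_locales (auto simp: hom1_iff hom2_iff * ** is_ip_cell1_id1 is_ip_cell1_comp1
        ip_comp1_unit ip_comp1_assoc is_ip_cell2_id2 is_ip_cell2_vcomp is_ip_cell2_hcomp
        ip_vcomp_unit ip_vcomp_assoc ip_hcomp_unit ip_hcomp_assoc ip_hcomp_id2 ip_interchange)
qed

section \<open>Kleisli objects of comonads of indexed posets\<close>

interpretation IP: is_two_category IdxPos
  by (rule is_two_category_IdxPos)

locale ip_comonad =
  fixes T :: "(('o, 'a, 'p) idxpos, ('o, 'a, 'p) ip_cell1, ('o, 'a, 'p) ip_cell2) comonad"
  assumes is_comonad: "is_comonad IdxPos T"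
begin

abbreviation "P \<equiv> carr T"
abbreviation "C \<equiv> base P"
abbreviation "K0 A \<equiv> fobj (fun1 (endo T)) A"
abbreviation "K1 A B f \<equiv> farr (fun1 (endo T)) A B f"
abbreviation "\<kappa> A \<equiv> nat1 (endo T) A"
abbreviation "\<gamma> A \<equiv> nat2 (comult T) A"
abbreviation "\<epsilon> A \<equiv> nat2 (coun T) A"

lemma cells:
  "is_ip_cell1 (endo T)" "src1 (endo T) = P" "tgt1 (endo T) = P"
  "is_ip_cell2 (comult T)" "dom2 (comult T) = endo T" "cod2 (comult T) = ip_comp1 (endo T) (endo T)"
  "is_ip_cell2 (coun T)" "dom2 (coun T) = endo T" "cod2 (coun T) = ip_id1 P"
  using is_comonad unfolding IP.is_comonad_iff by auto

sublocale E: ip_cell1 "endo T"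
  rewrites "src1 (endo T) = P" and "tgt1 (endo T) = P"
  by unfold_locales (rule cells)+

sublocale G: ip_cell2 "comult T"
  rewrites "dom2 (comult T) = endo T" and "cod2 (comult T) = ip_comp1 (endo T) (endo T)"
    and "src1 (endo T) = P" and "tgt1 (endo T) = P"
  by unfold_locales (rule cells)+

sublocale N: ip_cell2 "coun T"
  rewrites "dom2 (coun T) = endo T" and "cod2 (coun T) = ip_id1 P"
    and "src1 (endo T) = P" and "tgt1 (endo T) = P"
  by unfold_locales (rule cells)+

declare cells(2,3) [simp]

section \<open>The comonad laws and inequalities in components\<close>

lemma comult_Hom [simp]: "A \<in> Obj C \<Longrightarrow> \<gamma> A \<in> Hom C (K0 A) (K0 (K0 A))"
  using G.nat2_Hom[of A] by (simp add: cells)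

lemma coun_Hom [simp]: "A \<in> Obj C \<Longrightarrow> \<epsilon> A \<in> Hom C (K0 A) A"
  using N.nat2_Hom[of A] by simp

lemma comult_natural:
  assumes "f \<in> Hom C A B"
  shows "Cmp C (K0 A) (K0 B) (K0 (K0 B)) (\<gamma> B) (K1 A B f)
    = Cmp C (K0 A) (K0 (K0 A)) (K0 (K0 B)) (K1 (K0 A) (K0 B) (K1 A B f)) (\<gamma> A)"
  using G.nat2_natural[OF assms] assms E.P.C.Hom_ObjD[OF assms] by (simp add: cells)

lemma coun_natural:
  assumes "f \<in> Hom C A B"
  shows "Cmp C (K0 A) (K0 B) B (\<epsilon> B) (K1 A B f) = Cmp C (K0 A) A B f (\<epsilon> A)"
  using N.nat2_natural[OF assms] assms E.P.C.Hom_ObjD[OF assms] by simp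

lemma coassoc:
  assumes "A \<in> Obj C"
  shows "Cmp C (K0 A) (K0 (K0 A)) (K0 (K0 (K0 A))) (K1 (K0 A) (K0 (K0 A)) (\<gamma> A)) (\<gamma> A)
    = Cmp C (K0 A) (K0 (K0 A)) (K0 (K0 (K0 A))) (\<gamma> (K0 A)) (\<gamma> A)"
proof -
  have "ip_vcomp (ip_hcomp (ip_id2 (endo T)) (comult T)) (comult T)
    = ip_vcomp (ip_hcomp (comult T) (ip_id2 (endo T))) (comult T)"
    using is_comonad by (simp add: is_comonad_def Let_def)
  from arg_cong[OF this, of "\<lambda>t. nat2 t A"] show ?thesis
    using assms by (simp add: cells)
qed

lemma counit:
  assumes "A \<in> Obj C"
  shows "Cmp C (K0 A) (K0 (K0 A)) (K0 A) (K1 (K0 A) A (\<epsilon> A)) (\<gamma> A) = Idm C (K0 A)"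
    "Cmp C (K0 A) (K0 (K0 A)) (K0 A) (\<epsilon> (K0 A)) (\<gamma> A) = Idm C (K0 A)"
proof -
  have "ip_vcomp (ip_hcomp (ip_id2 (endo T)) (coun T)) (comult T) = ip_id2 (endo T)"
    "ip_vcomp (ip_hcomp (coun T) (ip_id2 (endo T))) (comult T) = ip_id2 (endo T)"
    using is_comonad by (simp_all add: is_comonad_def Let_def)
  from this[THEN arg_cong, of "\<lambda>t. nat2 t A"]
  show "Cmp C (K0 A) (K0 (K0 A)) (K0 A) (K1 (K0 A) A (\<epsilon> A)) (\<gamma> A) = Idm C (K0 A)"
    "Cmp C (K0 A) (K0 (K0 A)) (K0 A) (\<epsilon> (K0 A)) (\<gamma> A) = Idm C (K0 A)"
    using assms by (simp_all add: cells)
qed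

lemma comult_le:
  "A \<in> Obj C \<Longrightarrow> x \<in> fpts P A
    \<Longrightarrow> fle P (K0 A) (\<kappa> A x) (reidx P (K0 A) (K0 (K0 A)) (\<gamma> A) (\<kappa> (K0 A) (\<kappa> A x)))"
  using G.nat2_le[of A x] by (simp add: cells)

lemma coun_le:
  "A \<in> Obj C \<Longrightarrow> x \<in> fpts P A \<Longrightarrow> fle P (K0 A) (\<kappa> A x) (reidx P (K0 A) A (\<epsilon> A) x)"
  using N.nat2_le[of A x] by simp

text \<open>The map of cofree coalgebras corresponding to \<open>f\<close>. The laws
  \<open>cokl_coun\<close>, \<open>coun_cokl\<close> and \<open>cokl_Cmp\<close> are those of an
  extension system and give the category laws of the Kleisli base.\<close>

definition cokl :: "'o \<Rightarrow> 'o \<Rightarrow> 'a \<Rightarrow> 'a" where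
  "cokl A B f = Cmp C (K0 A) (K0 (K0 A)) (K0 B) (K1 (K0 A) B f) (\<gamma> A)"

lemma cokl_Hom [simp]: "A \<in> Obj C \<Longrightarrow> f \<in> Hom C (K0 A) B \<Longrightarrow> cokl A B f \<in> Hom C (K0 A) (K0 B)"
  by (simp add: cokl_def)

lemma cokl_coun [simp]: "A \<in> Obj C \<Longrightarrow> cokl A A (\<epsilon> A) = Idm C (K0 A)"
  by (simp add: cokl_def counit)

lemma cokl_Idm [simp]: "A \<in> Obj C \<Longrightarrow> cokl A (K0 A) (Idm C (K0 A)) = \<gamma> A"
  by (simp add: cokl_def)

lemma coun_cokl [simp]:
  assumes "A \<in> Obj C" "f \<in> Hom C (K0 A) B"
  shows "Cmp C (K0 A) (K0 B) B (\<epsilon> B) (cokl A B f) = f"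
proof -
  have B: "B \<in> Obj C" using assms E.P.C.Hom_ObjD by auto
  have "Cmp C (K0 A) (K0 B) B (\<epsilon> B) (cokl A B f)
    = Cmp C (K0 A) (K0 (K0 A)) B (Cmp C (K0 (K0 A)) (K0 B) B (\<epsilon> B) (K1 (K0 A) B f)) (\<gamma> A)"
    using assms B by (simp add: cokl_def)
  also have "\<dots> = f"
    using assms B by (simp add: coun_natural counit)
  finally show ?thesis .
qed

text \<open>Naturality of \<gamma> at \<open>f\<close> moves it past \<open>K1 (K0 A) B f\<close>,
  and coassociativity then replaces \<open>\<gamma> (K0 A)\<close> by \<open>K1\<close> of
  \<open>\<gamma> A\<close>.\<close>

lemma cokl_Cmp:
  assumes "A \<in> Obj C" "f \<in> Hom C (K0 A) B" "g \<in> Hom C (K0 B) D"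
  shows "cokl A D (Cmp C (K0 A) (K0 B) D g (cokl A B f))
    = Cmp C (K0 A) (K0 B) (K0 D) (cokl B D g) (cokl A B f)"
proof -
  have B: "B \<in> Obj C" using assms E.P.C.Hom_ObjD by auto
  have "Cmp C (K0 A) (K0 B) (K0 D) (cokl B D g) (cokl A B f)
    = Cmp C (K0 A) (K0 (K0 B)) (K0 D) (K1 (K0 B) D g) (Cmp C (K0 A) (K0 (K0 A)) (K0 (K0 B))
        (Cmp C (K0 (K0 A)) (K0 B) (K0 (K0 B)) (\<gamma> B) (K1 (K0 A) B f)) (\<gamma> A))"
    using assms B by (simp add: cokl_def)
  also have "\<dots> = cokl A D (Cmp C (K0 A) (K0 B) D g (cokl A B f))"
    unfolding comult_natural[OF assms(2)] using assms B by (simp add: cokl_def coassoc)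
  finally show ?thesis by simp
qed

text \<open>Reindexing in the Kleisli object along the image of \<open>f\<close> is therefore
  reindexing along \<open>K1 A B f\<close>, which lets naturality of \<kappa> pass to
  \<open>unit1\<close>.\<close>

lemma cokl_natural:
  assumes "f \<in> Hom C A B"
  shows "cokl A B (Cmp C (K0 A) A B f (\<epsilon> A)) = K1 A B f"
proof -
  have "A \<in> Obj C" using assms E.P.C.Hom_ObjD by auto
  then show ?thesis
    using assms by (simp add: cokl_def counit)
qed

section \<open>The interior operator on the fibres over K A\<close>

definition cl :: "'o \<Rightarrow> 'p \<Rightarrow> 'p" where
  "cl A x = reidx P (K0 A) (K0 (K0 A)) (\<gamma> A) (\<kappa> (K0 A) x)"

text \<open>The counit inequality bounds \<open>\<kappa> (K0 A) x\<close> by \<open>x\<close>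
  reindexed along \<open>\<epsilon> (K0 A)\<close>, and reindexing along \<open>\<gamma> A\<close>
  cancels this by the counit law.\<close>

lemma cl_le:
  assumes "A \<in> Obj C" "x \<in> fpts P (K0 A)"
  shows "fle P (K0 A) (cl A x) x"
proof -
  have "fle P (K0 A) (cl A x) (reidx P (K0 A) (K0 (K0 A)) (\<gamma> A) (reidx P (K0 (K0 A)) (K0 A) (\<epsilon> (K0 A)) x))"
    unfolding cl_def using assms by (intro E.P.reidx_mono coun_le) simp_all
  also have "reidx P (K0 A) (K0 (K0 A)) (\<gamma> A) (reidx P (K0 (K0 A)) (K0 A) (\<epsilon> (K0 A)) x)
    = reidx P (K0 A) (K0 A) (Cmp C (K0 A) (K0 (K0 A)) (K0 A) (\<epsilon> (K0 A)) (\<gamma> A)) x"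
    using assms by simp
  also have "\<dots> = x"
    using assms by (simp add: counit del: E.P.reidx_Cmp)
  finally show ?thesis .
qed

text \<open>One inequality is \<open>cl_le\<close>, the other is the 2-cell inequality of the
  comultiplication.\<close>

lemma cl_kappa [simp]:
  assumes "A \<in> Obj C" "x \<in> fpts P A"
  shows "cl A (\<kappa> A x) = \<kappa> A x"
  using cl_le[of A "\<kappa> A x"] comult_le[of A x] assms
  by (intro E.P.fle_antisym[of "K0 A"]) (auto simp: cl_def)

lemma cl_cokl:
  assumes "A \<in> Obj C" "f \<in> Hom C (K0 A) B" "x \<in> fpts P (K0 B)"
  shows "cl A (reidx P (K0 A) (K0 B) (cokl A B f) x) = reidx P (K0 A) (K0 B) (cokl A B f) (cl B x)"
proof -
  have B: "B \<in> Obj C" using assms E.P.C.Hom_ObjD by auto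
  have "cl A (reidx P (K0 A) (K0 B) (cokl A B f) x)
    = reidx P (K0 A) (K0 (K0 B)) (Cmp C (K0 A) (K0 (K0 A)) (K0 (K0 B))
        (K1 (K0 A) (K0 B) (cokl A B f)) (\<gamma> A)) (\<kappa> (K0 B) x)"
    using assms B by (simp add: cl_def)
  \<comment> \<open>The case of \<open>cokl_Cmp\<close> with an identity as second arrow:
    \<open>cokl A B f\<close> commutes with the comultiplications.\<close>
  also have "Cmp C (K0 A) (K0 (K0 A)) (K0 (K0 B)) (K1 (K0 A) (K0 B) (cokl A B f)) (\<gamma> A)
    = Cmp C (K0 A) (K0 B) (K0 (K0 B)) (\<gamma> B) (cokl A B f)"
    using cokl_Cmp[of A f B "Idm C (K0 B)" "K0 B"] assms B by (simp add: cokl_def)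
  finally show ?thesis
    using assms B by (simp add: cl_def)
qed

text \<open>Off the objects \<open>K0 A\<close> is \<open>undefined\<close>, which may happen to be
  an object; the guard keeps the hom-sets empty there.\<close>

definition klHom :: "'o \<Rightarrow> 'o \<Rightarrow> 'a set" where
  "klHom A B = (if A \<in> Obj C then Hom C (K0 A) B else {})"

lemma klHom_iff [simp]: "f \<in> klHom A B \<longleftrightarrow> A \<in> Obj C \<and> B \<in> Obj C \<and> f \<in> Hom C (K0 A) B"
  using E.P.C.Hom_ObjD by (auto simp: klHom_def)

definition klpts :: "'o \<Rightarrow> 'p set" where
  "klpts A = {x \<in> fpts P (K0 A). cl A x = x}"

lemma klpts_iff [simp]: "x \<in> klpts A \<longleftrightarrow> x \<in> fpts P (K0 A) \<and> cl A x = x"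
  by (simp add: klpts_def)

definition kl :: "('o, 'a, 'p) idxpos" where
  "kl = \<lparr>base = \<lparr>Obj = Obj C, Hom = klHom, Idm = (\<lambda>A\<in>Obj C. \<epsilon> A),
      Cmp = (\<lambda>A B D g f. if f \<in> klHom A B \<and> g \<in> klHom B D
        then Cmp C (K0 A) (K0 B) D g (cokl A B f) else undefined)\<rparr>,
    fib = \<lparr>fobj = (\<lambda>A\<in>Obj C. \<lparr>pts = klpts A, ple = ple (fobj (fib P) (K0 A)) \<inter> klpts A \<times> klpts A\<rparr>),
      farr = (\<lambda>B A. \<lambda>f\<in>klHom A B. \<lambda>x\<in>klpts B. reidx P (K0 A) (K0 B) (cokl A B f) x)\<rparr>\<rparr>"

lemma kl_simps [simp]:
  "Obj (base kl) = Obj C" "Hom (base kl) = klHom"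
  "A \<in> Obj C \<Longrightarrow> Idm (base kl) A = \<epsilon> A"
  "\<lbrakk>f \<in> klHom A B; g \<in> klHom B D\<rbrakk> \<Longrightarrow> Cmp (base kl) A B D g f = Cmp C (K0 A) (K0 B) D g (cokl A B f)"
  "A \<in> Obj C \<Longrightarrow> fpts kl A = klpts A"
  "A \<in> Obj C \<Longrightarrow> fle kl A x y \<longleftrightarrow> x \<in> klpts A \<and> y \<in> klpts A \<and> fle P (K0 A) x y"
  "\<lbrakk>f \<in> klHom A B; x \<in> klpts B\<rbrakk> \<Longrightarrow> reidx kl A B f x = reidx P (K0 A) (K0 B) (cokl A B f) x"
  by (auto simp: kl_def)

lemma is_category_kl: "is_category (base kl)"
proof
  show "Idm (base kl) \<in> extensional (Obj (base kl))"
    by (simp add: kl_def)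
  show "Cmp (base kl) A B D g f = undefined" if "\<not> (f \<in> Hom (base kl) A B \<and> g \<in> Hom (base kl) B D)"
    for A B D f g
    using that by (auto simp: kl_def simp del: klHom_iff)
qed (auto simp: cokl_Cmp)

text \<open>By \<open>cl_cokl\<close>, reindexing along extensions preserves fixed points;
  \<open>cokl_Cmp\<close> makes it functorial.\<close>

lemma is_idxpos_kl: "is_idxpos kl"
proof (rule is_idxposI, rule is_category_kl)
  fix A assume A: "A \<in> Obj (base kl)"
  show "partial_order_on (fpts kl A) (ple (fobj (fib kl) A))"
    using E.P.fib_order[of "K0 A"] A
    by (auto simp: kl_def partial_order_on_def preorder_on_def refl_on_def antisym_def trans_def; blast)
qed (auto simp: kl_def cl_cokl cokl_Cmp E.P.reidx_mono)

text \<open>The functor is the right adjoint of the coKleisli adjunction. \<kappa> can be its action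
  on fibres because its values are fixed points, by \<open>cl_kappa\<close>.\<close>

definition unit1 :: "('o, 'a, 'p) ip_cell1" where
  "unit1 = \<lparr>src1 = P, tgt1 = kl,
    fun1 = \<lparr>fobj = (\<lambda>A\<in>Obj C. A), farr = (\<lambda>A B. \<lambda>f\<in>Hom C A B. Cmp C (K0 A) A B f (\<epsilon> A))\<rparr>,
    nat1 = nat1 (endo T)\<rparr>"

lemma unit1_simps [simp]:
  "src1 unit1 = P" "tgt1 unit1 = kl" "nat1 unit1 = nat1 (endo T)"
  "A \<in> Obj C \<Longrightarrow> fobj (fun1 unit1) A = A"
  "f \<in> Hom C A B \<Longrightarrow> farr (fun1 unit1) A B f = Cmp C (K0 A) A B f (\<epsilon> A)"
  by (simp_all add: unit1_def)

lemma is_ip_cell1_unit1: "is_ip_cell1 unit1"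
proof (rule is_ip_cell1I)
  show "is_functor (base (src1 unit1)) (base (tgt1 unit1)) (fun1 unit1)"
  proof (rule is_functorI)
    fix A B D f g assume fg: "f \<in> Hom (base (src1 unit1)) A B" "g \<in> Hom (base (src1 unit1)) B D"
    then have "A \<in> Obj C" "B \<in> Obj C" "D \<in> Obj C"
      using E.P.C.Hom_ObjD by auto
    with fg show "farr (fun1 unit1) A D (Cmp (base (src1 unit1)) A B D g f) =
       Cmp (base (tgt1 unit1)) (fobj (fun1 unit1) A) (fobj (fun1 unit1) B) (fobj (fun1 unit1) D)
        (farr (fun1 unit1) B D g) (farr (fun1 unit1) A B f)"
      by (simp add: cokl_natural coun_natural)
  qed (auto simp: unit1_def is_category_kl E.P.C.is_category_axioms dest: E.P.C.Hom_ObjD)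
  fix A assume A: "A \<in> Obj (base (src1 unit1))"
  then show "nat1 unit1 A \<in> fpts (src1 unit1) A \<rightarrow>\<^sub>E fpts (tgt1 unit1) (fobj (fun1 unit1) A)"
    using E.nat1_extensional[of A] by (auto simp: PiE_iff)
  show "fle (tgt1 unit1) (fobj (fun1 unit1) A) (nat1 unit1 A x) (nat1 unit1 A y)"
    if "fle (src1 unit1) A x y" for x y
    using that A E.P.fle_fpts[of A x y] by (auto simp: E.nat1_mono)
next
  fix A B h x assume h: "h \<in> Hom (base (src1 unit1)) A B" "x \<in> fpts (src1 unit1) B"
  then have "A \<in> Obj C" "B \<in> Obj C"
    using E.P.C.Hom_ObjD by auto
  with h show "nat1 unit1 A (reidx (src1 unit1) A B h x)
    = reidx (tgt1 unit1) (fobj (fun1 unit1) A) (fobj (fun1 unit1) B)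
        (farr (fun1 unit1) A B h) (nat1 unit1 B x)"
    by (simp add: cokl_natural)
qed (auto simp: is_idxpos_kl E.P.is_idxpos E.nat1_ext)

text \<open>The identity of \<open>K0 A\<close>, read as a Kleisli arrow from \<open>A\<close> to
  \<open>K0 A\<close>. Its extension is \<open>\<gamma> A\<close>, so reindexing
  \<open>\<kappa> (K0 A) x\<close> along it gives \<open>cl A x\<close>, and the 2-cell inequality
  holds with equality by \<open>cl_kappa\<close>.\<close>

definition unit2 :: "('o, 'a, 'p) ip_cell2" where
  "unit2 = \<lparr>dom2 = unit1, cod2 = ip_comp1 unit1 (endo T), nat2 = (\<lambda>A\<in>Obj C. Idm C (K0 A))\<rparr>"

lemma unit2_simps [simp]:
  "dom2 unit2 = unit1" "cod2 unit2 = ip_comp1 unit1 (endo T)"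
  "A \<in> Obj C \<Longrightarrow> nat2 unit2 A = Idm C (K0 A)"
  by (simp_all add: unit2_def)

lemma is_ip_cell2_unit2: "is_ip_cell2 unit2"
proof (rule is_ip_cell2I)
  show "is_ip_cell1 (cod2 unit2)"
    by (simp add: is_ip_cell1_comp1 is_ip_cell1_unit1 cells)
  fix A B h assume h: "h \<in> Hom (base (src1 (dom2 unit2))) A B"
  then have "A \<in> Obj C" "B \<in> Obj C"
    using E.P.C.Hom_ObjD by auto
  with h show "Cmp (base (tgt1 (dom2 unit2))) (fobj (fun1 (dom2 unit2)) A) (fobj (fun1 (dom2 unit2)) B)
        (fobj (fun1 (cod2 unit2)) B) (nat2 unit2 B) (farr (fun1 (dom2 unit2)) A B h)
      = Cmp (base (tgt1 (dom2 unit2))) (fobj (fun1 (dom2 unit2)) A) (fobj (fun1 (cod2 unit2)) A)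
        (fobj (fun1 (cod2 unit2)) B) (farr (fun1 (cod2 unit2)) A B h) (nat2 unit2 A)"
    by (simp add: cells cokl_natural counit)
next
  fix A x assume "A \<in> Obj (base (src1 (dom2 unit2)))" "x \<in> fpts (src1 (dom2 unit2)) A"
  then show "fle (tgt1 (dom2 unit2)) (fobj (fun1 (dom2 unit2)) A) (nat1 (dom2 unit2) A x)
        (reidx (tgt1 (dom2 unit2)) (fobj (fun1 (dom2 unit2)) A) (fobj (fun1 (cod2 unit2)) A)
          (nat2 unit2 A) (nat1 (cod2 unit2) A x))"
    by (simp add: cells flip: cl_def)
qed (auto simp: is_ip_cell1_unit1 cells unit2_def)

lemma is_coalgebra_iff:
  "IP.is_coalgebra T g j \<longleftrightarrow>
    is_ip_cell1 g \<and> src1 g = P \<and> is_ip_cell2 j \<and> dom2 j = g \<and> cod2 j = ip_comp1 g (endo T) \<and>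
    (\<forall>A\<in>Obj C.
      Cmp (base (tgt1 g)) (fobj (fun1 g) A) (fobj (fun1 g) (K0 A)) (fobj (fun1 g) (K0 (K0 A)))
        (farr (fun1 g) (K0 A) (K0 (K0 A)) (\<gamma> A)) (nat2 j A)
      = Cmp (base (tgt1 g)) (fobj (fun1 g) A) (fobj (fun1 g) (K0 A)) (fobj (fun1 g) (K0 (K0 A)))
        (nat2 j (K0 A)) (nat2 j A) \<and>
      Cmp (base (tgt1 g)) (fobj (fun1 g) A) (fobj (fun1 g) (K0 A)) (fobj (fun1 g) A)
        (farr (fun1 g) (K0 A) A (\<epsilon> A)) (nat2 j A) = Idm (base (tgt1 g)) (fobj (fun1 g) A))"
  (is "_ \<longleftrightarrow> ?g \<and> ?s \<and> ?j \<and> ?d \<and> ?c \<and> (\<forall>A\<in>_. ?comult A \<and> ?coun A)")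
proof (cases "?g \<and> ?s \<and> ?j \<and> ?d \<and> ?c")
  \<comment> \<open>\<open>ip_cell2_eqI\<close> compares genuine 2-cells only, so the typing
    conditions common to both sides are assumed before the laws are read componentwise.\<close>
  case True
  then have [simp]: ?g ?s ?j ?d ?c
    by auto
  interpret g: ip_cell1 g rewrites "src1 g = P"
    by unfold_locales simp_all
  interpret j: ip_cell2 j rewrites "dom2 j = g" and "cod2 j = ip_comp1 g (endo T)" and "src1 g = P"
    by unfold_locales simp_all
  note jH = j.nat2_Hom[simplified]
  have ids: "is_ip_cell2 (ip_id2 g)" "is_ip_cell2 (ip_id2 (endo T))"
    by (simp_all add: is_ip_cell2_id2 cells)
  have 1: "is_ip_cell2 (ip_vcomp (ip_hcomp (ip_id2 g) (comult T)) j)"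
    "is_ip_cell2 (ip_vcomp (ip_hcomp j (ip_id2 (endo T))) j)"
    "is_ip_cell2 (ip_vcomp (ip_hcomp (ip_id2 g) (coun T)) j)"
    using ids by (auto intro!: is_ip_cell2_vcomp is_ip_cell2_hcomp simp: cells)
  have "ip_vcomp (ip_hcomp (ip_id2 g) (comult T)) j = ip_vcomp (ip_hcomp j (ip_id2 (endo T))) j
    \<longleftrightarrow> (\<forall>A\<in>Obj C. ?comult A)" (is "?l = ?r \<longleftrightarrow> _")
  proof -
    have "?l = ?r \<longleftrightarrow> (\<forall>A\<in>Obj C. nat2 ?l A = nat2 ?r A)"
      by (rule iffI, rule ballI, drule arg_cong[of _ _ nat2], erule fun_cong, rule ip_cell2_eqI[OF 1(1,2)])
        (simp_all add: cells ip_comp1_assoc)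
    then show ?thesis
      using jH by (simp add: cells)
  qed
  moreover have "ip_vcomp (ip_hcomp (ip_id2 g) (coun T)) j = ip_id2 g
    \<longleftrightarrow> (\<forall>A\<in>Obj C. ?coun A)" (is "?l = ?r \<longleftrightarrow> _")
  proof -
    have "?l = ?r \<longleftrightarrow> (\<forall>A\<in>Obj C. nat2 ?l A = nat2 ?r A)"
      by (rule iffI, rule ballI, drule arg_cong[of _ _ nat2], erule fun_cong,
          rule ip_cell2_eqI[OF 1(3) ids(1)])
        (use ip_comp1_unit(1)[of g] in \<open>simp_all add: cells\<close>)
    then show ?thesis
      using jH by (simp add: cells)
  qed
  ultimately show ?thesis
    by (auto simp: IP.is_coalgebra_def IP.wl_def IP.wr_def)
qed (auto simp: IP.is_coalgebra_def)

lemma is_coalgebra_unit: "IP.is_coalgebra T unit1 unit2"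
  by (simp add: is_coalgebra_iff is_ip_cell1_unit1 is_ip_cell2_unit2 counit)

end

section \<open>Extending a coalgebra to the Kleisli object\<close>

locale ip_coalgebra = ip_comonad +
  fixes g j
  assumes coalgebra: "IP.is_coalgebra T g j"
begin

abbreviation "R \<equiv> tgt1 g"
abbreviation "D \<equiv> base R"
abbreviation "G0 A \<equiv> fobj (fun1 g) A"
abbreviation "G1 A B f \<equiv> farr (fun1 g) A B f"
abbreviation "\<theta> A \<equiv> nat2 j A"

lemma coalgebra_cells:
  "is_ip_cell1 g" "src1 g = P" "is_ip_cell2 j" "dom2 j = g" "cod2 j = ip_comp1 g (endo T)"
  using coalgebra by (auto simp: is_coalgebra_iff)

sublocale g: ip_cell1 g
  rewrites "src1 g = P"
  by unfold_locales (rule coalgebra_cells)+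

sublocale j: ip_cell2 j
  rewrites "dom2 j = g" and "cod2 j = ip_comp1 g (endo T)" and "src1 g = P"
  by unfold_locales (rule coalgebra_cells)+

lemma theta_Hom [simp]: "A \<in> Obj C \<Longrightarrow> \<theta> A \<in> Hom D (G0 A) (G0 (K0 A))"
  using j.nat2_Hom[of A] by (simp add: coalgebra_cells)

lemma theta_natural:
  assumes "f \<in> Hom C A B"
  shows "Cmp D (G0 A) (G0 B) (G0 (K0 B)) (\<theta> B) (G1 A B f)
    = Cmp D (G0 A) (G0 (K0 A)) (G0 (K0 B)) (G1 (K0 A) (K0 B) (K1 A B f)) (\<theta> A)"
  using j.nat2_natural[OF assms] assms E.P.C.Hom_ObjD[OF assms] by (simp add: coalgebra_cells)

lemma theta_comult:
  "A \<in> Obj C \<Longrightarrow> Cmp D (G0 A) (G0 (K0 A)) (G0 (K0 (K0 A))) (G1 (K0 A) (K0 (K0 A)) (\<gamma> A)) (\<theta> A)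
    = Cmp D (G0 A) (G0 (K0 A)) (G0 (K0 (K0 A))) (\<theta> (K0 A)) (\<theta> A)"
  using coalgebra by (simp add: is_coalgebra_iff)

lemma theta_coun:
  "A \<in> Obj C \<Longrightarrow> Cmp D (G0 A) (G0 (K0 A)) (G0 A) (G1 (K0 A) A (\<epsilon> A)) (\<theta> A) = Idm D (G0 A)"
  using coalgebra by (simp add: is_coalgebra_iff)

lemma theta_le:
  "A \<in> Obj C \<Longrightarrow> x \<in> fpts P A
    \<Longrightarrow> fle R (G0 A) (nat1 g A x) (reidx R (G0 A) (G0 (K0 A)) (\<theta> A) (nat1 g (K0 A) (\<kappa> A x)))"
  using j.nat2_le[of A x] by (simp add: coalgebra_cells)

definition lift :: "('a, 'b, 'c) ip_cell1" where
  "lift = \<lparr>src1 = kl, tgt1 = R,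
    fun1 = \<lparr>fobj = (\<lambda>A\<in>Obj C. G0 A),
      farr = (\<lambda>A B. \<lambda>f\<in>klHom A B. Cmp D (G0 A) (G0 (K0 A)) (G0 B) (G1 (K0 A) B f) (\<theta> A))\<rparr>,
    nat1 = (\<lambda>A\<in>Obj C. \<lambda>x\<in>klpts A. reidx R (G0 A) (G0 (K0 A)) (\<theta> A) (nat1 g (K0 A) x))\<rparr>"

lemma lift_simps [simp]:
  "src1 lift = kl" "tgt1 lift = R"
  "A \<in> Obj C \<Longrightarrow> fobj (fun1 lift) A = G0 A"
  "f \<in> klHom A B \<Longrightarrow> farr (fun1 lift) A B f = Cmp D (G0 A) (G0 (K0 A)) (G0 B) (G1 (K0 A) B f) (\<theta> A)"
  "A \<in> Obj C \<Longrightarrow> x \<in> klpts A \<Longrightarrow>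
    nat1 lift A x = reidx R (G0 A) (G0 (K0 A)) (\<theta> A) (nat1 g (K0 A) x)"
  by (simp_all add: lift_def)

text \<open>Naturality of \<theta> at \<open>f\<close>, then the comultiplication law of the
  coalgebra. It yields both functoriality of \<open>lift\<close> on arrows and its naturality on
  fibres.\<close>

lemma cokl_theta:
  assumes "A \<in> Obj C" "f \<in> Hom C (K0 A) B"
  shows "Cmp D (G0 A) (G0 (K0 A)) (G0 (K0 B)) (G1 (K0 A) (K0 B) (cokl A B f)) (\<theta> A)
    = Cmp D (G0 A) (G0 B) (G0 (K0 B)) (\<theta> B) (Cmp D (G0 A) (G0 (K0 A)) (G0 B) (G1 (K0 A) B f) (\<theta> A))"
proof -
  have B: "B \<in> Obj C" using assms E.P.C.Hom_ObjD by auto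
  have "Cmp D (G0 A) (G0 B) (G0 (K0 B)) (\<theta> B) (Cmp D (G0 A) (G0 (K0 A)) (G0 B) (G1 (K0 A) B f) (\<theta> A))
    = Cmp D (G0 A) (G0 (K0 A)) (G0 (K0 B)) (Cmp D (G0 (K0 A)) (G0 B) (G0 (K0 B)) (\<theta> B) (G1 (K0 A) B f)) (\<theta> A)"
    using assms B by simp
  also have "\<dots> = Cmp D (G0 A) (G0 (K0 A)) (G0 (K0 B)) (G1 (K0 A) (K0 B) (cokl A B f)) (\<theta> A)"
    unfolding theta_natural[OF assms(2)] using assms B by (simp add: cokl_def theta_comult)
  finally show ?thesis by simp
qed

lemma is_ip_cell1_lift: "is_ip_cell1 lift"
proof (rule is_ip_cell1I)
  show "is_functor (base (src1 lift)) (base (tgt1 lift)) (fun1 lift)"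
  proof (rule is_functorI)
    fix A B E f h assume "f \<in> Hom (base (src1 lift)) A B" "h \<in> Hom (base (src1 lift)) B E"
    then show "farr (fun1 lift) A E (Cmp (base (src1 lift)) A B E h f) =
       Cmp (base (tgt1 lift)) (fobj (fun1 lift) A) (fobj (fun1 lift) B) (fobj (fun1 lift) E)
        (farr (fun1 lift) B E h) (farr (fun1 lift) A B f)"
      by (simp add: cokl_theta)
  qed (auto simp: lift_def is_category_kl g.R.C.is_category_axioms theta_coun)
  fix A B h x assume h: "h \<in> Hom (base (src1 lift)) A B" "x \<in> fpts (src1 lift) B"
  \<comment> \<open>\<open>cl_cokl\<close> ensures that the reindexed element is again a fixed
    point, so that \<open>nat1 lift A\<close> is defined on it.\<close>
  have "nat1 lift A (reidx kl A B h x)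
    = reidx R (G0 A) (G0 (K0 B)) (Cmp D (G0 A) (G0 (K0 A)) (G0 (K0 B)) (G1 (K0 A) (K0 B) (cokl A B h)) (\<theta> A))
        (nat1 g (K0 B) x)"
    using h by (simp add: cl_cokl)
  also have "\<dots> = reidx R (G0 A) (G0 B) (farr (fun1 lift) A B h) (nat1 lift B x)"
    using h by (subst cokl_theta) simp_all
  finally show "nat1 lift A (reidx (src1 lift) A B h x)
    = reidx (tgt1 lift) (fobj (fun1 lift) A) (fobj (fun1 lift) B)
        (farr (fun1 lift) A B h) (nat1 lift B x)"
    using h by simp
qed (auto simp: lift_def is_idxpos_kl g.R.is_idxpos g.nat1_mono g.R.reidx_mono)

text \<open>On fibres one inequality is that of the coalgebra; the other comes from
  \<open>coun_le\<close>, with \<open>theta_coun\<close> cancelling the counit. On arrows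
  \<open>theta_coun\<close> suffices.\<close>

lemma lift_unit1: "ip_comp1 lift unit1 = g"
proof (rule ip_cell1_eqI)
  fix A x assume "A \<in> Obj (base (src1 (ip_comp1 lift unit1)))" "x \<in> fpts (src1 (ip_comp1 lift unit1)) A"
  then have Ax [simp]: "A \<in> Obj C" "x \<in> fpts P A" by simp_all
  have "fle R (G0 A) (reidx R (G0 A) (G0 (K0 A)) (\<theta> A) (nat1 g (K0 A) (\<kappa> A x)))
    (reidx R (G0 A) (G0 (K0 A)) (\<theta> A) (nat1 g (K0 A) (reidx P (K0 A) A (\<epsilon> A) x)))"
    by (intro g.R.reidx_mono g.nat1_mono coun_le theta_Hom) simp_all
  also have "reidx R (G0 A) (G0 (K0 A)) (\<theta> A) (nat1 g (K0 A) (reidx P (K0 A) A (\<epsilon> A) x))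
    = reidx R (G0 A) (G0 A) (Cmp D (G0 A) (G0 (K0 A)) (G0 A) (G1 (K0 A) A (\<epsilon> A)) (\<theta> A)) (nat1 g A x)"
    by simp
  also have "\<dots> = nat1 g A x"
    by (simp add: theta_coun del: g.R.reidx_Cmp)
  finally have "reidx R (G0 A) (G0 (K0 A)) (\<theta> A) (nat1 g (K0 A) (\<kappa> A x)) = nat1 g A x"
    using theta_le[of A x] by (intro g.R.fle_antisym[of "G0 A"]) simp_all
  then show "nat1 (ip_comp1 lift unit1) A x = nat1 g A x"
    by simp
next
  fix A B f assume "f \<in> Hom (base (src1 (ip_comp1 lift unit1))) A B"
  then have "f \<in> Hom C A B" "A \<in> Obj C" "B \<in> Obj C"
    using E.P.C.Hom_ObjD by auto
  then show "farr (fun1 (ip_comp1 lift unit1)) A B f = farr (fun1 g) A B f"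
    by (simp add: theta_coun)
qed (auto simp: is_ip_cell1_comp1 is_ip_cell1_lift is_ip_cell1_unit1 coalgebra_cells)

text \<open>\<open>lift\<close> sends the Kleisli arrow \<open>Idm C (K0 A)\<close> to
  \<open>G1\<close> of an identity after \<open>\<theta> A\<close>, which is
  \<open>\<theta> A\<close>.\<close>

lemma lift_unit2: "ip_hcomp (ip_id2 lift) unit2 = j"
proof (rule ip_cell2_eqI)
  show "cod2 (ip_hcomp (ip_id2 lift) unit2) = cod2 j"
    using ip_comp1_assoc[of "endo T" unit1 lift]
    by (simp add: lift_unit1 coalgebra_cells cells is_ip_cell1_lift is_ip_cell1_unit1)
qed (auto simp: is_ip_cell2_hcomp is_ip_cell2_id2 is_ip_cell1_lift is_ip_cell2_unit2
    coalgebra_cells lift_unit1)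

end

section \<open>Uniqueness and the universal property for 2-cells\<close>

context ip_comonad
begin

text \<open>Arrows are generated by the image of \<open>unit1\<close> and the components of
  \<open>unit2\<close>: the extension of the identity is \<open>\<gamma> A\<close>, which the counit
  law cancels.\<close>

lemma kl_factor:
  assumes "f \<in> klHom A B"
  shows "Cmp (base kl) A (K0 A) B (farr (fun1 unit1) (K0 A) B f) (Idm C (K0 A)) = f"
  using assms by (simp add: counit)

text \<open>Fibres are generated by the values of \<kappa>: the left side is \<open>cl A x\<close>,
  and \<open>x\<close> is a fixed point.\<close>

lemma kl_reidx_kappa:
  assumes "A \<in> Obj C" "x \<in> klpts A"
  shows "reidx kl A (K0 A) (Idm C (K0 A)) (\<kappa> (K0 A) x) = x"
  using assms by (simp flip: cl_def)

text \<open>Hypothesis \<open>1\<close> settles the image of \<open>unit1\<close> and the values of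
  \<kappa>, hypothesis \<open>2\<close> the components of \<open>unit2\<close>; by
  \<open>kl_factor\<close> and \<open>kl_reidx_kappa\<close> these generate everything.\<close>

lemma unit_unique1:
  assumes "is_ip_cell1 h" "is_ip_cell1 h'" "src1 h = kl" "src1 h' = kl" "tgt1 h = tgt1 h'"
    and 1: "ip_comp1 h unit1 = ip_comp1 h' unit1"
    and 2: "ip_hcomp (ip_id2 h) unit2 = ip_hcomp (ip_id2 h') unit2"
  shows "h = h'"
proof (rule ip_cell1_eqI)
  interpret h: ip_cell1 h rewrites "src1 h = kl" by unfold_locales fact+
  interpret h': ip_cell1 h' rewrites "src1 h' = kl" and "tgt1 h' = tgt1 h"
    by unfold_locales (use assms in simp_all)
  show obj: "fobj (fun1 h) A = fobj (fun1 h') A" if "A \<in> Obj (base (src1 h))" for A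
    using fun_cong[OF arg_cong[OF 1, of "\<lambda>f. fobj (fun1 f)"], of A] that assms(3) by simp
  have arr: "farr (fun1 h) A B (farr (fun1 unit1) A B f) = farr (fun1 h') A B (farr (fun1 unit1) A B f)"
    if "f \<in> Hom C A B" for A B f
    using arg_cong[OF 1, of "\<lambda>f'. farr (fun1 f') A B f"] that E.P.C.Hom_ObjD[OF that] by simp
  have u: "farr (fun1 h) A (K0 A) (Idm C (K0 A)) = farr (fun1 h') A (K0 A) (Idm C (K0 A))"
    if "A \<in> Obj C" for A
    using arg_cong[OF 2, of "\<lambda>f. nat2 f A"] that assms(3,4) assms(5)[symmetric] obj
      h.F.farr_Hom[of "Idm C (K0 A)" A "K0 A"] h'.F.farr_Hom[of "Idm C (K0 A)" A "K0 A"] by simp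
  show "farr (fun1 h) A B f = farr (fun1 h') A B f" if "f \<in> Hom (base (src1 h)) A B" for A B f
  proof -
    have f: "f \<in> klHom A B" using that assms(3) by simp
    \<comment> \<open>Kleisli composition stays folded so that functoriality of \<open>h\<close> and
      \<open>h'\<close> splits it into the two generators.\<close>
    have "farr (fun1 h) A B (Cmp (base kl) A (K0 A) B (farr (fun1 unit1) (K0 A) B f) (Idm C (K0 A)))
      = farr (fun1 h') A B (Cmp (base kl) A (K0 A) B (farr (fun1 unit1) (K0 A) B f) (Idm C (K0 A)))"
      using f arr[of f "K0 A" B] u[of A] obj assms(3) by (simp del: kl_simps(4))
    then show ?thesis using kl_factor[OF f] by simp
  qed
  show "nat1 h A x = nat1 h' A x" if "A \<in> Obj (base (src1 h))" "x \<in> fpts (src1 h) A" for A x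
  proof -
    have Ax: "A \<in> Obj C" "x \<in> klpts A" using that assms(3) by simp_all
    have "nat1 h (K0 A) (\<kappa> (K0 A) x) = nat1 h' (K0 A) (\<kappa> (K0 A) x)"
      using arg_cong[OF 1, of "\<lambda>f. nat1 f (K0 A) x"] Ax by simp
    then have "nat1 h A (reidx kl A (K0 A) (Idm C (K0 A)) (\<kappa> (K0 A) x))
      = nat1 h' A (reidx kl A (K0 A) (Idm C (K0 A)) (\<kappa> (K0 A) x))"
      using Ax u[of A] obj assms(3) by (simp del: kl_simps(7))
    then show ?thesis using kl_reidx_kappa[OF Ax] by simp
  qed
qed (use assms in simp_all)

text \<open>\<open>unit1\<close> is the identity on objects, so \<open>b\<close> must have the
  components of \<open>a\<close>. Naturality and the inequality extend from the generators, where
  \<open>a\<close> and \<open>eq\<close> provide them.\<close>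

lemma unit_unique2:
  assumes "is_ip_cell1 h" "is_ip_cell1 h'" "src1 h = kl" "src1 h' = kl" "tgt1 h = tgt1 h'"
    and a: "is_ip_cell2 a" "dom2 a = ip_comp1 h unit1" "cod2 a = ip_comp1 h' unit1"
    and eq: "ip_vcomp (ip_hcomp a (ip_id2 (endo T))) (ip_hcomp (ip_id2 h) unit2)
      = ip_vcomp (ip_hcomp (ip_id2 h') unit2) a"
  shows "\<exists>!b. is_ip_cell2 b \<and> dom2 b = h \<and> cod2 b = h' \<and> ip_hcomp b (ip_id2 unit1) = a"
proof -
  interpret h: ip_cell1 h rewrites "src1 h = kl" by unfold_locales fact+
  interpret h': ip_cell1 h' rewrites "src1 h' = kl" and "tgt1 h' = tgt1 h"
    by unfold_locales (use assms in simp_all)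
  interpret a: ip_cell2 a
    rewrites "dom2 a = ip_comp1 h unit1" and "cod2 a = ip_comp1 h' unit1"
    by unfold_locales fact+
  let ?D = "base (tgt1 h)" and ?H = "fun1 h" and ?H' = "fun1 h'"
  let ?O = "\<lambda>A. fobj (fun1 h) A" and ?O' = "\<lambda>A. fobj (fun1 h') A"
  have a_Hom [simp]: "nat2 a A \<in> Hom ?D (?O A) (?O' A)" if "A \<in> Obj C" for A
    using a.nat2_Hom[of A] that by simp
  have a_le: "fle (tgt1 h) (?O A) (nat1 h A (\<kappa> A x))
      (reidx (tgt1 h) (?O A) (?O' A) (nat2 a A) (nat1 h' A (\<kappa> A x)))"
    if "A \<in> Obj C" "x \<in> fpts P A" for A x
    using a.nat2_le[of A x] that by simp
  have a_nat: "Cmp ?D (?O A) (?O B) (?O' B) (nat2 a B) (farr ?H A B (farr (fun1 unit1) A B f))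
    = Cmp ?D (?O A) (?O' A) (?O' B) (farr ?H' A B (farr (fun1 unit1) A B f)) (nat2 a A)"
    if "f \<in> Hom C A B" for A B f
    using a.nat2_natural[of f A B] that E.P.C.Hom_ObjD[OF that] by simp
  \<comment> \<open>Read at \<open>A\<close>, the hypothesis \<open>eq\<close> is naturality at the
    generator \<open>Idm C (K0 A)\<close>, which is outside the scope of
    \<open>a_nat\<close>.\<close>
  have a_s: "Cmp ?D (?O A) (?O (K0 A)) (?O' (K0 A)) (nat2 a (K0 A)) (farr ?H A (K0 A) (Idm C (K0 A)))
    = Cmp ?D (?O A) (?O' A) (?O' (K0 A)) (farr ?H' A (K0 A) (Idm C (K0 A))) (nat2 a A)"
    if A: "A \<in> Obj C" for A
    using arg_cong[OF eq, of "\<lambda>t. nat2 t A"] A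
      h'.F.farr_Idm[of "K0 A"] assms(3,4) assms(5)[symmetric] a(2,3) by simp
  define b where "b = \<lparr>dom2 = h, cod2 = h', nat2 = nat2 a\<rparr>"
  have b: "is_ip_cell2 b"
  proof (rule is_ip_cell2I)
    fix A B f assume "f \<in> Hom (base (src1 (dom2 b))) A B"
    then have f: "f \<in> klHom A B" by (simp add: b_def assms(3))
    let ?f = "farr (fun1 unit1) (K0 A) B f"
    have f': "?f \<in> klHom (K0 A) B" "Idm C (K0 A) \<in> klHom A (K0 A)"
      using f by auto
    have "Cmp ?D (?O A) (?O B) (?O' B) (nat2 a B)
        (farr ?H A B (Cmp (base kl) A (K0 A) B ?f (Idm C (K0 A))))
      = Cmp ?D (?O A) (?O (K0 A)) (?O' B)
        (Cmp ?D (?O (K0 A)) (?O B) (?O' B) (nat2 a B) (farr ?H (K0 A) B ?f))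
        (farr ?H A (K0 A) (Idm C (K0 A)))"
      using f f' by (simp del: kl_simps(4) unit1_simps)
    also have "\<dots> = Cmp ?D (?O A) (?O' (K0 A)) (?O' B) (farr ?H' (K0 A) B ?f)
      (Cmp ?D (?O A) (?O (K0 A)) (?O' (K0 A)) (nat2 a (K0 A)) (farr ?H A (K0 A) (Idm C (K0 A))))"
      using f f' by (subst a_nat) (simp_all del: kl_simps(4) unit1_simps)
    also have "\<dots> = Cmp ?D (?O A) (?O' A) (?O' B)
        (farr ?H' A B (Cmp (base kl) A (K0 A) B ?f (Idm C (K0 A)))) (nat2 a A)"
      using f f' by (subst a_s) (simp_all del: kl_simps(4) unit1_simps)
    finally show "Cmp (base (tgt1 (dom2 b))) (fobj (fun1 (dom2 b)) A) (fobj (fun1 (dom2 b)) B)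
        (fobj (fun1 (cod2 b)) B) (nat2 b B) (farr (fun1 (dom2 b)) A B f)
      = Cmp (base (tgt1 (dom2 b))) (fobj (fun1 (dom2 b)) A) (fobj (fun1 (cod2 b)) A)
        (fobj (fun1 (cod2 b)) B) (farr (fun1 (cod2 b)) A B f) (nat2 b A)"
      unfolding kl_factor[OF f] by (simp add: b_def)
  next
    fix A x assume "A \<in> Obj (base (src1 (dom2 b)))" "x \<in> fpts (src1 (dom2 b)) A"
    then have Ax: "A \<in> Obj C" "x \<in> klpts A" by (simp_all add: b_def assms(3))
    let ?s = "Idm C (K0 A)" and ?y = "\<kappa> (K0 A) x"
    have s: "?s \<in> klHom A (K0 A)" "?y \<in> klpts (K0 A)"
      using Ax by auto
    \<comment> \<open>The inequality of \<open>a\<close> at \<open>?y\<close> over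
      \<open>K0 A\<close>, reindexed along the image of \<open>?s\<close>; \<open>a_s\<close> then
      moves the bound to \<open>A\<close>.\<close>
    have "fle (tgt1 h) (?O A) (nat1 h A (reidx kl A (K0 A) ?s ?y))
      (reidx (tgt1 h) (?O A) (?O (K0 A)) (farr ?H A (K0 A) ?s)
        (reidx (tgt1 h) (?O (K0 A)) (?O' (K0 A)) (nat2 a (K0 A)) (nat1 h' (K0 A) ?y)))"
      using Ax s by (simp add: h.R.reidx_mono a_le del: kl_simps(7))
    also have "reidx (tgt1 h) (?O A) (?O (K0 A)) (farr ?H A (K0 A) ?s)
        (reidx (tgt1 h) (?O (K0 A)) (?O' (K0 A)) (nat2 a (K0 A)) (nat1 h' (K0 A) ?y))
      = reidx (tgt1 h) (?O A) (?O' (K0 A)) (Cmp ?D (?O A) (?O (K0 A)) (?O' (K0 A)) (nat2 a (K0 A))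
          (farr ?H A (K0 A) ?s)) (nat1 h' (K0 A) ?y)"
      using Ax s by simp
    also have "\<dots> = reidx (tgt1 h) (?O A) (?O' A) (nat2 a A) (nat1 h' A (reidx kl A (K0 A) ?s ?y))"
      using Ax s by (subst a_s) (simp_all del: kl_simps(7))
    finally show "fle (tgt1 (dom2 b)) (fobj (fun1 (dom2 b)) A) (nat1 (dom2 b) A x)
        (reidx (tgt1 (dom2 b)) (fobj (fun1 (dom2 b)) A) (fobj (fun1 (cod2 b)) A) (nat2 b A)
          (nat1 (cod2 b) A x))"
      unfolding kl_reidx_kappa[OF Ax] by (simp add: b_def)
  qed (use assms(1-4) assms(5)[symmetric] a.nat2_ext in \<open>simp_all add: b_def\<close>)
  \<comment> \<open>Whiskering with \<open>unit1\<close> leaves components unchanged, which gives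
    both the equation for \<open>b\<close> and its uniqueness.\<close>
  have whisker: "nat2 (ip_hcomp b' (ip_id2 unit1)) A = nat2 b' A"
    if "is_ip_cell2 b'" "dom2 b' = h" "cod2 b' = h'" "A \<in> Obj C" for b' A
  proof -
    interpret b': ip_cell2 b' rewrites "dom2 b' = h" and "cod2 b' = h'" and "src1 h = kl"
      by unfold_locales (use that assms in simp_all)
    show ?thesis
      using that h'.F.farr_Idm[of A] b'.nat2_Hom[of A] by simp
  qed
  show ?thesis
  proof (rule ex1I[of _ b])
    have "ip_hcomp b (ip_id2 unit1) = a"
    proof (rule ip_cell2_eqI)
      show "is_ip_cell2 (ip_hcomp b (ip_id2 unit1))"
        using b assms(3) by (intro is_ip_cell2_hcomp is_ip_cell2_id2 is_ip_cell1_unit1) (simp_all add: b_def)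
      show "nat2 (ip_hcomp b (ip_id2 unit1)) A = nat2 a A"
        if "A \<in> Obj (base (src1 (dom2 (ip_hcomp b (ip_id2 unit1)))))" for A
        using whisker[OF b, of A] that by (simp add: b_def)
    qed (use a in \<open>simp_all add: b_def\<close>)
    then show "is_ip_cell2 b \<and> dom2 b = h \<and> cod2 b = h' \<and> ip_hcomp b (ip_id2 unit1) = a"
      using b by (simp add: b_def)
  next
    fix b' assume b': "is_ip_cell2 b' \<and> dom2 b' = h \<and> cod2 b' = h' \<and> ip_hcomp b' (ip_id2 unit1) = a"
    show "b' = b"
    proof (rule ip_cell2_eqI)
      show "nat2 b' A = nat2 b A" if "A \<in> Obj (base (src1 (dom2 b')))" for A
        using whisker[of b' A] b' that assms(3) by (simp add: b_def)
    qed (use b b' in \<open>simp_all add: b_def\<close>)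
  qed
qed

theorem is_kleisli_unit: "IP.is_kleisli T unit1 unit2"
  unfolding IP.is_kleisli_def
proof (intro conjI allI ballI impI is_coalgebra_unit)
  fix g j assume "IP.is_coalgebra T g j"
  then interpret ip_coalgebra T g j by unfold_locales
  show "\<exists>!h. h \<in> hom1 IdxPos (Tgt IdxPos unit1) (Tgt IdxPos g) \<and> Comp1 IdxPos h unit1 = g \<and>
    IP.wl h unit2 = j"
  proof (rule ex1I[of _ lift])
    show "lift \<in> hom1 IdxPos (Tgt IdxPos unit1) (Tgt IdxPos g) \<and> Comp1 IdxPos lift unit1 = g \<and>
      IP.wl lift unit2 = j"
      by (simp add: hom1_iff is_ip_cell1_lift lift_unit1 lift_unit2 IP.wl_def)
    show "h = lift" if "h \<in> hom1 IdxPos (Tgt IdxPos unit1) (Tgt IdxPos g) \<and>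
      Comp1 IdxPos h unit1 = g \<and> IP.wl h unit2 = j" for h
      by (rule unit_unique1)
        (use that in \<open>simp_all add: hom1_iff is_ip_cell1_lift lift_unit1 lift_unit2 IP.wl_def\<close>)
  qed
next
  fix h h' a
  assume "h \<in> Cell1 IdxPos" "h' \<in> Cell1 IdxPos"
    "a \<in> hom2 IdxPos (Comp1 IdxPos h unit1) (Comp1 IdxPos h' unit1)"
    "Src IdxPos h = Tgt IdxPos unit1" "Src IdxPos h' = Tgt IdxPos unit1" "Tgt IdxPos h = Tgt IdxPos h'"
    "VComp IdxPos (IP.wr a (endo T)) (IP.wl h unit2) = VComp IdxPos (IP.wl h' unit2) a"
  then show "\<exists>!b. b \<in> hom2 IdxPos h h' \<and> IP.wr b unit1 = a"
    using unit_unique2[of h h' a] by (simp add: hom2_iff IP.wl_def IP.wr_def conj_assoc)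
qed

end

theorem proposition2p19:
  shows "\<exists>L. is_left_two_adjoint
           (CmdStar (IdxPos :: (('o, 'a, 'p) idxpos, ('o, 'a, 'p) ip_cell1, ('o, 'a, 'p) ip_cell2) two_cat))
           IdxPos L (Inc IdxPos)"
  by (rule IP.Inc_left_two_adjoint) (metis ip_comonad.intro ip_comonad.is_kleisli_unit)

end
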